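(* There is an absolute constant $\delta>0$ such that the following holds. Let $\psi(t)$ be a function of a positive variable $t$ that increases monotonically to infinity and satisfies $\psi(t)=O(t^{\delta})$ for large $t$. Then for each $\varepsilon>0$ one has $$E_3(X;\psi)\ll X^{1/2+\varepsilon}\psi(X)^2\quad\text{and}\quad E_4(X;\psi)\ll X^{1/4+\varepsilon}\psi(X)^4,$$ where the implied constants may depend on $\varepsilon$ (and on $\psi$).
   Context: Write $e(z)=e^{2\pi i z}$. For $s\in\{3,4\}$ and a positive integer $n$, let $R_s(n)$ denote the number of representations of $n$ as the sum of two squares and $s$ biquadrates, i.e. the number of tuples $(x_1,x_2,y_1,\dots,y_s)$ of natural numbers with $x_1^2+x_2^2+y_1^4+\dots+y_s^4=n$. Define the singular series $$\mathfrak{S}_s(n)=\sum_{q=1}^\infty\sum_{\substack{a=1\\(a,q)=1}}^q\Bigl(q^{-1}\sum_{r=1}^q e(ar^2/q)\Bigr)^2\Bigl(q^{-1}\sum_{r=1}^q e(ar^4/q)\Bigr)^s e(-na/q).$$ Put $c_3=\tfrac{2}{3}\sqrt{2}$ and $c_4=\tfrac14\pi$. For $X\ge1$, let $E_s(X;\psi)$ be the number of integers $n$ with $1\le n\le X$ such that $$\left|R_s(n)-c_s\Gamma(\tfrac54)^4\mathfrak{S}_s(n)n^{s/4}\right|>n^{s/4}\psi(n)^{-1}.$$ *)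

theory Defs
  imports "HOL-Analysis.Analysis" "HOL-Library.Landau_Symbols"
begin

definition e2pi :: "complex \<Rightarrow> complex"
  where "e2pi z = exp (2 * of_real pi * \<i> * z)"

text \<open>"Natural number" means positive integer. The tuple \<open>(y\<^sub>1, \<dots>, y\<^sub>s)\<close> is an
  extensional function on \<open>{1..s}\<close>.\<close>

definition R :: "nat \<Rightarrow> nat \<Rightarrow> nat"
  where "R s n = card {(x1, x2, y). x1 \<in> {1..} \<and> x2 \<in> {1..} \<and> y \<in> {1..s} \<rightarrow>\<^sub>E {1..} \<and>
                         x1\<^sup>2 + x2\<^sup>2 + (\<Sum>i=1..s. y i ^ 4) = n}"

definition mean_exp_sum :: "nat \<Rightarrow> nat \<Rightarrow> nat \<Rightarrow> complex"
  where "mean_exp_sum k q a = inverse (of_nat q) * (\<Sum>r=1..q. e2pi (of_nat a * of_nat r ^ k / of_nat q))"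

definition singular_term :: "nat \<Rightarrow> nat \<Rightarrow> nat \<Rightarrow> complex"
  where "singular_term s n q =
    (\<Sum>a | a \<in> {1..q} \<and> coprime a q.
       mean_exp_sum 2 q a ^ 2 * mean_exp_sum 4 q a ^ s * e2pi (- (of_nat n * of_nat a / of_nat q)))"

text \<open>The summation variable \<open>q\<close> of the series is shifted so as to start at 1. The value is kept
  complex (it is in fact real).\<close>

definition singular_series :: "nat \<Rightarrow> nat \<Rightarrow> complex"
  where "singular_series s n = (\<Sum>q. singular_term s n (Suc q))"

text \<open>This is \<open>c\<^sub>s\<close>, where \<open>c\<^sub>s \<Gamma>(5/4)\<^sup>4 = \<Gamma>(3/2)\<^sup>2 \<Gamma>(5/4)\<^sup>s / \<Gamma>(1 + s/4)\<close>. Only \<open>s = 3\<close> and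
  \<open>s = 4\<close> are meaningful; the second branch is the value for \<open>s = 4\<close>.\<close>

definition main_coeff :: "nat \<Rightarrow> real"
  where "main_coeff s = (if s = 3 then 2 / 3 * sqrt 2 else pi / 4)"

definition E :: "nat \<Rightarrow> (real \<Rightarrow> real) \<Rightarrow> real \<Rightarrow> nat"
  where "E s \<psi> X = card {n :: nat. 1 \<le> n \<and> real n \<le> X \<and>
    cmod (of_nat (R s n) - of_real (main_coeff s * Gamma (5 / 4) ^ 4) * singular_series s n
            * of_real (real n powr (real s / 4)))
      > real n powr (real s / 4) * inverse (\<psi> (real n))}"

end

theory Submission
  imports Defs "HOL-Computational_Algebra.Primes" "HOL-Computational_Algebra.Polynomial_FPS"
    "HOL-Analysis.Kronecker_Approximation_Theorem" "HOL-Real_Asymp.Real_Asymp"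
begin

text \<open>Let \<open>f\<^sub>2, f\<^sub>4\<close> be the exponential sums over squares and biquadrates up to \<open>N\<close>, let \<open>Z\<close> be the
  set of exceptional \<open>n \<in> (N/2, N]\<close> and \<open>K(t) = (\<Sum>n\<in>Z. \<eta>\<^sub>n e(-nt))\<close> with unimodular \<open>\<eta>\<^sub>n\<close>. The circle method
  gives \<open>|Z| N\<^bsup>s/4\<^esup> / \<psi> \<lless> \<integral> |f\<^sub>2\<^sup>2 f\<^sub>4\<^sup>s K|\<close> over the minor arcs. One factor \<open>f\<^sub>4\<close> is bounded there by Weyl's
  inequality, saving a power of \<open>N\<close>; by Cauchy--Schwarz the rest is at most the geometric mean of
  \<open>\<integral> |f\<^sub>2 f\<^sub>4\<^sup>2|\<^sup>2\<close> and \<open>\<integral> |f\<^sub>2 f\<^sub>4\<^bsup>s-3\<^esup> K|\<^sup>2\<close>. Both count solutions of an equation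
  \<open>x\<^sup>2 - y\<^sup>2 = k - k'\<close>, which has \<open>O(N\<^sup>\<epsilon>)\<close> solutions \<open>(x, y)\<close> when \<open>k \<noteq> k'\<close>. The contribution of
  \<open>k \<noteq> k'\<close> to the second integral is quadratic in \<open>|Z|\<close> and is absorbed by the power saving; the
  diagonal one yields \<open>|Z| \<lless> N\<^bsup>(5-s)/4\<^esup> \<psi>\<^sup>2\<close>. The same divisor argument, applied to
  \<open>x\<^sup>4 \<equiv> y\<^sup>4 (mod q)\<close> on average over \<open>q\<close>, makes the singular series converge absolutely with a power
  saving in its tail, so that short major arcs suffice.\<close>

section \<open>Exponential sums over a finite grid and divisor counts\<close>

text \<open>With the trivial bound N^(1/4) for the factor f4 taken out, the term quadratic in |Z|
  has size N^(1/2) * N * N^((s-3)/2) = N^(s/2), exactly that of the left-hand side. So any power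
  saving decides the matter, but it has to pay for \<open>\<psi>\<close>^2, logarithms and divisor
  counts together; hence the small admissible growth of \<open>\<psi>\<close>. The linear term
  leaves N^(3/2 + (s-1)/4 - s/2) = N^((5-s)/4). As the saving covers the N^eps too, one bound
  X^((5-s)/4) \<open>\<psi>\<close>(X)^2 serves both values of s and implies both claims. Constants:
  with arcs of level T = N^(1/64), Weyl's inequality gives f4^2 << N^(1/2 - 7/2000) off the arcs,
  and the tail of the singular series is T^(-1/20) = N^(-1/1280). Both beat the N^(-1/2000) reserved
  for 1/\<open>\<psi>\<close> on a dyadic block. Blocks below X^(1/4) are counted trivially, so
  \<open>\<psi>\<close>(X) <= X^(1/8000) is enough, and the exponent 1/16000 leaves room for the
  implied constant. Biquadrates are read as squares of squares, so that differences of squares also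
  control f4.\<close>

lemma card_divisors_prime_power_mult_le:
  fixes p m :: nat
  assumes "prime p" "m > 0"
  shows "card {d. d dvd p ^ a * m} \<le> (a + 1) * card {d. d dvd m}"
proof -
  have "{d. d dvd p ^ a * m} \<subseteq> (\<lambda>(i, d). p ^ i * d) ` ({..a} \<times> {d. d dvd m})"
  proof
    fix d assume "d \<in> {d. d dvd p ^ a * m}"
    then obtain b c where "d = b * c" "b dvd p ^ a" "c dvd m"
      using division_decomp[of d "p ^ a" m] by auto
    moreover from this obtain i where "i \<le> a" "b = p ^ i"
      using divides_primepow_nat[OF assms(1)] by auto
    ultimately show "d \<in> (\<lambda>(i, d). p ^ i * d) ` ({..a} \<times> {d. d dvd m})"
      by auto
  qed
  moreover have fin: "finite ({..a} \<times> {d. d dvd m})" using assms by auto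
  ultimately have "card {d. d dvd p ^ a * m} \<le> card ({..a} \<times> {d. d dvd m})"
    by (meson card_image_le card_mono finite_imageI le_trans)
  then show ?thesis by (simp add: card_cartesian_product)
qed

text \<open>Primes with p^e >= 2 have a + 1 <= 2^a <= p^(e a) and cost nothing. Each of the finitely
  many others costs at most one constant factor \<open>K\<close>.\<close>

lemma card_divisors_le_powr:
  fixes e :: real
  assumes "e > 0"
  obtains C where "C \<ge> 1" "\<And>n::nat. n > 0 \<Longrightarrow> real (card {d. d dvd n}) \<le> C * real n powr e"
proof -
  \<comment> \<open>Here 1 + x = 2^e <= p^e, so Bernoulli gives p^(e a) >= 1 + a x; the constant K =
    1 + 1/x turns this into K p^(e a) >= 1 + a.\<close>
  define x where "x = (2::real) powr e - 1"
  have x: "x > 0" using assms by (simp add: x_def)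
  define K where "K = 1 + 1 / x"
  have K: "K \<ge> 1" using x by (simp add: K_def)
  define S where "S = {p::nat. real p powr e < 2}"
  have S_fin: "finite S"
  proof -
    have "S \<subseteq> {p. real p \<le> 2 powr (1 / e)}"
    proof
      fix p assume "p \<in> S"
      then have "(real p powr e) powr (1 / e) \<le> 2 powr (1 / e)"
        by (intro powr_mono2) (use assms in \<open>auto simp: S_def\<close>)
      then show "p \<in> {p. real p \<le> 2 powr (1 / e)}"
        using assms by (simp add: powr_powr)
    qed
    moreover have "finite {p. real p \<le> 2 powr (1 / e)}"
      by (rule finite_subset[of _ "{..nat \<lfloor>2 powr (1 / e)\<rfloor>}"]) (auto simp: le_nat_iff le_floor_iff)
    ultimately show ?thesis by (rule finite_subset)
  qed
  have small: "real (a + 1) \<le> K * (real p powr e) ^ a" if "p \<ge> 2" for a p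
  proof -
    have "1 + real a * x \<le> (1 + x) ^ a"
      using Bernoulli_inequality[of x a] x by simp
    then have "K * (1 + real a * x) \<le> K * (1 + x) ^ a"
      using K by simp
    moreover have "K * (1 + real a * x) \<ge> 1 + real a"
      using x by (simp add: K_def field_simps)
    moreover have "(1 + x) ^ a \<le> (real p powr e) ^ a"
      using that assms by (intro power_mono) (auto simp: x_def intro!: powr_mono2)
    ultimately show ?thesis using K
      by (smt (verit, best) mult_left_mono of_nat_1 of_nat_add)
  qed
  have large: "real (a + 1) \<le> (real p powr e) ^ a" if "p \<notin> S" for a p
  proof -
    have "a + 1 \<le> 2 ^ a" by (simp add: Suc_leI)
    then have "real (a + 1) \<le> 2 ^ a"
      by (metis numeral_power_le_of_nat_cancel_iff of_nat_le_iff of_nat_numeral of_nat_power)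
    also have "(2::real) ^ a \<le> (real p powr e) ^ a"
      using that by (intro power_mono) (auto simp: S_def)
    finally show ?thesis .
  qed
  have main: "real (card {d. d dvd n}) \<le> K ^ card {p \<in> S. p dvd n} * real n powr e" if "n > 0" for n :: nat
    using that
  proof (induction n rule: less_induct)
    case (less n)
    show ?case
    proof (cases "n = 1")
      case True
      then show ?thesis using K by simp
    next
      case False
      then obtain p where p: "prime p" "p dvd n" using prime_factor_nat by blast
      have p2: "p \<ge> 2" using p prime_ge_2_nat by blast
      define a where "a = multiplicity p n"
      obtain m where m: "n = p ^ a * m" "\<not> p dvd m"
        using multiplicity_decompose'[of n p] less.prems p not_prime_1 unfolding a_def
        by (metis nat_dvd_1_iff_1 not_gr_zero)
      have a: "a > 0"
        using p less.prems by (simp add: a_def prime_multiplicity_gt_zero_iff)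
      have m0: "m > 0" using less.prems m by (cases m) auto
      have "m < n"
        using m(1) m0 one_less_power[of p a] a p2 by simp
      with less m0 have IH: "real (card {d. d dvd m}) \<le> K ^ card {p \<in> S. p dvd m} * real m powr e"
        by blast
      have npow: "real n powr e = (real p powr e) ^ a * real m powr e"
        using p2 by (simp add: m powr_mult powr_power mult.commute flip: powr_realpow)
          (simp add: powr_powr mult.commute)
      have "real (card {d. d dvd n}) \<le> real (a + 1) * real (card {d. d dvd m})"
        unfolding m(1) of_nat_mult[symmetric] of_nat_le_iff
        by (rule card_divisors_prime_power_mult_le[OF p(1) m0])
      also have "\<dots> \<le> real (a + 1) * (K ^ card {p \<in> S. p dvd m} * real m powr e)"
        using IH by (intro mult_left_mono) auto
      also have "\<dots> \<le> K ^ card {p \<in> S. p dvd n} * real n powr e"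
      proof (cases "p \<in> S")
        case True
        have sub: "{q \<in> S. q dvd m} \<subset> {q \<in> S. q dvd n}"
          using True p m by auto
        then have "card {q \<in> S. q dvd m} < card {q \<in> S. q dvd n}"
          using S_fin by (intro psubset_card_mono) auto
        then have "K * K ^ card {q \<in> S. q dvd m} \<le> K ^ card {q \<in> S. q dvd n}"
          using K power_increasing[of "Suc (card {q \<in> S. q dvd m})" "card {q \<in> S. q dvd n}" K] by simp
        then have "K * (real p powr e) ^ a * (K ^ card {q \<in> S. q dvd m} * real m powr e)
            \<le> K ^ card {q \<in> S. q dvd n} * ((real p powr e) ^ a * real m powr e)"
          using mult_right_mono[of "K * K ^ card {q \<in> S. q dvd m}" "K ^ card {q \<in> S. q dvd n}"
              "(real p powr e) ^ a * real m powr e"]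
          by (simp only: mult_ac) auto
        moreover have "real (a + 1) * (K ^ card {p \<in> S. p dvd m} * real m powr e)
            \<le> K * (real p powr e) ^ a * (K ^ card {q \<in> S. q dvd m} * real m powr e)"
          using K small[OF p2, of a] by (intro mult_right_mono) auto
        ultimately show ?thesis unfolding npow by linarith
      next
        case False
        have sub: "{q \<in> S. q dvd m} \<subseteq> {q \<in> S. q dvd n}"
          using m by auto
        then have "K ^ card {q \<in> S. q dvd m} \<le> K ^ card {q \<in> S. q dvd n}"
          using S_fin K by (intro power_increasing card_mono) auto
        then have "(real p powr e) ^ a * (K ^ card {q \<in> S. q dvd m} * real m powr e)
            \<le> K ^ card {q \<in> S. q dvd n} * ((real p powr e) ^ a * real m powr e)"
          using mult_right_mono[of "K ^ card {q \<in> S. q dvd m}" "K ^ card {q \<in> S. q dvd n}"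
              "(real p powr e) ^ a * real m powr e"]
          by (simp only: mult_ac) auto
        moreover have "real (a + 1) * (K ^ card {p \<in> S. p dvd m} * real m powr e)
            \<le> (real p powr e) ^ a * (K ^ card {q \<in> S. q dvd m} * real m powr e)"
          using K large[OF False, of a] by (intro mult_right_mono) auto
        ultimately show ?thesis unfolding npow by linarith
      qed
      finally show ?thesis .
    qed
  qed
  show thesis
  proof (rule that[of "K ^ card S"])
    show "K ^ card S \<ge> 1" using K by simp
    fix n :: nat assume n: "n > 0"
    have "K ^ card {p \<in> S. p dvd n} \<le> K ^ card S"
      using K S_fin by (intro power_increasing card_mono) auto
    then show "real (card {d. d dvd n}) \<le> K ^ card S * real n powr e"
      using main[OF n] by (meson mult_right_mono order.trans powr_ge_zero)
  qed
qed

section \<open>Additive characters and their orthogonality on a finite grid\<close>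

definition ee :: "real \<Rightarrow> complex"
  where "ee t = cis (2 * pi * t)"

lemma ee_add: "ee (s + t) = ee s * ee t"
  by (simp add: ee_def cis_mult algebra_simps)

lemma ee_diff: "ee (s - t) = ee s * cnj (ee t)"
  by (simp add: ee_def cis_mult algebra_simps cis_cnj)

lemma ee_0 [simp]: "ee 0 = 1"
  by (simp add: ee_def)

lemma norm_ee [simp]: "cmod (ee t) = 1"
  by (simp add: ee_def)

lemma ee_int [simp]: "ee (of_int k) = 1"
  by (simp add: ee_def cis_multiple_2pi Ints_def)

lemma ee_nat [simp]: "ee (of_nat k) = 1"
  using ee_int[of "int k"] by simp

lemma ee_of_nat_mult: "ee (real n * t) = ee t ^ n"
  unfolding ee_def Complex.DeMoivre by (simp add: algebra_simps)

lemma ee_sum: "finite A \<Longrightarrow> ee (\<Sum>i\<in>A. f i) = (\<Prod>i\<in>A. ee (f i))"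
  by (induction A rule: finite_induct) (auto simp: ee_add)

lemma ee_cong_Ints: "s - t \<in> \<int> \<Longrightarrow> ee s = ee t"
  by (metis Ints_cases add.commute diff_add_cancel ee_add ee_int mult.right_neutral)

lemma ee_eq_1_iff: "ee t = 1 \<longleftrightarrow> t \<in> \<int>"
proof
  assume "ee t = 1"
  then have "cos (2 * pi * t) = 1" by (simp add: ee_def complex_eq_iff)
  then obtain k :: int where "2 * pi * t = of_int k * 2 * pi"
    using cos_one_2pi_int by auto
  then have "t = of_int k" by simp
  then show "t \<in> \<int>" by simp
next
  assume "t \<in> \<int>"
  then show "ee t = 1" by (auto elim: Ints_cases)
qed

lemma e2pi_of_real: "e2pi (of_real t) = ee t"
  by (simp add: e2pi_def ee_def cis_conv_exp algebra_simps)

lemma norm_ee_diff_le: "cmod (ee s - ee t) \<le> 2 * pi * \<bar>s - t\<bar>"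
proof -
  have "ee s - ee t = ee t * (ee (s - t) - 1)"
    using ee_add[of t "s - t"] by (simp add: algebra_simps)
  then have "cmod (ee s - ee t) = cmod (exp (\<i> * of_real (2 * pi * (s - t))) - 1)"
    by (simp add: norm_mult ee_def cis_conv_exp)
  also have "\<dots> \<le> \<bar>2 * pi * (s - t)\<bar>"
    using abs_sin_x_le_abs_x[of "pi * (s - t)"] dist_exp_i_1[of "2 * pi * (s - t)"]
    by (simp add: abs_mult)
  finally show ?thesis by (simp add: abs_mult)
qed

lemma sum_ee_roots:
  fixes k :: int
  assumes "M > 0"
  shows "(\<Sum>b<M. ee (of_int k * (real b / real M))) = (if int M dvd k then of_nat M else 0)"
proof -
  have eq: "ee (of_int k * (real b / real M)) = ee (of_int k / real M) ^ b" for b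
    by (simp add: ee_of_nat_mult[symmetric] mult.commute)
  have iff: "ee (of_int k / real M) = 1 \<longleftrightarrow> int M dvd k"
  proof -
    have "of_int k / real M \<in> \<int> \<longleftrightarrow> int M dvd k"
      using of_int_div_of_int_in_Ints_iff[of k "int M", where 'a = real] assms by simp
    then show ?thesis by (simp add: ee_eq_1_iff)
  qed
  show ?thesis
  proof (cases "int M dvd k")
    case True
    then have "(\<Sum>b<M. ee (of_int k * (real b / real M))) = (\<Sum>b<M. 1)"
      using iff by (intro sum.cong refl) (simp only: eq, simp)
    then show ?thesis using True by simp
  next
    case False
    have "ee (of_int k / real M) ^ M = 1"
      using assms by (simp add: ee_of_nat_mult[symmetric])
    then show ?thesis using False iff
      unfolding eq by (simp add: geometric_sum)
  qed
qed

text \<open>Means over the points \<open>b / M\<close> replace integrals over the unit interval: for trigonometric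
  polynomials whose frequencies differ by less than \<open>M\<close> they satisfy the same orthogonality relations.\<close>

definition avg :: "nat \<Rightarrow> (real \<Rightarrow> complex) \<Rightarrow> complex"
  where "avg M f = (\<Sum>b<M. f (real b / real M)) / of_nat M"

text \<open>A translation only contributes a constant phase. Thus sums centred at a/q can be
  averaged exactly even though a/q need not be a grid point.\<close>

lemma avg_ee_shift:
  fixes k :: int
  assumes "\<bar>k\<bar> < int M"
  shows "avg M (\<lambda>t. ee (of_int k * (t - \<theta>))) = (if k = 0 then 1 else 0)"
proof -
  have M: "M > 0" using assms by auto
  have "int M dvd k \<longleftrightarrow> k = 0" using assms zdvd_imp_le[of "int M" "\<bar>k\<bar>"] by auto
  moreover have "avg M (\<lambda>t. ee (of_int k * (t - \<theta>)))
      = (\<Sum>b<M. ee (of_int k * (real b / real M))) * ee (- (of_int k * \<theta>)) / of_nat M"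
    unfolding avg_def sum_distrib_right ee_add[symmetric]
    by (intro arg_cong2[where f = "(/)"] sum.cong refl arg_cong[where f = ee]) (simp add: right_diff_distrib)
  ultimately show ?thesis using M sum_ee_roots[OF M, of k] by simp
qed

lemma avg_ee: "\<bar>k\<bar> < int M \<Longrightarrow> avg M (\<lambda>t. ee (of_int k * t)) = (if k = 0 then 1 else 0)"
  using avg_ee_shift[of k M 0] by simp

lemma avg_sum: "avg M (\<lambda>t. \<Sum>i\<in>I. f i t) = (\<Sum>i\<in>I. avg M (f i))"
  unfolding avg_def sum_divide_distrib by (rule sum.swap)

lemma avg_cmult: "avg M (\<lambda>t. c * f t) = c * avg M f"
  by (simp add: avg_def sum_distrib_left)

lemma avg_diff: "avg M (\<lambda>t. f t - g t) = avg M f - avg M g"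
  by (simp add: avg_def sum_subtractf diff_divide_distrib)

definition ravg :: "nat \<Rightarrow> (real \<Rightarrow> real) \<Rightarrow> real"
  where "ravg M f = (\<Sum>b<M. f (real b / real M)) / real M"

lemma norm_avg_le: "cmod (avg M f) \<le> ravg M (\<lambda>t. cmod (f t))"
  unfolding avg_def ravg_def norm_divide norm_of_nat
  by (intro divide_right_mono norm_sum) auto

lemma ravg_mono: "(\<And>b. b < M \<Longrightarrow> f (real b / real M) \<le> g (real b / real M)) \<Longrightarrow> ravg M f \<le> ravg M g"
  unfolding ravg_def by (intro divide_right_mono sum_mono) auto

lemma ravg_cmult: "ravg M (\<lambda>t. c * f t) = c * ravg M f"
  by (simp add: ravg_def sum_distrib_left)

lemma ravg_add: "ravg M (\<lambda>t. f t + g t) = ravg M f + ravg M g"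
  by (simp add: ravg_def sum.distrib add_divide_distrib)

lemma ravg_sum: "ravg M (\<lambda>t. \<Sum>i\<in>I. f i t) = (\<Sum>i\<in>I. ravg M (f i))"
  unfolding ravg_def sum_divide_distrib by (rule sum.swap)

lemma ravg_nonneg: "(\<And>t. f t \<ge> 0) \<Longrightarrow> ravg M f \<ge> 0"
  unfolding ravg_def by (intro divide_nonneg_nonneg sum_nonneg) auto

lemma ravg_Cauchy_Schwarz: "(ravg M (\<lambda>t. f t * g t))\<^sup>2 \<le> ravg M (\<lambda>t. (f t)\<^sup>2) * ravg M (\<lambda>t. (g t)\<^sup>2)"
  using divide_right_mono[OF Cauchy_Schwarz_ineq_sum[of "\<lambda>b. f (real b / real M)" "\<lambda>b. g (real b / real M)" "{..<M}"],
      of "(real M)\<^sup>2"]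
  by (simp add: ravg_def power_divide) (simp add: power2_eq_square)

lemma of_real_cmod_square: "of_real ((cmod z)\<^sup>2) = z * cnj z"
  using complex_norm_square[of z] by simp

text \<open>The mean square of a trigonometric sum with coefficients of modulus at most 1 is bounded
  by this count, which turns mean values into numbers of solutions of equations.\<close>

definition coincidences :: "'i set \<Rightarrow> ('i \<Rightarrow> int) \<Rightarrow> nat"
  where "coincidences I k = card {(i, j). i \<in> I \<and> j \<in> I \<and> k i = k j}"

text \<open>Expand the square and apply orthogonality. The frequencies may repeat, so the surviving
  diagonal consists of all pairs of indices with equal frequency.\<close>

lemma ravg_trig_sum:
  fixes k :: "'i \<Rightarrow> int"
  assumes fin: "finite I" and bd: "\<And>i j. i \<in> I \<Longrightarrow> j \<in> I \<Longrightarrow> \<bar>k i - k j\<bar> < int M"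
  shows "of_real (ravg M (\<lambda>t. (cmod (\<Sum>i\<in>I. c i * ee (of_int (k i) * (t - \<theta>))))\<^sup>2))
    = (\<Sum>(i, j)\<in>{(i, j). i \<in> I \<and> j \<in> I \<and> k i = k j}. c i * cnj (c j))"
proof -
  have "of_real (ravg M (\<lambda>t. (cmod (\<Sum>i\<in>I. c i * ee (of_int (k i) * (t - \<theta>))))\<^sup>2))
      = avg M (\<lambda>t. \<Sum>(i, j)\<in>I \<times> I. c i * cnj (c j) * ee (of_int (k i - k j) * (t - \<theta>)))"
    unfolding ravg_def avg_def of_real_divide of_real_sum of_real_cmod_square cnj_sum sum_product
      sum.cartesian_product
    by (simp add: left_diff_distrib ee_diff mult_ac case_prod_unfold)
  also have "\<dots> = (\<Sum>p\<in>I \<times> I. c (fst p) * cnj (c (snd p)) * avg M (\<lambda>t. ee (of_int (k (fst p) - k (snd p)) * (t - \<theta>))))"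
    unfolding avg_sum case_prod_unfold avg_cmult ..
  also have "\<dots> = (\<Sum>p\<in>I \<times> I. if k (fst p) = k (snd p) then c (fst p) * cnj (c (snd p)) else 0)"
    by (intro sum.cong refl, subst avg_ee_shift) (auto intro: bd)
  also have "\<dots> = (\<Sum>p\<in>{(i, j). i \<in> I \<and> j \<in> I \<and> k i = k j}. c (fst p) * cnj (c (snd p)))"
    using fin by (intro sum.mono_neutral_cong_right) auto
  finally show ?thesis by (simp add: case_prod_unfold)
qed

lemma ravg_trig_sum_le:
  fixes k :: "'i \<Rightarrow> int"
  assumes fin: "finite I" and bd: "\<And>i j. i \<in> I \<Longrightarrow> j \<in> I \<Longrightarrow> \<bar>k i - k j\<bar> < int M"
    and c: "\<And>i. i \<in> I \<Longrightarrow> cmod (c i) \<le> 1"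
  shows "ravg M (\<lambda>t. (cmod (\<Sum>i\<in>I. c i * ee (of_int (k i) * t)))\<^sup>2) \<le> real (coincidences I k)"
proof -
  let ?D = "{(i, j). i \<in> I \<and> j \<in> I \<and> k i = k j}"
  let ?V = "ravg M (\<lambda>t. (cmod (\<Sum>i\<in>I. c i * ee (of_int (k i) * t)))\<^sup>2)"
  have "?V \<le> cmod (of_real ?V)"
    using abs_ge_self[of ?V] by (simp only: norm_of_real)
  also have "of_real ?V = (\<Sum>p\<in>?D. c (fst p) * cnj (c (snd p)))"
    using ravg_trig_sum[OF fin bd, where c = c and \<theta> = 0] by (simp only: diff_0_right case_prod_unfold)
  also have "cmod \<dots> \<le> of_nat (card ?D) * 1"
  proof (rule sum_norm_bound)
    fix p assume "p \<in> ?D"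
    then have "cmod (c (fst p)) \<le> 1" "cmod (c (snd p)) \<le> 1" using c by auto
    then show "cmod (c (fst p) * cnj (c (snd p))) \<le> 1"
      by (simp add: norm_mult mult_le_one)
  qed
  finally show ?thesis by (simp only: coincidences_def mult_1_right)
qed

section \<open>Coincidences and Weyl differencing\<close>

text \<open>The sum x + y divides h and determines x - y = h / (x + y), hence the pair.\<close>

lemma card_square_differences:
  fixes U :: "nat set" and h :: int
  assumes "finite U" "0 \<notin> U" "h \<noteq> 0"
  shows "card {(x, y). x \<in> U \<and> y \<in> U \<and> (int x)\<^sup>2 - (int y)\<^sup>2 = h} \<le> card {d. d dvd nat \<bar>h\<bar>}"
proof (rule card_inj_on_le)
  let ?S = "{(x, y). x \<in> U \<and> y \<in> U \<and> (int x)\<^sup>2 - (int y)\<^sup>2 = h}"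
  have fac: "int (x + y) * (int x - int y) = h" if "(x, y) \<in> ?S" for x y
    using that by (auto simp: power2_eq_square algebra_simps)
  show "inj_on (\<lambda>(x, y). x + y) ?S"
  proof (rule inj_onI, clarify)
    fix x y x' y'
    assume *: "x \<in> U" "y \<in> U" "x' \<in> U" "y' \<in> U" "x + y = x' + y'"
      "(int x')\<^sup>2 - (int y')\<^sup>2 = (int x)\<^sup>2 - (int y)\<^sup>2" "h = (int x)\<^sup>2 - (int y)\<^sup>2"
    then have "int (x + y) * (int x - int y) = int (x + y) * (int x' - int y')"
      using fac[of x y] fac[of x' y'] by auto
    moreover have "int (x + y) \<noteq> 0" using * assms by (metis add_is_0 of_nat_eq_0_iff)
    ultimately show "x = x' \<and> y = y'" using *(5) by auto
  qed
  show "(\<lambda>(x, y). x + y) ` ?S \<subseteq> {d. d dvd nat \<bar>h\<bar>}"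
  proof clarify
    fix x y assume "x \<in> U" "y \<in> U" "h = (int x)\<^sup>2 - (int y)\<^sup>2"
    then have "int (x + y) dvd h" using fac[of x y] by (metis (mono_tags, lifting) case_prodI dvd_triv_left mem_Collect_eq)
    then show "x + y dvd nat \<bar>(int x)\<^sup>2 - (int y)\<^sup>2\<bar>"
      using \<open>h = _\<close> by (simp only: dvd_nat_abs_iff flip: int_dvd_int_iff) simp
  qed
  show "finite {d. d dvd nat \<bar>h\<bar>}" using assms by (intro finite_divisors_nat) simp
qed

text \<open>In u^2 + k i = v^2 + k j either k i = k j, which forces u = v, or u^2 - v^2 is a given
  nonzero number and has at most D solutions. Iterating this adds one variable at a time to a
  form.\<close>

lemma coincidences_add_square:
  fixes U :: "nat set" and k :: "'i \<Rightarrow> int"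
  assumes U: "finite U" "0 \<notin> U" and I: "finite I"
    and D: "\<And>h. 0 < h \<Longrightarrow> h \<le> H \<Longrightarrow> card {d. d dvd h} \<le> D"
    and H: "\<And>i j. i \<in> I \<Longrightarrow> j \<in> I \<Longrightarrow> \<bar>k i - k j\<bar> \<le> int H"
  shows "coincidences (U \<times> I) (\<lambda>(u, i). (int u)\<^sup>2 + k i) \<le> card U * coincidences I k + D * (card I)\<^sup>2"
proof -
  define C where "C = {(i, j). i \<in> I \<and> j \<in> I \<and> k i = k j}"
  define V where "V h = {(x, y). x \<in> U \<and> y \<in> U \<and> (int x)\<^sup>2 - (int y)\<^sup>2 = h}" for h
  define W where "W = I \<times> I - C"
  have finC: "finite C" by (rule finite_subset[of _ "I \<times> I"]) (auto simp: C_def I)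
  have finV: "finite (V h)" for h by (rule finite_subset[of _ "U \<times> U"]) (auto simp: V_def U)
  have finW: "finite W" by (simp add: W_def I)
  let ?f = "\<lambda>(i, j) (u, v). ((u, i), (v, j))"
  have "{(p, q). p \<in> U \<times> I \<and> q \<in> U \<times> I \<and>
           (case p of (u, i) \<Rightarrow> (int u)\<^sup>2 + k i) = (case q of (u, i) \<Rightarrow> (int u)\<^sup>2 + k i)}
     \<subseteq> (\<lambda>(u, i, j). ((u, i), (u, j))) ` (U \<times> C) \<union> (\<Union>p\<in>W. ?f p ` V (k (snd p) - k (fst p)))" (is "?S \<subseteq> ?A \<union> ?B")
  proof clarify
    fix u i v j
    assume *: "((u, i), (v, j)) \<notin> ?B" "(int u)\<^sup>2 + k i = (int v)\<^sup>2 + k j" "u \<in> U" "i \<in> I" "v \<in> U" "j \<in> I"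
    have "k i = k j"
    proof (rule ccontr)
      assume "k i \<noteq> k j"
      then have "(i, j) \<in> W" "(u, v) \<in> V (k j - k i)"
        using * by (auto simp: W_def C_def V_def)
      then have "((u, i), (v, j)) \<in> ?B" by (intro UN_I[of "(i, j)"]) force+
      with * show False by blast
    qed
    moreover from this have "u = v" using * by simp
    ultimately show "((u, i), (v, j)) \<in> ?A"
      using * by (intro image_eqI[of _ _ "(u, i, j)"]) (auto simp: C_def)
  qed
  then have "coincidences (U \<times> I) (\<lambda>(u, i). (int u)\<^sup>2 + k i) \<le> card (?A \<union> ?B)"
    unfolding coincidences_def using U finC finW finV by (intro card_mono) auto
  also have "\<dots> \<le> card ?A + card ?B" by (rule card_Un_le)
  also have "card ?A \<le> card U * card C"
    using card_image_le[of "U \<times> C"] U finC by (simp add: card_cartesian_product)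
  also have "card ?B \<le> (\<Sum>p\<in>W. card (?f p ` V (k (snd p) - k (fst p))))"
    by (rule card_UN_le[OF finW])
  also have "\<dots> \<le> (\<Sum>p\<in>W. D)"
  proof (rule sum_mono)
    fix p assume p: "p \<in> W"
    then have ne: "k (snd p) - k (fst p) \<noteq> 0" and le: "\<bar>k (snd p) - k (fst p)\<bar> \<le> int H"
      using H by (auto simp: W_def C_def)
    have "card (?f p ` V (k (snd p) - k (fst p))) \<le> card (V (k (snd p) - k (fst p)))"
      by (rule card_image_le[OF finV])
    also have "\<dots> \<le> card {d. d dvd nat \<bar>k (snd p) - k (fst p)\<bar>}"
      unfolding V_def by (rule card_square_differences[OF U ne])
    also have "\<dots> \<le> D" using ne le by (intro D) auto
    finally show "card (?f p ` V (k (snd p) - k (fst p))) \<le> D" .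
  qed
  also have "\<dots> \<le> D * (card I)\<^sup>2"
    using card_mono[of "I \<times> I" W] I by (auto simp: W_def power2_eq_square card_cartesian_product mult.commute)
  finally show ?thesis by (simp add: coincidences_def C_def)
qed

section \<open>Distance to the nearest integer and linear exponential sums\<close>

definition dist_int :: "real \<Rightarrow> real"
  where "dist_int t = \<bar>t - of_int (round t)\<bar>"

lemma dist_int_nonneg [simp]: "dist_int t \<ge> 0" by (simp add: dist_int_def)

lemma dist_int_le: "dist_int t \<le> \<bar>t - of_int k\<bar>"
  unfolding dist_int_def by (rule round_diff_minimal)

lemma dist_int_ge: "(\<And>k::int. x \<le> \<bar>t - of_int k\<bar>) \<Longrightarrow> x \<le> dist_int t"
  by (simp add: dist_int_def)

lemma dist_int_le_half: "dist_int t \<le> 1 / 2"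
  unfolding dist_int_def using of_int_round_abs_le[of t] by (simp add: abs_minus_commute)

lemma dist_int_minus: "dist_int (- t) = dist_int t"
proof -
  have "dist_int (- t) \<le> dist_int t" for t
    using dist_int_le[of "- t" "- round t"] by (simp add: dist_int_def)
  from this[of t] this[of "- t"] show ?thesis by simp
qed

lemma dist_int_0_iff: "dist_int t = 0 \<longleftrightarrow> t \<in> \<int>"
proof
  assume "dist_int t = 0"
  then have "t = of_int (round t)" by (simp add: dist_int_def)
  then show "t \<in> \<int>" by (metis Ints_of_int)
qed (auto simp: dist_int_def elim: Ints_cases)

text \<open>The modulus is 2 |sin(pi y)| for the representative y of t in [-1/2, 1/2]. The sharp
  constant would be 4; the cubic remainder of the sine on |pi y| <= 1.6 already yields 2.\<close>

lemma norm_1_minus_ee_ge: "2 * dist_int t \<le> cmod (1 - ee t)"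
proof -
  define y where "y = t - of_int (round t)"
  have y: "\<bar>y\<bar> \<le> 1 / 2"
    unfolding y_def using of_int_round_abs_le[of t] by (simp add: abs_minus_commute)
  have "ee t = ee y" by (rule ee_cong_Ints) (simp add: y_def)
  moreover have "cmod (1 - ee y) = cmod (exp (\<i> * of_real (2 * pi * y)) - 1)"
    by (simp add: ee_def cis_conv_exp norm_minus_commute)
  ultimately have eq: "cmod (1 - ee t) = 2 * \<bar>sin (pi * y)\<bar>"
    using dist_exp_i_1[of "2 * pi * y"] by simp
  have py: "\<bar>pi * y\<bar> \<le> 1.6"
  proof -
    have "\<bar>pi * y\<bar> \<le> pi * (1 / 2)" unfolding abs_mult using y by (intro mult_mono) auto
    also have "\<dots> \<le> 1.6" using pi_approx by simp
    finally show ?thesis .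
  qed
  have "\<bar>sin (pi * y) - pi * y\<bar> \<le> \<bar>pi * y\<bar> ^ 3 / 6"
    using Maclaurin_sin_bound[of "pi * y" 3]
    by (simp add: numeral_3_eq_3 sin_coeff_def field_simps)
  also have "\<dots> = \<bar>pi * y\<bar> * (\<bar>pi * y\<bar>\<^sup>2 / 6)" by (simp add: power3_eq_cube power2_eq_square)
  also have "\<dots> \<le> \<bar>pi * y\<bar> * (1.6\<^sup>2 / 6)"
    using py by (intro mult_left_mono divide_right_mono power_mono) auto
  finally have "\<bar>sin (pi * y)\<bar> \<ge> \<bar>pi * y\<bar> * (1 - 1.6\<^sup>2 / 6)"
    using abs_triangle_ineq2_sym[of "pi * y" "sin (pi * y)"] by (simp add: field_simps power2_eq_square)
  moreover have "\<bar>pi * y\<bar> * (1 - 1.6\<^sup>2 / 6) \<ge> \<bar>y\<bar>"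
  proof -
    have "pi * (1 - 1.6\<^sup>2 / 6) \<ge> 1" using pi_approx by (simp add: power2_eq_square)
    then show ?thesis using mult_right_mono[of 1 "pi * (1 - 1.6\<^sup>2 / 6)" "\<bar>y\<bar>"] by (simp add: abs_mult mult_ac)
  qed
  ultimately show ?thesis using eq by (simp add: dist_int_def y_def)
qed

lemma norm_geometric_ee_le:
  assumes "dist_int t > 0"
  shows "cmod (\<Sum>x<n. ee (real x * t)) \<le> 1 / dist_int t"
proof -
  have ne: "ee t \<noteq> 1" using assms dist_int_0_iff[of t] by (auto simp: ee_eq_1_iff)
  have "(\<Sum>x<n. ee (real x * t)) = (\<Sum>x<n. ee t ^ x)" by (simp add: ee_of_nat_mult)
  also have "\<dots> = (1 - ee t ^ n) / (1 - ee t)"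
    using ne by (simp add: geometric_sum) (simp add: divide_simps, simp add: algebra_simps)
  finally have "cmod (\<Sum>x<n. ee (real x * t)) = cmod (1 - ee t ^ n) / cmod (1 - ee t)"
    by (simp add: norm_divide)
  also have "\<dots> \<le> 2 / (2 * dist_int t)"
  proof (rule frac_le)
    show "cmod (1 - ee t ^ n) \<le> 2"
      using norm_triangle_ineq4[of 1 "ee t ^ n"] by (simp add: norm_power)
  qed (use assms norm_1_minus_ee_ge in auto)
  finally show ?thesis by simp
qed

text \<open>\<^term>\<open>recip_dist B t\<close> is the minimum of \<open>B\<close> and \<open>1 / dist_int t\<close>, read as \<open>B\<close> when \<open>t\<close> is an integer.\<close>

definition recip_dist :: "nat \<Rightarrow> real \<Rightarrow> real"
  where "recip_dist B t = (if real B * dist_int t \<le> 1 then real B else 1 / dist_int t)"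

lemma recip_dist_le: "recip_dist B t \<le> real B"
  by (auto simp: recip_dist_def divide_simps mult.commute not_le split: if_splits)
     (smt (verit) mult_eq_0_iff dist_int_nonneg)

lemma recip_dist_nonneg: "recip_dist B t \<ge> 0" by (auto simp: recip_dist_def)

lemma recip_dist_le_inverse: "x > 0 \<Longrightarrow> x \<le> dist_int t \<Longrightarrow> recip_dist B t \<le> 1 / x"
  by (auto simp: recip_dist_def divide_simps) (smt (verit) mult_left_mono of_nat_0_le_iff)+

lemma recip_dist_minus: "recip_dist B (- t) = recip_dist B t" by (simp add: recip_dist_def dist_int_minus)

text \<open>Arbitrary integer intervals are allowed because differencing replaces the range by the
  intersection of two translates of it.\<close>

definition abs_interval_sum :: "int \<Rightarrow> int \<Rightarrow> (int \<Rightarrow> real) \<Rightarrow> real"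
  where "abs_interval_sum a b \<phi> = cmod (\<Sum>x\<in>{a..b}. ee (\<phi> x))"

lemma abs_interval_sum_linear_le:
  assumes "b - a + 1 \<le> int B"
  shows "abs_interval_sum a b (\<lambda>x. c + of_int x * t) \<le> recip_dist B t"
proof (cases "real B * dist_int t \<le> 1")
  case True
  have "abs_interval_sum a b (\<lambda>x. c + of_int x * t) \<le> real (card {a..b}) * 1"
    unfolding abs_interval_sum_def by (rule sum_norm_bound) simp
  also have "\<dots> \<le> real B" using assms by simp
  finally show ?thesis using True by (simp add: recip_dist_def)
next
  case False
  then have nz: "dist_int t > 0" using dist_int_nonneg[of t] by (cases "dist_int t = 0") (auto simp del: dist_int_nonneg)
  have "(\<Sum>x\<in>{a..b}. ee (c + of_int x * t)) = (\<Sum>y<nat (b - a + 1). ee (c + of_int (a + int y) * t))"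
    by (rule sum.reindex_bij_witness[of _ "\<lambda>y. a + int y" "\<lambda>x. nat (x - a)"]) auto
  also have "\<dots> = ee (c + of_int a * t) * (\<Sum>y<nat (b - a + 1). ee (real y * t))"
    by (simp add: sum_distrib_left ee_add[symmetric] algebra_simps)
  finally have "abs_interval_sum a b (\<lambda>x. c + of_int x * t) = cmod (\<Sum>y<nat (b - a + 1). ee (real y * t))"
    by (simp add: abs_interval_sum_def norm_mult)
  also have "\<dots> \<le> 1 / dist_int t" by (rule norm_geometric_ee_le[OF nz])
  finally show ?thesis using False by (simp add: recip_dist_def)
qed

text \<open>The differencing step: open the square, write the pair as (x + h, x) and sum over x
  first.\<close>

lemma abs_interval_sum_square_le:
  assumes len: "b - a + 1 \<le> int B"
  shows "(abs_interval_sum a b \<phi>)\<^sup>2 \<le> (\<Sum>h\<in>{- int B..int B}. abs_interval_sum (max a (a - h)) (min b (b - h)) (\<lambda>x. \<phi> (x + h) - \<phi> x))"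
proof -
  define J where "J h = {max a (a - h)..min b (b - h)}" for h
  have "complex_of_real ((abs_interval_sum a b \<phi>)\<^sup>2) = (\<Sum>y\<in>{a..b}. ee (\<phi> y)) * cnj (\<Sum>x\<in>{a..b}. ee (\<phi> x))"
    unfolding abs_interval_sum_def by (rule of_real_cmod_square)
  also have "\<dots> = (\<Sum>(y, x)\<in>{a..b} \<times> {a..b}. ee (\<phi> y - \<phi> x))"
    by (simp add: cnj_sum sum_product sum.cartesian_product ee_diff)
  also have "\<dots> = (\<Sum>(h, x)\<in>Sigma {- int B..int B} J. ee (\<phi> (x + h) - \<phi> x))"
    by (rule sum.reindex_bij_witness[of _ "\<lambda>(h, x). (x + h, x)" "\<lambda>(y, x). (y - x, x)"])
       (use len in \<open>auto simp: J_def\<close>)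
  also have "\<dots> = (\<Sum>h\<in>{- int B..int B}. \<Sum>x\<in>J h. ee (\<phi> (x + h) - \<phi> x))"
    by (rule sum.Sigma[symmetric]) (auto simp: J_def)
  finally have "(abs_interval_sum a b \<phi>)\<^sup>2 = cmod (\<Sum>h\<in>{- int B..int B}. \<Sum>x\<in>J h. ee (\<phi> (x + h) - \<phi> x))"
    by (metis norm_of_real abs_of_nonneg zero_le_power2)
  also have "\<dots> \<le> (\<Sum>h\<in>{- int B..int B}. cmod (\<Sum>x\<in>J h. ee (\<phi> (x + h) - \<phi> x)))"
    by (rule norm_sum)
  finally show ?thesis by (simp add: abs_interval_sum_def J_def)
qed

text \<open>A bound that depends on the shift h only, uniformly over all intervals of length at most
  B, lets the iteration forget the ranges.\<close>

lemma abs_interval_sum_square_le':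
  assumes len: "b - a + 1 \<le> int B"
    and "\<And>h a' b'. h \<in> {- int B..int B} \<Longrightarrow> b' - a' + 1 \<le> int B \<Longrightarrow> abs_interval_sum a' b' (\<lambda>x. \<phi> (x + h) - \<phi> x) \<le> K h"
  shows "(abs_interval_sum a b \<phi>)\<^sup>2 \<le> (\<Sum>h\<in>{- int B..int B}. K h)"
  by (rule order_trans[OF abs_interval_sum_square_le[OF len] sum_mono]) (rule assms(2), use len in auto)

text \<open>Three differencings make the phase linear. Cauchy-Schwarz between them accounts for the
  eighth power, and each of the four factors \<open>3 * real B\<close> bounds the number 2B + 1 of
  shifts.\<close>

lemma weyl_quartic_differences:
  assumes len: "b - a + 1 \<le> int B" and B: "B \<ge> 1"
  shows "abs_interval_sum a b (\<lambda>x. \<alpha> * of_int x ^ 4) ^ 8 \<le> (3 * real B) ^ 4 *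
    (\<Sum>h1\<in>{- int B..int B}. \<Sum>h2\<in>{- int B..int B}. \<Sum>h3\<in>{- int B..int B}. recip_dist B (of_int (24 * h1 * h2 * h3) * \<alpha>))"
proof -
  define H where "H = {- int B..int B}"
  have cH: "real (card H) \<le> 3 * real B" "finite H" using B by (auto simp: H_def)
  define \<phi> where "\<phi> = (\<lambda>x::int. \<alpha> * of_int x ^ 4)"
  define d where "d h f = (\<lambda>x::int. f (x + h) - f x :: real)" for h :: int and f
  define K3 where "K3 h1 h2 h3 = recip_dist B (of_int (24 * h1 * h2 * h3) * \<alpha>)" for h1 h2 h3
  have cube: "abs_interval_sum a b (d h3 (d h2 (d h1 \<phi>))) \<le> K3 h1 h2 h3"
    if "b - a + 1 \<le> int B" for a b h1 h2 h3
  proof -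
    \<comment> \<open>The third difference of x^4 is linear in x with slope 24 h1 h2 h3, so the
      geometric sum bound applies.\<close>
    have "d h3 (d h2 (d h1 \<phi>)) = (\<lambda>x. of_int (12 * h1 * h2 * h3 * (h1 + h2 + h3)) * \<alpha>
        + of_int x * (of_int (24 * h1 * h2 * h3) * \<alpha>))"
      by (rule ext) (simp add: d_def \<phi>_def power4_eq_xxxx algebra_simps)
    then show ?thesis using abs_interval_sum_linear_le[OF that] by (simp add: K3_def)
  qed
  have L2: "(abs_interval_sum a b (d h2 (d h1 \<phi>)))\<^sup>2 \<le> (\<Sum>h3\<in>H. K3 h1 h2 h3)"
    if "b - a + 1 \<le> int B" for a b h1 h2
    unfolding H_def by (rule abs_interval_sum_square_le'[OF that]) (use cube in \<open>auto simp: d_def\<close>)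
  have L1: "abs_interval_sum a b (d h1 \<phi>) ^ 4 \<le> 3 * real B * (\<Sum>h2\<in>H. \<Sum>h3\<in>H. K3 h1 h2 h3)"
    if "b - a + 1 \<le> int B" for a b h1
  proof -
    have "(abs_interval_sum a b (d h1 \<phi>))\<^sup>2 \<le> (\<Sum>h2\<in>H. sqrt (\<Sum>h3\<in>H. K3 h1 h2 h3))"
      unfolding H_def
      by (rule abs_interval_sum_square_le'[OF that])
         (use L2 in \<open>auto simp: d_def H_def intro!: real_le_rsqrt\<close>)
    then have "((abs_interval_sum a b (d h1 \<phi>))\<^sup>2)\<^sup>2 \<le> (\<Sum>h2\<in>H. sqrt (\<Sum>h3\<in>H. K3 h1 h2 h3))\<^sup>2"
      by (intro power_mono) auto
    also have "\<dots> \<le> real (card H) * (\<Sum>h2\<in>H. (sqrt (\<Sum>h3\<in>H. K3 h1 h2 h3))\<^sup>2)"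
      using Cauchy_Schwarz_ineq_sum[of "\<lambda>_. 1" "\<lambda>h2. sqrt (\<Sum>h3\<in>H. K3 h1 h2 h3)" H] by simp
    also have "\<dots> \<le> 3 * real B * (\<Sum>h2\<in>H. (sqrt (\<Sum>h3\<in>H. K3 h1 h2 h3))\<^sup>2)"
      using cH by (intro mult_right_mono sum_nonneg) auto
    also have "(\<Sum>h2\<in>H. (sqrt (\<Sum>h3\<in>H. K3 h1 h2 h3))\<^sup>2) = (\<Sum>h2\<in>H. \<Sum>h3\<in>H. K3 h1 h2 h3)"
      by (intro sum.cong refl real_sqrt_pow2 sum_nonneg) (auto simp: K3_def recip_dist_nonneg)
    finally show ?thesis by simp
  qed
  define R where "R h1 = 3 * real B * (\<Sum>h2\<in>H. \<Sum>h3\<in>H. K3 h1 h2 h3)" for h1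
  have R0: "R h1 \<ge> 0" for h1 unfolding R_def K3_def by (intro mult_nonneg_nonneg sum_nonneg recip_dist_nonneg) auto
  \<comment> \<open>Only fourth powers of the once differenced sums are under control, which puts
    nested roots here; two applications of Cauchy-Schwarz to the sum over h1 remove them.\<close>
  have "(abs_interval_sum a b \<phi>)\<^sup>2 \<le> (\<Sum>h1\<in>H. sqrt (sqrt (R h1)))"
    unfolding H_def
  proof (rule abs_interval_sum_square_le'[OF len])
    fix h a' b' assume *: "b' - a' + 1 \<le> int B"
    have "(abs_interval_sum a' b' (d h \<phi>))\<^sup>2 \<le> sqrt (R h)"
      using L1[OF *, of h] by (intro real_le_rsqrt) (simp add: R_def)
    then show "abs_interval_sum a' b' (\<lambda>x. \<phi> (x + h) - \<phi> x) \<le> sqrt (sqrt (R h))"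
      unfolding d_def by (rule real_le_rsqrt)
  qed
  then have "((abs_interval_sum a b \<phi>)\<^sup>2) ^ 4 \<le> (\<Sum>h1\<in>H. sqrt (sqrt (R h1))) ^ 4"
    by (intro power_mono) auto
  also have "\<dots> = ((\<Sum>h1\<in>H. sqrt (sqrt (R h1)))\<^sup>2)\<^sup>2" by simp
  also have "\<dots> \<le> (real (card H) * (\<Sum>h1\<in>H. sqrt (R h1)))\<^sup>2"
    using Cauchy_Schwarz_ineq_sum[of "\<lambda>_. 1" "\<lambda>h1. sqrt (sqrt (R h1))" H] R0
    by (intro power_mono) auto
  also have "\<dots> \<le> (3 * real B * (\<Sum>h1\<in>H. sqrt (R h1)))\<^sup>2"
    using cH R0 by (intro power_mono mult_right_mono mult_nonneg_nonneg sum_nonneg) auto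
  also have "\<dots> = (3 * real B)\<^sup>2 * (\<Sum>h1\<in>H. sqrt (R h1))\<^sup>2" by (simp add: power_mult_distrib)
  also have "\<dots> \<le> (3 * real B)\<^sup>2 * (3 * real B * (\<Sum>h1\<in>H. R h1))"
  proof (rule mult_left_mono)
    have "(\<Sum>h1\<in>H. sqrt (R h1))\<^sup>2 \<le> real (card H) * (\<Sum>h1\<in>H. R h1)"
      using Cauchy_Schwarz_ineq_sum[of "\<lambda>_. 1" "\<lambda>h1. sqrt (R h1)" H] R0 by simp
    also have "\<dots> \<le> 3 * real B * (\<Sum>h1\<in>H. R h1)"
      using cH R0 by (intro mult_right_mono sum_nonneg) auto
    finally show "(\<Sum>h1\<in>H. sqrt (R h1))\<^sup>2 \<le> 3 * real B * (\<Sum>h1\<in>H. R h1)" .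
  qed auto
  also have "\<dots> = (3 * real B) ^ 4 * (\<Sum>h1\<in>H. \<Sum>h2\<in>H. \<Sum>h3\<in>H. K3 h1 h2 h3)"
    by (simp add: R_def sum_distrib_left[symmetric] power_mult_distrib power4_eq_xxxx power2_eq_square)
  finally show ?thesis by (simp add: \<phi>_def H_def K3_def)
qed

lemma card_int_divisors_le:
  fixes m :: int
  assumes "m \<noteq> 0"
  shows "card {d. d dvd m} \<le> 2 * card {d. d dvd nat \<bar>m\<bar>}"
proof -
  let ?T = "{d. d dvd nat \<bar>m\<bar>}"
  have fin: "finite ?T" using assms by (intro finite_divisors_nat) simp
  have "{d. d dvd m} \<subseteq> int ` ?T \<union> (\<lambda>d. - int d) ` ?T"
  proof
    fix d assume "d \<in> {d. d dvd m}"
    then have "nat \<bar>d\<bar> \<in> ?T" by (simp add: nat_abs_dvd_iff) 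
    moreover have "d = int (nat \<bar>d\<bar>) \<or> d = - int (nat \<bar>d\<bar>)" by linarith
    ultimately show "d \<in> int ` ?T \<union> (\<lambda>d. - int d) ` ?T" by blast
  qed
  then have "card {d. d dvd m} \<le> card (int ` ?T \<union> (\<lambda>d. - int d) ` ?T)"
    using fin by (intro card_mono) auto
  also have "\<dots> \<le> card (int ` ?T) + card ((\<lambda>d. - int d) ` ?T)" by (rule card_Un_le)
  also have "\<dots> \<le> card ?T + card ?T" using fin by (intro add_mono card_image_le)
  finally show ?thesis by simp
qed

text \<open>Group the triples by their product m. At most 27 B^2 triples have m = 0, each
  contributing at most B. For m nonzero, h1 and h2 are signed divisors of m and fix h3, so at most
  (2D)^2 triples share m. The signs of m give a further factor 2, and the factor 24 is absorbed by
  lengthening the range.\<close>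

lemma sum_triple_products_le:
  assumes B: "B \<ge> 1" and D: "\<And>h. 0 < h \<Longrightarrow> h \<le> B ^ 3 \<Longrightarrow> card {d. d dvd h} \<le> D"
  shows "(\<Sum>h1\<in>{- int B..int B}. \<Sum>h2\<in>{- int B..int B}. \<Sum>h3\<in>{- int B..int B}. recip_dist B (of_int (24 * h1 * h2 * h3) * \<alpha>))
    \<le> 81 * real B ^ 3 + 8 * (real D)\<^sup>2 * (\<Sum>m\<in>{1..24 * B ^ 3}. recip_dist B (real m * \<alpha>))"
proof -
  define H where "H = {- int B..int B}"
  define P where "P = H \<times> H \<times> H"
  define \<pi> where "\<pi> = (\<lambda>(h1, h2, h3). h1 * h2 * h3 :: int)"
  define g where "g m = recip_dist B (of_int (24 * m) * \<alpha>)" for m :: int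
  have finH: "finite H" and cH: "card H \<le> 3 * B" using B by (auto simp: H_def)
  have finP: "finite P" by (simp add: P_def finH)
  have g0: "g m \<ge> 0" for m by (simp add: g_def recip_dist_nonneg)
  have "(\<Sum>h1\<in>H. \<Sum>h2\<in>H. \<Sum>h3\<in>H. recip_dist B (of_int (24 * h1 * h2 * h3) * \<alpha>)) = (\<Sum>p\<in>P. g (\<pi> p))"
    unfolding P_def sum.cartesian_product
    by (intro sum.cong refl) (auto simp: g_def \<pi>_def mult_ac)
  also have "\<dots> = (\<Sum>p\<in>{p\<in>P. \<pi> p = 0}. g (\<pi> p)) + (\<Sum>p\<in>{p\<in>P. \<pi> p \<noteq> 0}. g (\<pi> p))"
    by (subst sum.union_disjoint[symmetric]) (auto intro!: sum.cong simp: finP)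
  also have "(\<Sum>p\<in>{p\<in>P. \<pi> p = 0}. g (\<pi> p)) \<le> 81 * real B ^ 3"
  proof -
    let ?Z = "{0} \<times> H \<times> H \<union> H \<times> {0} \<times> H \<union> H \<times> H \<times> {0}"
    have "card {p\<in>P. \<pi> p = 0} \<le> card ?Z"
      by (rule card_mono) (auto simp: finH P_def \<pi>_def)
    also have "\<dots> \<le> card H * card H + card H * card H + card H * card H"
      by (intro order_trans[OF card_Un_le] add_mono) (auto simp: card_cartesian_product)
    also have "\<dots> = 3 * (card H * card H)" by simp
    also have "\<dots> \<le> 3 * ((3 * B) * (3 * B))" using cH by (intro mult_left_mono mult_mono) auto
    finally have "card {p\<in>P. \<pi> p = 0} \<le> 27 * B\<^sup>2" by (simp add: power2_eq_square)
    then have c: "real (card {p\<in>P. \<pi> p = 0}) \<le> 27 * (real B)\<^sup>2"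
      by (metis (mono_tags, lifting) of_nat_le_iff of_nat_mult of_nat_numeral of_nat_power)
    have "(\<Sum>p\<in>{p\<in>P. \<pi> p = 0}. g (\<pi> p)) \<le> real (card {p\<in>P. \<pi> p = 0}) * real B"
      by (rule sum_bounded_above) (auto simp: g_def recip_dist_le)
    also have "\<dots> \<le> (27 * (real B)\<^sup>2) * real B" using c by (intro mult_right_mono) auto
    also have "\<dots> \<le> 81 * real B ^ 3" by (simp add: power2_eq_square power3_eq_cube)
    finally show ?thesis .
  qed
  also have "(\<Sum>p\<in>{p\<in>P. \<pi> p \<noteq> 0}. g (\<pi> p)) \<le> 8 * (real D)\<^sup>2 * (\<Sum>m\<in>{1..24 * B ^ 3}. recip_dist B (real m * \<alpha>))"
  proof -
    define T where "T = {- int (B ^ 3)..int (B ^ 3)} - {0}"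
    have im: "\<pi> ` {p\<in>P. \<pi> p \<noteq> 0} \<subseteq> T"
    proof clarify
      fix h1 h2 h3 assume *: "(h1, h2, h3) \<in> P" "\<pi> (h1, h2, h3) \<noteq> 0"
      then have "\<bar>h1\<bar> * \<bar>h2\<bar> * \<bar>h3\<bar> \<le> int B * int B * int B"
        by (intro mult_mono) (auto simp: P_def H_def)
      then show "\<pi> (h1, h2, h3) \<in> T" using *(2)
        by (simp add: T_def \<pi>_def abs_mult[symmetric] abs_le_iff power3_eq_cube)
    qed
    have fib: "card {p \<in> {p\<in>P. \<pi> p \<noteq> 0}. \<pi> p = m} \<le> 4 * D\<^sup>2" if m: "m \<in> T" for m
    proof -
      have m0: "m \<noteq> 0" and mB: "nat \<bar>m\<bar> \<le> B ^ 3"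
        using m by (auto simp: T_def nat_le_iff simp del: of_nat_power)
      let ?F = "{p \<in> {p\<in>P. \<pi> p \<noteq> 0}. \<pi> p = m}"
      have "card ?F \<le> card ({d. d dvd m} \<times> {d. d dvd m})"
      proof (rule card_inj_on_le)
        show "inj_on (\<lambda>(h1, h2, h3). (h1, h2)) ?F"
          using m0 by (auto simp: inj_on_def \<pi>_def)
        show "(\<lambda>(h1, h2, h3). (h1, h2)) ` ?F \<subseteq> {d. d dvd m} \<times> {d. d dvd m}"
          by (auto simp: \<pi>_def)
      qed (use m0 in auto)
      also have "\<dots> = card {d. d dvd m} * card {d. d dvd m}" by (rule card_cartesian_product)
      also have "\<dots> \<le> (2 * D) * (2 * D)"
        using card_int_divisors_le[OF m0] D[of "nat \<bar>m\<bar>"] m0 mB by (intro mult_mono) auto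
      finally show ?thesis by (simp add: power2_eq_square)
    qed
    have "(\<Sum>p\<in>{p\<in>P. \<pi> p \<noteq> 0}. g (\<pi> p)) = (\<Sum>m\<in>T. \<Sum>p\<in>{p \<in> {p\<in>P. \<pi> p \<noteq> 0}. \<pi> p = m}. g (\<pi> p))"
      by (rule sum.group[symmetric]) (use im finP in \<open>auto simp: T_def\<close>)
    also have "\<dots> = (\<Sum>m\<in>T. real (card {p \<in> {p\<in>P. \<pi> p \<noteq> 0}. \<pi> p = m}) * g m)"
      by (intro sum.cong refl) simp
    also have "\<dots> \<le> (\<Sum>m\<in>T. 4 * (real D)\<^sup>2 * g m)"
    proof (intro sum_mono mult_right_mono g0)
      fix m assume "m \<in> T"
      from fib[OF this] show "real (card {p \<in> {p\<in>P. \<pi> p \<noteq> 0}. \<pi> p = m}) \<le> 4 * (real D)\<^sup>2"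
        by (metis (mono_tags, lifting) of_nat_le_iff of_nat_mult of_nat_numeral of_nat_power)
    qed
    also have "\<dots> = 4 * (real D)\<^sup>2 * (\<Sum>m\<in>T. g m)" by (simp add: sum_distrib_left)
    also have "(\<Sum>m\<in>T. g m) = 2 * (\<Sum>m\<in>{1..B ^ 3}. g (int m))"
    proof -
      have "(\<Sum>m\<in>T. g m) = (\<Sum>m\<in>int ` {1..B ^ 3} \<union> (\<lambda>m. - int m) ` {1..B ^ 3}. g m)"
      proof (rule sum.cong[OF _ refl], rule set_eqI)
        fix m
        have "m \<in> T \<longleftrightarrow> nat \<bar>m\<bar> \<in> {1..B ^ 3}"
          by (auto simp: T_def le_nat_iff nat_le_iff simp del: of_nat_power)
        moreover have "m = int (nat \<bar>m\<bar>) \<or> m = - int (nat \<bar>m\<bar>)" by linarith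
        ultimately have "m \<in> T \<Longrightarrow> m \<in> int ` {1..B ^ 3} \<union> (\<lambda>m. - int m) ` {1..B ^ 3}"
          by blast
        moreover have "m \<in> int ` {1..B ^ 3} \<union> (\<lambda>m. - int m) ` {1..B ^ 3} \<Longrightarrow> nat \<bar>m\<bar> \<in> {1..B ^ 3}"
          by auto
        ultimately show "m \<in> T \<longleftrightarrow> m \<in> int ` {1..B ^ 3} \<union> (\<lambda>m. - int m) ` {1..B ^ 3}"
          using \<open>m \<in> T \<longleftrightarrow> nat \<bar>m\<bar> \<in> {1..B ^ 3}\<close> by blast
      qed
      also have "\<dots> = (\<Sum>m\<in>int ` {1..B ^ 3}. g m) + (\<Sum>m\<in>(\<lambda>m. - int m) ` {1..B ^ 3}. g m)"
        by (rule sum.union_disjoint) auto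
      also have "\<dots> = (\<Sum>m\<in>{1..B ^ 3}. g (int m)) + (\<Sum>m\<in>{1..B ^ 3}. g (- int m))"
        by (simp add: sum.reindex inj_on_def)
      also have "(\<Sum>m\<in>{1..B ^ 3}. g (- int m)) = (\<Sum>m\<in>{1..B ^ 3}. g (int m))"
        using recip_dist_minus by (intro sum.cong refl) (simp add: g_def)
      finally show ?thesis by simp
    qed
    also have "(\<Sum>m\<in>{1..B ^ 3}. g (int m)) = (\<Sum>m\<in>(\<lambda>m. 24 * m) ` {1..B ^ 3}. recip_dist B (real m * \<alpha>))"
      by (simp add: sum.reindex inj_on_def g_def)
    also have "\<dots> \<le> (\<Sum>m\<in>{1..24 * B ^ 3}. recip_dist B (real m * \<alpha>))"
      by (rule sum_mono2) (auto simp: recip_dist_nonneg)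
    finally show ?thesis by (simp add: mult_left_mono)
  qed
  finally show ?thesis by (simp add: H_def)
qed

section \<open>Weyl's inequality for biquadrates\<close>

lemma sum_inverse_le_ln: "n \<ge> 1 \<Longrightarrow> (\<Sum>t\<in>{1..n}. 1 / real t) \<le> 1 + ln (real n)"
proof (induction n rule: dec_induct)
  case (step n)
  have "ln (real n / real (Suc n)) \<le> real n / real (Suc n) - 1"
    using step by (intro ln_le_minus_one) auto
  also have "\<dots> = - (1 / real (Suc n))" by (simp add: field_simps)
  finally have "1 / real (Suc n) \<le> ln (real (Suc n)) - ln (real n)"
    using step by (simp add: ln_div)
  then show ?case using step by simp
qed simp

text \<open>Up to an error of 2/q, the numbers (m0 + j) \<alpha> are congruent modulo 1 to
  \<open>r j / q\<close>, and \<open>r\<close> permutes the residues modulo q because a is coprime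
  to q. Residues within 2 of a multiple of q take the trivial bound B; the others form two harmonic
  sums.\<close>

lemma sum_recip_dist_block_le:
  fixes a :: int
  assumes q: "q \<ge> 1" and cop: "coprime a (int q)" and ap: "\<bar>\<alpha> - of_int a / real q\<bar> \<le> 1 / (real q)\<^sup>2"
  shows "(\<Sum>j<q. recip_dist B (real (m0 + j) * \<alpha>)) \<le> 5 * real B + 2 * real q * (1 + ln (real q))"
proof -
  \<comment> \<open>Rounding m0 \<alpha> to the grid of q-th parts costs at most 1/q, and replacing
    j \<alpha> by j a/q costs another 1/q. Together these are the 2 subtracted in
    \<open>g\<close>.\<close>
  define k0 where "k0 = \<lfloor>real m0 * \<alpha> * real q\<rfloor>"
  define r where "r j = nat ((k0 + int j * a) mod int q)" for j
  define g where "g r = (if 3 \<le> r \<and> r + 3 \<le> q then real q / (real (min r (q - r)) - 2) else real B)" for r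
  have key: "recip_dist B (real (m0 + j) * \<alpha>) \<le> g (r j)" if j: "j < q" for j
  proof (cases "3 \<le> r j \<and> r j + 3 \<le> q")
    case True
    define \<delta> where "\<delta> = (real m0 * \<alpha> * real q - of_int k0) / real q + real j * (\<alpha> - of_int a / real q)"
    have "\<bar>real j * (\<alpha> - of_int a / real q)\<bar> \<le> real q * (1 / (real q)\<^sup>2)"
      unfolding abs_mult using j ap by (intro mult_mono) auto
    also have "\<dots> = 1 / real q" using q by (simp add: power2_eq_square)
    finally have 1: "\<bar>real j * (\<alpha> - of_int a / real q)\<bar> \<le> 1 / real q" .
    have "\<bar>real m0 * \<alpha> * real q - of_int k0\<bar> \<le> 1" unfolding k0_def by linarith
    then have 2: "\<bar>(real m0 * \<alpha> * real q - of_int k0) / real q\<bar> \<le> 1 / real q"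
      using q by (simp add: divide_right_mono)
    from 1 2 have \<delta>: "\<bar>\<delta>\<bar> \<le> 2 / real q" unfolding \<delta>_def
      by (intro order_trans[OF abs_triangle_ineq]) simp
    define u where "u = (k0 + int j * a) div int q"
    have rj: "int (r j) = k0 + int j * a - int q * u"
      using q by (simp add: r_def u_def minus_mult_div_eq_mod)
    have rj': "real (r j) = of_int k0 + real j * of_int a - real q * of_int u"
      using arg_cong[OF rj, of "of_int :: int \<Rightarrow> real"] by simp
    have eq: "real (m0 + j) * \<alpha> = of_int u + real (r j) / real q + \<delta>"
      using q by (simp add: rj' \<delta>_def field_simps)
    have "(real (min (r j) (q - r j)) - 2) / real q \<le> dist_int (real (m0 + j) * \<alpha>)"
    proof (rule dist_int_ge)
      fix k :: int
      define w where "w = k - u"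
      have "int (min (r j) (q - r j)) \<le> \<bar>int (r j) - int q * w\<bar>"
      proof (cases "w \<le> 0")
        case True
        then have "int q * w \<le> 0" by (simp add: mult_nonneg_nonpos)
        then show ?thesis by linarith
      next
        case False
        then have "int q * 1 \<le> int q * w" by (intro mult_left_mono) auto
        then show ?thesis using \<open>3 \<le> r j \<and> r j + 3 \<le> q\<close> by linarith
      qed
      then have "real (min (r j) (q - r j)) \<le> \<bar>real (r j) - real q * of_int w\<bar>"
        by (metis (mono_tags, lifting) of_int_abs of_int_diff of_int_le_iff of_int_mult of_int_of_nat_eq)
      then have "real (min (r j) (q - r j)) / real q \<le> \<bar>real (r j) - real q * of_int w\<bar> / real q"
        by (intro divide_right_mono) auto
      also have "\<dots> = \<bar>(real (r j) - real q * of_int w) / real q\<bar>" by simp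
      also have "(real (r j) - real q * of_int w) / real q = real (m0 + j) * \<alpha> - of_int k - \<delta>"
        using q unfolding eq by (simp add: w_def field_simps)
      finally show "(real (min (r j) (q - r j)) - 2) / real q \<le> \<bar>real (m0 + j) * \<alpha> - of_int k\<bar>"
        using \<delta> by (simp add: diff_divide_distrib)
    qed
    moreover have "(real (min (r j) (q - r j)) - 2) / real q > 0"
      using True q by (intro divide_pos_pos) auto
    ultimately have "recip_dist B (real (m0 + j) * \<alpha>) \<le> 1 / ((real (min (r j) (q - r j)) - 2) / real q)"
      by (intro recip_dist_le_inverse)
    then show ?thesis using True by (simp add: g_def)
  next
    case False
    then have "g (r j) = real B" unfolding g_def by (rule if_not_P)
    then show ?thesis by (simp only: recip_dist_le)
  qed
  have inj: "inj_on r {..<q}"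
  proof (rule inj_onI)
    fix i j assume ij: "i \<in> {..<q}" "j \<in> {..<q}" "r i = r j"
    then have "(k0 + int i * a) mod int q = (k0 + int j * a) mod int q"
      using q by (simp add: r_def nat_eq_iff2)
    then have "int q dvd (int i - int j) * a"
      by (simp add: mod_eq_dvd_iff algebra_simps)
    then have "int q dvd int i - int j"
      using cop by (simp add: coprime_commute coprime_dvd_mult_left_iff)
    then show "i = j" using ij zdvd_imp_le[of "int q" "\<bar>int i - int j\<bar>"] by (cases "i = j") auto
  qed
  have sub: "r ` {..<q} \<subseteq> {..<q}" using q by (auto simp: r_def nat_less_iff)
  have im: "r ` {..<q} = {..<q}"
    by (rule card_subset_eq) (use sub inj in \<open>auto simp: card_image\<close>)
  have "(\<Sum>j<q. recip_dist B (real (m0 + j) * \<alpha>)) \<le> (\<Sum>j<q. g (r j))"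
    by (rule sum_mono) (use key in auto)
  also have "\<dots> = (\<Sum>s\<in>r ` {..<q}. g s)" by (simp add: sum.reindex[OF inj])
  also have "\<dots> = (\<Sum>s<q. g s)" by (simp add: im)
  \<comment> \<open>\<open>g s\<close> equals one of the two fractions, whichever side of q the
    residue is closer to. Adding both nonnegative terms avoids following the minimum.\<close>
  also have "\<dots> \<le> (\<Sum>s<q. (if s \<in> {0, 1, 2, q - 1, q - 2} then real B else 0)
      + ((if 3 \<le> s then real q / (real s - 2) else 0) + (if s + 3 \<le> q then real q / (real (q - s) - 2) else 0)))"
  proof (rule sum_mono)
    fix s assume s: "s \<in> {..<q}"
    show "g s \<le> (if s \<in> {0, 1, 2, q - 1, q - 2} then real B else 0)
      + ((if 3 \<le> s then real q / (real s - 2) else 0) + (if s + 3 \<le> q then real q / (real (q - s) - 2) else 0))"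
    proof (cases "3 \<le> s \<and> s + 3 \<le> q")
      case True
      then have "s \<noteq> q - 1" "s \<noteq> q - 2" by auto
      then show ?thesis using True by (auto simp: g_def min_def)
    next
      case False
      then have "s \<in> {0, 1, 2, q - 1, q - 2}" using s by auto
      then have "g s = (if s \<in> {0, 1, 2, q - 1, q - 2} then real B else 0)" using False by (auto simp: g_def)
      moreover have "real q / (real s - 2) \<ge> 0" if "3 \<le> s" using that by auto
      moreover have "real q / (real (q - s) - 2) \<ge> 0" if "s + 3 \<le> q" using that by auto
      ultimately show ?thesis by (smt (verit))
    qed
  qed
  also have "\<dots> = (\<Sum>s<q. (if s \<in> {0, 1, 2, q - 1, q - 2} then real B else 0))
      + (\<Sum>s<q. (if 3 \<le> s then real q / (real s - 2) else 0)) + (\<Sum>s<q. (if s + 3 \<le> q then real q / (real (q - s) - 2) else 0))"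
    by (simp add: sum.distrib)
  also have "(\<Sum>s<q. (if s \<in> {0, 1, 2, q - 1, q - 2} then real B else 0)) \<le> 5 * real B"
  proof -
    have "(\<Sum>s<q. (if s \<in> {0, 1, 2, q - 1, q - 2} then real B else 0)) = (\<Sum>s\<in>{..<q} \<inter> {0, 1, 2, q - 1, q - 2}. real B)"
      by (simp only: sum.inter_restrict finite_lessThan)
    also have "\<dots> = real (card ({..<q} \<inter> {0, 1, 2, q - 1, q - 2})) * real B" by simp
    also have "card ({..<q} \<inter> {0, 1, 2, q - 1, q - 2}) \<le> card (set [0, 1, 2, q - 1, q - 2])"
      by (rule card_mono) auto
    also have "\<dots> \<le> 5" using card_length[of "[0, 1, 2, q - 1, q - 2]"] by simp
    finally show ?thesis by (simp add: mult_right_mono)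
  qed
  also have "(\<Sum>s<q. (if 3 \<le> s then real q / (real s - 2) else 0)) \<le> real q * (1 + ln (real q))"
  proof -
    have "(\<Sum>s<q. (if 3 \<le> s then real q / (real s - 2) else 0)) = (\<Sum>s\<in>{3..<q}. real q / (real s - 2))"
      by (rule sum.mono_neutral_cong_right) auto
    also have "\<dots> = (\<Sum>t\<in>{1..<q - 2}. real q / real t)"
      by (rule sum.reindex_bij_witness[of _ "\<lambda>t. t + 2" "\<lambda>s. s - 2"]) (auto simp: of_nat_diff)
    also have "\<dots> \<le> (\<Sum>t\<in>{1..q}. real q / real t)" by (rule sum_mono2) auto
    also have "\<dots> = real q * (\<Sum>t\<in>{1..q}. 1 / real t)" by (simp add: sum_distrib_left)
    also have "\<dots> \<le> real q * (1 + ln (real q))" using sum_inverse_le_ln[OF q] by (intro mult_left_mono) auto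
    finally show ?thesis .
  qed
  also have "(\<Sum>s<q. (if s + 3 \<le> q then real q / (real (q - s) - 2) else 0)) \<le> real q * (1 + ln (real q))"
  proof -
    have "(\<Sum>s<q. (if s + 3 \<le> q then real q / (real (q - s) - 2) else 0)) = (\<Sum>s\<in>{s. s + 3 \<le> q}. real q / (real (q - s) - 2))"
      by (rule sum.mono_neutral_cong_right) auto
    also have "\<dots> = (\<Sum>t\<in>{t. 1 \<le> t \<and> t + 2 \<le> q}. real q / real t)"
      by (rule sum.reindex_bij_witness[of _ "\<lambda>t. q - 2 - t" "\<lambda>s. q - 2 - s"]) (auto simp: of_nat_diff)
    also have "\<dots> \<le> (\<Sum>t\<in>{1..q}. real q / real t)" by (rule sum_mono2) auto
    also have "\<dots> = real q * (\<Sum>t\<in>{1..q}. 1 / real t)" by (simp add: sum_distrib_left)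
    also have "\<dots> \<le> real q * (1 + ln (real q))" using sum_inverse_le_ln[OF q] by (intro mult_left_mono) auto
    finally show ?thesis .
  qed
  finally show ?thesis by simp
qed

lemma sum_recip_dist_le:
  fixes a :: int
  assumes q: "q \<ge> 1" and cop: "coprime a (int q)" and ap: "\<bar>\<alpha> - of_int a / real q\<bar> \<le> 1 / (real q)\<^sup>2"
  shows "(\<Sum>m\<in>{1..K}. recip_dist B (real m * \<alpha>)) \<le> (real K / real q + 1) * (5 * real B + 2 * real q * (1 + ln (real q)))"
proof -
  let ?n = "K div q + 1"
  have "K + 1 \<le> ?n * q"
    using q by (simp add: Suc_leI dividend_less_div_times add.commute)
  then have "(\<Sum>m\<in>{1..K}. recip_dist B (real m * \<alpha>)) \<le> (\<Sum>m<?n * q. recip_dist B (real m * \<alpha>))"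
    by (intro sum_mono2) (auto simp: recip_dist_nonneg)
  also have "\<dots> = (\<Sum>i<?n. \<Sum>j<q. recip_dist B (real (i * q + j) * \<alpha>))"
    unfolding sum.nat_group[symmetric]
  proof (rule sum.cong[OF refl])
    fix i
    show "(\<Sum>m = i * q..<i * q + q. recip_dist B (real m * \<alpha>)) = (\<Sum>j<q. recip_dist B (real (i * q + j) * \<alpha>))"
      by (rule sum.reindex_bij_witness[of _ "\<lambda>j. i * q + j" "\<lambda>m. m - i * q"]) auto
  qed
  also have "\<dots> \<le> (\<Sum>i<?n. 5 * real B + 2 * real q * (1 + ln (real q)))"
    by (intro sum_mono sum_recip_dist_block_le[OF q cop ap])
  also have "\<dots> = real ?n * (5 * real B + 2 * real q * (1 + ln (real q)))" by simp
  also have "\<dots> \<le> (real K / real q + 1) * (5 * real B + 2 * real q * (1 + ln (real q)))"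
  proof (rule mult_right_mono)
    have "real (K div q) * real q \<le> real K"
      by (metis div_times_less_eq_dividend of_nat_le_iff of_nat_mult)
    then show "real ?n \<le> real K / real q + 1" using q by (simp add: field_simps)
    show "5 * real B + 2 * real q * (1 + ln (real q)) \<ge> 0" using q by simp
  qed
  finally show ?thesis .
qed

text \<open>Kept explicit since it is applied twice: with \<alpha> = a/q and B = q to complete sums,
  and with a Dirichlet approximation to \<alpha> on the minor arcs.\<close>

lemma weyl_quartic:
  fixes a :: int
  assumes B: "B \<ge> 1" and D: "\<And>h. 0 < h \<Longrightarrow> h \<le> B ^ 3 \<Longrightarrow> card {d. d dvd h} \<le> D"
    and q: "q \<ge> 1" and cop: "coprime a (int q)" and ap: "\<bar>\<alpha> - of_int a / real q\<bar> \<le> 1 / (real q)\<^sup>2"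
  shows "cmod (\<Sum>x\<in>{1..B}. ee (real x ^ 4 * \<alpha>)) ^ 8 \<le> (3 * real B) ^ 4 * (81 * real B ^ 3 + 8 * (real D)\<^sup>2 *
    ((24 * real B ^ 3 / real q + 1) * (5 * real B + 2 * real q * (1 + ln (real q)))))"
proof -
  have "cmod (\<Sum>x\<in>{1..B}. ee (real x ^ 4 * \<alpha>)) = abs_interval_sum 1 (int B) (\<lambda>x. \<alpha> * of_int x ^ 4)"
    unfolding abs_interval_sum_def
    by (intro arg_cong[where f = cmod] sum.reindex_bij_witness[of _ nat int]) (auto simp: mult.commute)
  then have "cmod (\<Sum>x\<in>{1..B}. ee (real x ^ 4 * \<alpha>)) ^ 8 \<le> (3 * real B) ^ 4 *
    (\<Sum>h1\<in>{- int B..int B}. \<Sum>h2\<in>{- int B..int B}. \<Sum>h3\<in>{- int B..int B}. recip_dist B (of_int (24 * h1 * h2 * h3) * \<alpha>))"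
    using weyl_quartic_differences[of "int B" 1 B \<alpha>] B by simp
  also have "\<dots> \<le> (3 * real B) ^ 4 * (81 * real B ^ 3 + 8 * (real D)\<^sup>2 * (\<Sum>m\<in>{1..24 * B ^ 3}. recip_dist B (real m * \<alpha>)))"
    by (intro mult_left_mono sum_triple_products_le B D) auto
  also have "\<dots> \<le> (3 * real B) ^ 4 * (81 * real B ^ 3 + 8 * (real D)\<^sup>2 *
      ((real (24 * B ^ 3) / real q + 1) * (5 * real B + 2 * real q * (1 + ln (real q)))))"
    by (intro mult_left_mono add_left_mono sum_recip_dist_le[OF q cop ap]) auto
  finally show ?thesis by simp
qed

section \<open>The singular series\<close>

text \<open>One value that can serve as the uniform bound \<open>D\<close> in the counting
  lemmas.\<close>

definition max_divisor_count :: "nat \<Rightarrow> nat"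
  where "max_divisor_count n = Max ((\<lambda>h. card {d. d dvd h}) ` {1..n})"

lemma card_divisors_le_max_divisor_count: "0 < h \<Longrightarrow> h \<le> n \<Longrightarrow> card {d. d dvd h} \<le> max_divisor_count n"
  unfolding max_divisor_count_def by (intro Max_ge) auto

lemma max_divisor_count_ge_1: "n \<ge> 1 \<Longrightarrow> max_divisor_count n \<ge> 1"
  using card_divisors_le_max_divisor_count[of 1 n] by simp

lemma max_divisor_count_le_powr:
  assumes "e > 0"
  obtains C where "C \<ge> 1" "\<And>n. n \<ge> 1 \<Longrightarrow> real (max_divisor_count n) \<le> C * real n powr e"
proof -
  obtain C where C: "C \<ge> 1" "\<And>n::nat. n > 0 \<Longrightarrow> real (card {d. d dvd n}) \<le> C * real n powr e"
    using card_divisors_le_powr[OF assms] by blast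
  show thesis
  proof (rule that[OF C(1)])
    fix n :: nat assume "n \<ge> 1"
    then have "max_divisor_count n \<in> (\<lambda>h. card {d. d dvd h}) ` {1..n}"
      unfolding max_divisor_count_def by (intro Max_in) auto
    then obtain h where h: "h \<in> {1..n}" "max_divisor_count n = card {d. d dvd h}" by auto
    then have "real (max_divisor_count n) \<le> C * real h powr e" using C(2)[of h] by simp
    also have "\<dots> \<le> C * real n powr e"
      using h C(1) assms by (intro mult_left_mono powr_mono2) auto
    finally show "real (max_divisor_count n) \<le> C * real n powr e" .
  qed
qed

section \<open>Complete exponential sums\<close>

lemma mean_exp_sum_altdef:
  "mean_exp_sum k q a = (\<Sum>r\<in>{1..q}. ee (real r ^ k * (real a / real q))) / of_nat q"
proof -
  have "e2pi (of_nat a * of_nat r ^ k / of_nat q) = ee (real r ^ k * (real a / real q))" for r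
    using e2pi_of_real[of "real r ^ k * (real a / real q)"] by (simp add: mult.commute)
  then show ?thesis by (simp add: mean_exp_sum_def field_simps)
qed

lemma norm_mean_exp_sum_le_1: "cmod (mean_exp_sum k q a) \<le> 1"
proof -
  have "cmod (\<Sum>r\<in>{1..q}. ee (real r ^ k * (real a / real q))) \<le> real (card {1..q}) * 1"
    by (rule sum_norm_bound) simp
  then show ?thesis by (simp add: mean_exp_sum_altdef norm_divide divide_le_eq)
qed

text \<open>Weyl's inequality for a full period saves almost q^(1/8). This is weaker than what the
  arithmetic of q would give, but any power saving makes the singular series converge once the
  average over q is used.\<close>

lemma norm_mean_exp_sum_4_le:
  assumes q: "q \<ge> 1" and cop: "coprime a q"
  shows "cmod (mean_exp_sum 4 q a) ^ 8 \<le> 200000 * (real (max_divisor_count (q ^ 3)))\<^sup>2 * (1 + ln (real q)) / real q"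
proof -
  define D where "D = real (max_divisor_count (q ^ 3))"
  define L where "L = 1 + ln (real q)"
  define Q where "Q = real q"
  have D1: "D \<ge> 1" using max_divisor_count_ge_1[of "q ^ 3"] q by (simp add: D_def)
  have L1: "L \<ge> 1" and Q1: "Q \<ge> 1" using q by (auto simp: L_def Q_def)
  have "cmod (\<Sum>x\<in>{1..q}. ee (real x ^ 4 * (real a / real q))) ^ 8 \<le> (3 * Q) ^ 4 * (81 * Q ^ 3 + 8 * D\<^sup>2 *
      ((24 * Q ^ 3 / Q + 1) * (5 * Q + 2 * Q * L)))"
    unfolding D_def L_def Q_def
    by (rule weyl_quartic[OF q card_divisors_le_max_divisor_count q, of _ "int a"])
       (use cop in \<open>auto simp: coprime_int_iff\<close>)
  also have "24 * Q ^ 3 / Q = 24 * Q\<^sup>2" using Q1 by (simp add: power3_eq_cube power2_eq_square)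
  also have "(3 * Q) ^ 4 * (81 * Q ^ 3 + 8 * D\<^sup>2 * ((24 * Q\<^sup>2 + 1) * (5 * Q + 2 * Q * L)))
      \<le> (81 * Q ^ 4) * (81 * (Q ^ 3 * (D\<^sup>2 * L)) + 8 * D\<^sup>2 * ((25 * Q\<^sup>2) * (7 * Q * L)))"
  proof (rule mult_mono)
    have "1 * 1 \<le> D\<^sup>2 * L" using D1 L1 by (intro mult_mono) auto
    then have "Q ^ 3 * 1 \<le> Q ^ 3 * (D\<^sup>2 * L)" using Q1 by (intro mult_left_mono) auto
    moreover have "(24 * Q\<^sup>2 + 1) * (5 * Q + 2 * Q * L) \<le> (25 * Q\<^sup>2) * (7 * Q * L)"
      using Q1 L1 mult_left_mono[of 1 L Q] by (intro mult_mono) auto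
    then have "8 * D\<^sup>2 * ((24 * Q\<^sup>2 + 1) * (5 * Q + 2 * Q * L)) \<le> 8 * D\<^sup>2 * ((25 * Q\<^sup>2) * (7 * Q * L))"
      by (intro mult_left_mono) auto
    ultimately show "81 * Q ^ 3 + 8 * D\<^sup>2 * ((24 * Q\<^sup>2 + 1) * (5 * Q + 2 * Q * L))
        \<le> 81 * (Q ^ 3 * (D\<^sup>2 * L)) + 8 * D\<^sup>2 * ((25 * Q\<^sup>2) * (7 * Q * L))" by linarith
  qed (use Q1 L1 in \<open>auto simp: power_mult_distrib\<close>)
  also have "\<dots> = 119961 * (Q ^ 7 * (D\<^sup>2 * L))" by (simp add: eval_nat_numeral algebra_simps)
  also have "\<dots> \<le> 200000 * (Q ^ 7 * (D\<^sup>2 * L))" using Q1 L1 by (intro mult_right_mono) auto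
  finally have "cmod (\<Sum>x\<in>{1..q}. ee (real x ^ 4 * (real a / real q))) ^ 8 / Q ^ 8 \<le> 200000 * (Q ^ 7 * (D\<^sup>2 * L)) / Q ^ 8"
    by (intro divide_right_mono) auto
  also have "\<dots> = 200000 * D\<^sup>2 * L / Q" using Q1 by (simp add: eval_nat_numeral field_simps)
  finally show ?thesis
    by (simp add: mean_exp_sum_altdef norm_divide power_divide D_def L_def Q_def)
qed

lemma sum_symmetric_int:
  fixes g :: "int \<Rightarrow> real"
  assumes "\<And>m. g (- m) = g m"
  shows "(\<Sum>m\<in>{- int n..int n}. g m) = g 0 + 2 * (\<Sum>m\<in>{1..n}. g (int m))"
proof (induction n)
  case (Suc n)
  have eq: "{- int (Suc n)..int (Suc n)} = insert (- int (Suc n)) (insert (int (Suc n)) {- int n..int n})"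
    by auto
  show ?case unfolding eq using Suc assms[of "int (Suc n)"] by (subst sum.insert; simp)+
qed simp

text \<open>One differencing step suffices for squares. The constant is 43 = 1 + 2 * 3 * (5 + 2):
  the shift 0, then both signs of h, three blocks, and the block bound.\<close>

lemma norm_mean_exp_sum_2_le:
  assumes q: "q \<ge> 1" and cop: "coprime a q"
  shows "(cmod (mean_exp_sum 2 q a))\<^sup>2 \<le> 43 * (1 + ln (real q)) / real q"
proof -
  define \<alpha> where "\<alpha> = real a / real q"
  define L where "L = 1 + ln (real q)"
  have L1: "L \<ge> 1" using q by (auto simp: L_def)
  have "(abs_interval_sum 1 (int q) (\<lambda>x. \<alpha> * of_int x ^ 2))\<^sup>2 \<le> (\<Sum>h\<in>{- int q..int q}. recip_dist q (of_int (2 * h) * \<alpha>))"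
  proof (rule abs_interval_sum_square_le')
    fix h a' b' :: int assume *: "b' - a' + 1 \<le> int q"
    have "(\<lambda>x. \<alpha> * of_int (x + h) ^ 2 - \<alpha> * of_int x ^ 2) = (\<lambda>x. of_int h ^ 2 * \<alpha> + of_int x * (of_int (2 * h) * \<alpha>))"
      by (rule ext) (simp add: power2_eq_square algebra_simps)
    then show "abs_interval_sum a' b' (\<lambda>x. \<alpha> * of_int (x + h) ^ 2 - \<alpha> * of_int x ^ 2) \<le> recip_dist q (of_int (2 * h) * \<alpha>)"
      using abs_interval_sum_linear_le[OF *] by simp
  qed simp
  also have "\<dots> = recip_dist q 0 + 2 * (\<Sum>h\<in>{1..q}. recip_dist q (of_int (2 * int h) * \<alpha>))"
    by (subst sum_symmetric_int) (use recip_dist_minus in \<open>auto simp: mult.assoc\<close>)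
  also have "(\<Sum>h\<in>{1..q}. recip_dist q (of_int (2 * int h) * \<alpha>)) = (\<Sum>m\<in>(\<lambda>h. 2 * h) ` {1..q}. recip_dist q (real m * \<alpha>))"
    by (simp add: sum.reindex inj_on_def)
  also have "\<dots> \<le> (\<Sum>m\<in>{1..2 * q}. recip_dist q (real m * \<alpha>))"
    by (rule sum_mono2) (auto simp: recip_dist_nonneg)
  also have "\<dots> \<le> (real (2 * q) / real q + 1) * (5 * real q + 2 * real q * L)"
    unfolding L_def by (rule sum_recip_dist_le[OF q, of "int a"]) (use cop in \<open>auto simp: \<alpha>_def coprime_int_iff\<close>)
  also have "real (2 * q) / real q + 1 = 3" using q by simp
  also have "recip_dist q 0 + 2 * (3 * (5 * real q + 2 * real q * L)) \<le> 43 * L * real q"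
    using recip_dist_le[of q 0] mult_left_mono[OF L1, of "real q"] by (simp add: algebra_simps)
  finally have "(abs_interval_sum 1 (int q) (\<lambda>x. \<alpha> * of_int x ^ 2))\<^sup>2 / (real q)\<^sup>2 \<le> 43 * L * real q / (real q)\<^sup>2"
    by (simp add: divide_right_mono)
  moreover have "cmod (\<Sum>x\<in>{1..q}. ee (real x ^ 2 * \<alpha>)) = abs_interval_sum 1 (int q) (\<lambda>x. \<alpha> * of_int x ^ 2)"
    unfolding abs_interval_sum_def
    by (intro arg_cong[where f = cmod] sum.reindex_bij_witness[of _ nat int]) (auto simp: mult.commute)
  ultimately show ?thesis
    using q by (simp add: mean_exp_sum_altdef norm_divide power_divide L_def \<alpha>_def power2_eq_square)
qed

definition quartic_pairs :: "nat \<Rightarrow> (nat \<times> nat) set"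
  where "quartic_pairs q = {(x, y). x \<in> {1..q} \<and> y \<in> {1..q} \<and> int q dvd int x ^ 4 - int y ^ 4}"

text \<open>Parseval's identity modulo q. All residues a enter, not only those coprime to q, which
  is what turns the sum into a congruence count.\<close>

lemma sum_norm_mean_exp_sum_4_square:
  assumes q: "q \<ge> 1"
  shows "(\<Sum>a\<in>{1..q}. (cmod (mean_exp_sum 4 q a))\<^sup>2) = real (card (quartic_pairs q)) / real q"
proof -
  define S where "S a = (\<Sum>r\<in>{1..q}. ee (real r ^ 4 * (real a / real q)))" for a
  have "S q = S 0"
    using q by (simp add: S_def) (simp flip: of_nat_power)
  then have "(\<Sum>a\<in>{1..q}. (cmod (S a))\<^sup>2) = (\<Sum>a<q. (cmod (S a))\<^sup>2)"
  proof -
    have "{1..q} = insert q {1..<q}" "{..<q} = insert 0 {1..<q}" using q by auto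
    then show ?thesis using \<open>S q = S 0\<close> by simp
  qed
  also have "complex_of_real \<dots> = (\<Sum>a<q. \<Sum>(x, y)\<in>{1..q} \<times> {1..q}. ee (of_int (int x ^ 4 - int y ^ 4) * (real a / real q)))"
  proof -
    have "S a * cnj (S a) = (\<Sum>(x, y)\<in>{1..q} \<times> {1..q}. ee (of_int (int x ^ 4 - int y ^ 4) * (real a / real q)))" for a
      unfolding S_def cnj_sum sum_product sum.cartesian_product
      by (intro sum.cong refl) (auto simp: left_diff_distrib diff_divide_distrib ee_diff)
    then show ?thesis unfolding of_real_sum of_real_cmod_square by simp
  qed
  also have "\<dots> = (\<Sum>p\<in>{1..q} \<times> {1..q}. \<Sum>a<q. ee (of_int (int (fst p) ^ 4 - int (snd p) ^ 4) * (real a / real q)))"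
    unfolding case_prod_unfold by (rule sum.swap)
  also have "\<dots> = (\<Sum>p\<in>{1..q} \<times> {1..q}. if int q dvd int (fst p) ^ 4 - int (snd p) ^ 4 then of_nat q else 0)"
    using q by (intro sum.cong refl sum_ee_roots) auto
  also have "\<dots> = (\<Sum>p\<in>quartic_pairs q. of_nat q)"
    by (rule sum.mono_neutral_cong_right) (auto simp: quartic_pairs_def)
  also have "\<dots> = complex_of_real (real (card (quartic_pairs q)) * real q)" by simp
  finally have "(\<Sum>a\<in>{1..q}. (cmod (S a))\<^sup>2) = real (card (quartic_pairs q)) * real q"
    by (simp only: of_real_eq_iff)
  moreover have "(\<Sum>a\<in>{1..q}. (cmod (mean_exp_sum 4 q a))\<^sup>2) = (\<Sum>a\<in>{1..q}. (cmod (S a))\<^sup>2) / (real q)\<^sup>2"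
    unfolding sum_divide_distrib
    by (intro sum.cong refl) (simp add: mean_exp_sum_altdef norm_divide power_divide S_def)
  ultimately show ?thesis using q by (simp add: power2_eq_square)
qed

text \<open>Interchange the summations: for fixed x and y distinct, q divides a nonzero integer of
  size at most 16 Q^4, so few q occur. Hence on average over q the congruence has about q^(1+eps)
  solutions, hardly more than the diagonal ones.\<close>

lemma sum_card_quartic_pairs_le:
  assumes Q: "Q \<ge> 1"
  shows "(\<Sum>q\<in>{Q<..2 * Q}. card (quartic_pairs q)) \<le> 2 * Q * Q + 4 * Q\<^sup>2 * max_divisor_count (16 * Q ^ 4)"
proof -
  define P where "P = {1..2 * Q} \<times> {1..2 * Q}"
  define c where "c p = card {q \<in> {Q<..2 * Q}. int q dvd int (fst p) ^ 4 - int (snd p) ^ 4}" for p :: "nat \<times> nat"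
  have "(\<Sum>q\<in>{Q<..2 * Q}. card (quartic_pairs q))
      \<le> (\<Sum>q\<in>{Q<..2 * Q}. card {p \<in> P. int q dvd int (fst p) ^ 4 - int (snd p) ^ 4})"
    by (intro sum_mono card_mono) (auto simp: P_def quartic_pairs_def)
  also have "\<dots> = (\<Sum>q\<in>{Q<..2 * Q}. \<Sum>p\<in>P. if int q dvd int (fst p) ^ 4 - int (snd p) ^ 4 then 1 else 0)"
    by (intro sum.cong refl, subst sum.inter_filter[symmetric]) (auto simp: P_def)
  also have "\<dots> = (\<Sum>p\<in>P. \<Sum>q\<in>{Q<..2 * Q}. if int q dvd int (fst p) ^ 4 - int (snd p) ^ 4 then 1 else 0)"
    by (rule sum.swap)
  also have "\<dots> = (\<Sum>p\<in>P. c p)"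
    by (intro sum.cong refl, subst sum.inter_filter[symmetric]) (auto simp: c_def)
  also have "\<dots> \<le> (\<Sum>p\<in>P. (if fst p = snd p then Q else 0) + max_divisor_count (16 * Q ^ 4))"
  proof (rule sum_mono)
    fix p assume p: "p \<in> P"
    obtain x y where xy: "p = (x, y)" by (cases p)
    show "c p \<le> (if fst p = snd p then Q else 0) + max_divisor_count (16 * Q ^ 4)"
    proof (cases "x = y")
      case True
      have "c p \<le> card {Q<..2 * Q}" unfolding c_def by (rule card_mono) auto
      then show ?thesis using True xy by simp
    next
      case False
      define h where "h = nat \<bar>int x ^ 4 - int y ^ 4\<bar>"
      have ne: "int x ^ 4 - int y ^ 4 \<noteq> 0"
        using False by (simp add: power_eq_iff_eq_base flip: of_nat_power)
      have le: "int z ^ 4 \<le> int (16 * Q ^ 4)" if "z \<in> {1..2 * Q}" for z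
      proof -
        have "z ^ 4 \<le> (2 * Q) ^ 4" using that by (intro power_mono) auto
        also have "\<dots> = 16 * Q ^ 4" by (simp add: power_mult_distrib)
        finally show ?thesis by (metis of_nat_le_iff of_nat_power)
      qed
      have "int x ^ 4 \<le> int (16 * Q ^ 4)" "int y ^ 4 \<le> int (16 * Q ^ 4)" "int x ^ 4 \<ge> 0" "int y ^ 4 \<ge> 0"
        using le p xy by (auto simp: P_def)
      then have h: "0 < h" "h \<le> 16 * Q ^ 4" using ne unfolding h_def by linarith+
      have "c p \<le> card {d. d dvd h}"
        unfolding c_def xy fst_conv snd_conv
      proof (rule card_mono)
        show "finite {d. d dvd h}" using h by (intro finite_divisors_nat)
      qed (auto simp: h_def simp flip: int_dvd_int_iff)
      then show ?thesis using card_divisors_le_max_divisor_count[OF h] by linarith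
    qed
  qed
  also have "\<dots> = card {p \<in> P. fst p = snd p} * Q + card P * max_divisor_count (16 * Q ^ 4)"
    by (simp add: sum.distrib P_def flip: sum.inter_filter)
  also have "card {p \<in> P. fst p = snd p} \<le> 2 * Q"
  proof -
    have "{p \<in> P. fst p = snd p} = (\<lambda>x. (x, x)) ` {1..2 * Q}" by (auto simp: P_def)
    then show ?thesis using card_image_le[of "{1..2 * Q}" "\<lambda>x. (x, x)"] by simp
  qed
  also have "card P = 4 * Q\<^sup>2" by (simp add: P_def power2_eq_square)
  finally show ?thesis by simp
qed

text \<open>Independent of n, and of s as well because the means have modulus at most 1 and s >=
  3.\<close>

definition singular_majorant :: "nat \<Rightarrow> real"
  where "singular_majorant q = (\<Sum>a | a \<in> {1..q} \<and> coprime a q. (cmod (mean_exp_sum 2 q a))\<^sup>2 * cmod (mean_exp_sum 4 q a) ^ 3)"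

lemma singular_majorant_nonneg: "singular_majorant q \<ge> 0"
  unfolding singular_majorant_def by (intro sum_nonneg) auto

lemma norm_singular_term_le:
  assumes "s \<ge> 3"
  shows "cmod (singular_term s n q) \<le> singular_majorant q"
  unfolding singular_term_def singular_majorant_def
proof (rule sum_norm_le)
  fix a
  have "cmod (e2pi (- (of_nat n * of_nat a / of_nat q))) = 1"
    using e2pi_of_real[of "- (real n * real a / real q)"] by (metis norm_ee of_real_divide of_real_minus of_real_mult of_real_of_nat_eq)
  moreover have "cmod (mean_exp_sum 4 q a) ^ s \<le> cmod (mean_exp_sum 4 q a) ^ 3"
    using assms norm_mean_exp_sum_le_1 by (intro power_decreasing) auto
  ultimately show "cmod (mean_exp_sum 2 q a ^ 2 * mean_exp_sum 4 q a ^ s * e2pi (- (of_nat n * of_nat a / of_nat q)))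
      \<le> (cmod (mean_exp_sum 2 q a))\<^sup>2 * cmod (mean_exp_sum 4 q a) ^ 3"
    by (simp add: norm_mult norm_power mult_left_mono)
qed

text \<open>The squares are bounded pointwise by a logarithm over q, one biquadratic factor by V,
  and the remaining two by Parseval. With about q^(1+eps) pairs this is V q^(-1+eps), so a power
  saving in V gives convergence.\<close>

lemma singular_majorant_le:
  assumes q: "q \<ge> 1" and V: "\<And>a. coprime a q \<Longrightarrow> cmod (mean_exp_sum 4 q a) \<le> V"
  shows "singular_majorant q \<le> 43 * (1 + ln (real q)) * V / (real q)\<^sup>2 * real (card (quartic_pairs q))"
proof -
  define W where "W = 43 * (1 + ln (real q)) / real q"
  have W0: "W \<ge> 0" using q by (simp add: W_def)
  have V0: "V \<ge> 0" using order_trans[OF norm_ge_zero V[of 1]] by simp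
  have "singular_majorant q \<le> (\<Sum>a | a \<in> {1..q} \<and> coprime a q. W * (V * (cmod (mean_exp_sum 4 q a))\<^sup>2))"
    unfolding singular_majorant_def
  proof (rule sum_mono)
    fix a assume "a \<in> {a. a \<in> {1..q} \<and> coprime a q}"
    then have cop: "coprime a q" by simp
    have "(cmod (mean_exp_sum 2 q a))\<^sup>2 \<le> W" unfolding W_def by (rule norm_mean_exp_sum_2_le[OF q cop])
    moreover have "cmod (mean_exp_sum 4 q a) ^ 3 \<le> V * (cmod (mean_exp_sum 4 q a))\<^sup>2"
      using mult_right_mono[OF V[OF cop], of "(cmod (mean_exp_sum 4 q a))\<^sup>2"]
      by (simp add: power3_eq_cube power2_eq_square mult.assoc)
    ultimately show "(cmod (mean_exp_sum 2 q a))\<^sup>2 * cmod (mean_exp_sum 4 q a) ^ 3 \<le> W * (V * (cmod (mean_exp_sum 4 q a))\<^sup>2)"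
      using W0 by (intro mult_mono) auto
  qed
  also have "\<dots> \<le> (\<Sum>a\<in>{1..q}. W * (V * (cmod (mean_exp_sum 4 q a))\<^sup>2))"
    using W0 V0 by (intro sum_mono2) auto
  also have "\<dots> = W * V * (real (card (quartic_pairs q)) / real q)"
    using sum_norm_mean_exp_sum_4_square[OF q] by (simp add: sum_distrib_left[symmetric] mult.assoc)
  finally show ?thesis by (simp add: W_def power2_eq_square)
qed

lemma one_plus_ln_le_powr:
  assumes "e > 0" "x \<ge> (1::real)"
  shows "1 + ln x \<le> (1 + 1 / e) * x powr e"
proof -
  have "ln x \<le> x powr e / e" using assms by (intro ln_powr_bound) auto
  moreover have "1 \<le> x powr e" using assms by (simp add: ge_one_powr_ge_zero)
  ultimately show ?thesis by (simp add: algebra_simps)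
qed

lemma sum_dyadic_le:
  fixes h :: "nat \<Rightarrow> real"
  assumes h: "\<And>q. h q \<ge> 0" and C: "C \<ge> 0" and c: "c > 0"
    and dy: "\<And>Q. Q \<ge> 1 \<Longrightarrow> (\<Sum>q\<in>{Q<..2 * Q}. h q) \<le> C * real Q powr - c"
    and Q: "Q \<ge> 1"
  shows "(\<Sum>q\<in>{Q<..m}. h q) \<le> C / (1 - 2 powr - c) * real Q powr - c"
proof -
  define x where "x = (2::real) powr - c"
  have x: "0 \<le> x" "x < 1" using c by (auto simp: x_def powr_less_one)
  have J: "(\<Sum>q\<in>{Q<..2 ^ J * Q}. h q) \<le> C * real Q powr - c * (\<Sum>j<J. x ^ j)" for J
  proof (induction J)
    case (Suc J)
    have "{Q<..2 ^ Suc J * Q} = {Q<..2 ^ J * Q} \<union> {2 ^ J * Q<..2 * (2 ^ J * Q)}"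
      by auto (smt (verit) mult_le_mono1 one_le_numeral one_le_power mult_1 le_trans not_less)
    then have "(\<Sum>q\<in>{Q<..2 ^ Suc J * Q}. h q) = (\<Sum>q\<in>{Q<..2 ^ J * Q}. h q) + (\<Sum>q\<in>{2 ^ J * Q<..2 * (2 ^ J * Q)}. h q)"
      by (simp add: sum.union_disjoint ivl_disj_int)
    also have "(\<Sum>q\<in>{2 ^ J * Q<..2 * (2 ^ J * Q)}. h q) \<le> C * real (2 ^ J * Q) powr - c"
      using Q by (intro dy) simp
    also have "real (2 ^ J * Q) powr - c = x ^ J * real Q powr - c"
      using powr_realpow[of 2 J] powr_powr[of 2 "real J" "- c"] powr_powr[of 2 "- c" "real J"] powr_realpow[of x J]
      by (simp add: x_def powr_mult mult.commute)
    finally show ?case using Suc by (simp add: algebra_simps)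
  qed simp
  have "m \<le> 2 ^ m * Q" using Q less_exp[of m] by (metis le_trans less_or_eq_imp_le mult.right_neutral mult_le_mono2)
  then have "(\<Sum>q\<in>{Q<..m}. h q) \<le> (\<Sum>q\<in>{Q<..2 ^ m * Q}. h q)"
    using h by (intro sum_mono2) auto
  also have "\<dots> \<le> C * real Q powr - c * (\<Sum>j<m. x ^ j)" by (rule J)
  also have "\<dots> \<le> C * real Q powr - c * (1 / (1 - x))"
  proof (rule mult_left_mono)
    have "(\<Sum>j<m. x ^ j) = (1 - x ^ m) / (1 - x)"
      using x by (simp add: geometric_sum) (simp add: divide_simps, simp add: algebra_simps)
    also have "\<dots> \<le> 1 / (1 - x)" using x by (intro divide_right_mono) auto
    finally show "(\<Sum>j<m. x ^ j) \<le> 1 / (1 - x)" .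
  qed (use C in auto)
  finally show ?thesis by (simp add: x_def)
qed

lemma norm_mean_exp_sum_4_le_powr:
  obtains K where "K \<ge> 0" "\<And>q a. q \<ge> 1 \<Longrightarrow> coprime a q \<Longrightarrow> cmod (mean_exp_sum 4 q a) \<le> K * real q powr - (1 / 10)"
proof -
  \<comment> \<open>The exponent 1/35 makes the losses 6/35 from the squared divisor count of q^3
    and 1/35 from the logarithm add up to 1/5. This leaves q^(-4/5), whose eighth root is
    q^(-1/10).\<close>
  obtain C where C: "C \<ge> 1" "\<And>n. n \<ge> 1 \<Longrightarrow> real (max_divisor_count n) \<le> C * real n powr (1 / 35)"
    using max_divisor_count_le_powr[of "1 / 35"] by auto
  define K where "K = 200000 * C\<^sup>2 * 36"
  have K: "K \<ge> 0" by (simp add: K_def)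
  show thesis
  proof (rule that[of "K powr (1 / 8)"])
    fix q a :: nat assume q: "q \<ge> 1" and cop: "coprime a q"
    have q0: "real q > 0" using q by simp
    have "(real (max_divisor_count (q ^ 3)))\<^sup>2 \<le> (C * real (q ^ 3) powr (1 / 35))\<^sup>2"
      using C(2)[of "q ^ 3"] q by (intro power_mono) auto
    also have "real (q ^ 3) powr (1 / 35) = real q powr (3 / 35)"
      using powr_powr[of "real q" 3 "1 / 35"] q0 by simp
    also have "(C * real q powr (3 / 35))\<^sup>2 = C\<^sup>2 * real q powr (6 / 35)"
      using q by (simp add: power_mult_distrib powr_power)
    finally have 1: "(real (max_divisor_count (q ^ 3)))\<^sup>2 \<le> C\<^sup>2 * real q powr (6 / 35)" .
    have 2: "1 + ln (real q) \<le> 36 * real q powr (1 / 35)"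
      using one_plus_ln_le_powr[of "1 / 35" "real q"] q by simp
    have "cmod (mean_exp_sum 4 q a) ^ 8 \<le> 200000 * (real (max_divisor_count (q ^ 3)))\<^sup>2 * (1 + ln (real q)) / real q"
      by (rule norm_mean_exp_sum_4_le[OF q cop])
    also have "\<dots> \<le> 200000 * (C\<^sup>2 * real q powr (6 / 35)) * (36 * real q powr (1 / 35)) / real q"
      using 1 2 q by (intro divide_right_mono mult_mono) auto
    also have "\<dots> = K * (real q powr (6 / 35) * real q powr (1 / 35) / real q powr 1)"
      using q0 by (simp add: K_def)
    also have "\<dots> = K * real q powr - (4 / 5)"
      using powr_diff[of "real q" "1 / 5" 1] q0 by (simp flip: powr_add)
    finally have "(cmod (mean_exp_sum 4 q a) ^ 8) powr (1 / 8) \<le> (K * real q powr - (4 / 5)) powr (1 / 8)"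
      by (intro powr_mono2) auto
    then show "cmod (mean_exp_sum 4 q a) \<le> K powr (1 / 8) * real q powr - (1 / 10)"
      using K powr_powr[of "cmod (mean_exp_sum 4 q a)" 8 "1 / 8"]
      by (cases "mean_exp_sum 4 q a = 0") (simp_all add: powr_mult powr_powr)
  qed simp
qed

text \<open>On a block (Q, 2Q] the pointwise factors give 1/40 - 1/10 - 2 = -83/40 in the exponent
  and the pair count gives 2 + 1/40, in total -1/20. The dyadic blocks are then summed
  geometrically.\<close>

lemma sum_singular_majorant_le:
  obtains K where "K \<ge> 0" "\<And>Q m. Q \<ge> 1 \<Longrightarrow> (\<Sum>q\<in>{Q<..m}. singular_majorant q) \<le> K * real Q powr - (1 / 20)"
proof -
  obtain V where V: "V \<ge> 0" "\<And>q a. q \<ge> 1 \<Longrightarrow> coprime a q \<Longrightarrow> cmod (mean_exp_sum 4 q a) \<le> V * real q powr - (1 / 10)"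
    using norm_mean_exp_sum_4_le_powr by blast
  obtain C where C: "C \<ge> 1" "\<And>n. n \<ge> 1 \<Longrightarrow> real (max_divisor_count n) \<le> C * real n powr (1 / 160)"
    using max_divisor_count_le_powr[of "1 / 160"] by auto
  define K where "K = 43 * 41 * V * (2 + 4 * (C * 2))"
  have K: "K \<ge> 0" using V C by (simp add: K_def)
  have "(\<Sum>q\<in>{Q<..2 * Q}. singular_majorant q) \<le> K * real Q powr - (1 / 20)" if Q: "Q \<ge> 1" for Q
  proof -
    define Y where "Y = real Q"
    have Y: "Y \<ge> 1" using Q by (simp add: Y_def)
    have "singular_majorant q \<le> 43 * 41 * V * Y powr - (83 / 40) * real (card (quartic_pairs q))"
      if "q \<in> {Q<..2 * Q}" for q
    proof -
      have q: "q \<ge> 1" "real q > 0" "real q \<ge> Y" using that Q by (auto simp: Y_def)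
      have "singular_majorant q \<le> 43 * (1 + ln (real q)) * (V * real q powr - (1 / 10)) / (real q)\<^sup>2 * real (card (quartic_pairs q))"
        by (rule singular_majorant_le[OF q(1) V(2)[OF q(1)]])
      also have "\<dots> \<le> 43 * (41 * real q powr (1 / 40)) * (V * real q powr - (1 / 10)) / (real q)\<^sup>2 * real (card (quartic_pairs q))"
        using one_plus_ln_le_powr[of "1 / 40" "real q"] q V
        by (intro mult_right_mono divide_right_mono mult_left_mono) auto
      also have "\<dots> = 43 * 41 * V * (real q powr (1 / 40) * real q powr - (1 / 10) / real q powr 2) * real (card (quartic_pairs q))"
        using q by simp
      also have "real q powr (1 / 40) * real q powr - (1 / 10) / real q powr 2 = real q powr - (83 / 40)"
        by (simp flip: powr_add powr_diff del: powr_numeral)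
      also have "43 * 41 * V * real q powr - (83 / 40) * real (card (quartic_pairs q))
          \<le> 43 * 41 * V * Y powr - (83 / 40) * real (card (quartic_pairs q))"
        using q V Y by (intro mult_right_mono mult_left_mono powr_mono2') auto
      finally show ?thesis .
    qed
    then have "(\<Sum>q\<in>{Q<..2 * Q}. singular_majorant q) \<le> (\<Sum>q\<in>{Q<..2 * Q}. 43 * 41 * V * Y powr - (83 / 40) * real (card (quartic_pairs q)))"
      by (rule sum_mono)
    also have "\<dots> = 43 * 41 * V * Y powr - (83 / 40) * real (\<Sum>q\<in>{Q<..2 * Q}. card (quartic_pairs q))"
      by (simp add: sum_distrib_left)
    also have "\<dots> \<le> 43 * 41 * V * Y powr - (83 / 40) * (Y\<^sup>2 * ((2 + 4 * (C * 2)) * Y powr (1 / 40)))"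
    proof (rule mult_left_mono)
      have "real (\<Sum>q\<in>{Q<..2 * Q}. card (quartic_pairs q)) \<le> real (2 * Q * Q + 4 * Q\<^sup>2 * max_divisor_count (16 * Q ^ 4))"
        using sum_card_quartic_pairs_le[OF Q] by (simp only: of_nat_le_iff)
      also have "\<dots> = Y\<^sup>2 * (2 + 4 * real (max_divisor_count (16 * Q ^ 4)))" by (simp add: Y_def power2_eq_square algebra_simps)
      also have "\<dots> \<le> Y\<^sup>2 * ((2 + 4 * (C * 2)) * Y powr (1 / 40))"
      proof (rule mult_left_mono)
        have "real (max_divisor_count (16 * Q ^ 4)) \<le> C * real (16 * Q ^ 4) powr (1 / 160)"
          using C(2)[of "16 * Q ^ 4"] Q by simp
        also have "real (16 * Q ^ 4) powr (1 / 160) = 16 powr (1 / 160) * Y powr (1 / 40)"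
          using powr_powr[of Y 4 "1 / 160"] Y by (simp add: Y_def powr_mult)
        also have "C * (16 powr (1 / 160) * Y powr (1 / 40)) \<le> C * (2 * Y powr (1 / 40))"
        proof (intro mult_left_mono mult_right_mono)
          have "(16::real) powr (1 / 160) \<le> 16 powr (1 / 4)" by (intro powr_mono) auto
          also have "(16::real) powr (1 / 4) = 2" using powr_powr[of 2 4 "1 / 4"] by simp
          finally show "(16::real) powr (1 / 160) \<le> 2" .
        qed (use C in auto)
        finally have "real (max_divisor_count (16 * Q ^ 4)) \<le> C * 2 * Y powr (1 / 40)" by simp
        moreover have "1 \<le> Y powr (1 / 40)" using Y by (simp add: ge_one_powr_ge_zero)
        ultimately show "2 + 4 * real (max_divisor_count (16 * Q ^ 4)) \<le> (2 + 4 * (C * 2)) * Y powr (1 / 40)"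
          by (simp add: algebra_simps)
      qed auto
      finally show "real (\<Sum>q\<in>{Q<..2 * Q}. card (quartic_pairs q)) \<le> Y\<^sup>2 * ((2 + 4 * (C * 2)) * Y powr (1 / 40))" .
    qed (use V in auto)
    also have "\<dots> = K * (Y powr - (83 / 40) * (Y powr 2 * Y powr (1 / 40)))" using Y by (simp add: K_def)
    also have "Y powr - (83 / 40) * (Y powr 2 * Y powr (1 / 40)) = Y powr - (1 / 20)"
      by (simp flip: powr_add)
    finally show ?thesis by (simp add: Y_def)
  qed
  from sum_dyadic_le[OF singular_majorant_nonneg K _ this]
  have "(\<Sum>q\<in>{Q<..m}. singular_majorant q) \<le> K / (1 - 2 powr - (1 / 20)) * real Q powr - (1 / 20)" if "Q \<ge> 1" for Q m
    using that by simp
  moreover have "K / (1 - 2 powr - (1 / 20)) \<ge> 0" using K powr_less_one[of 2 "- (1 / 20)"] by (intro divide_nonneg_nonneg) auto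
  ultimately show thesis using that by blast
qed

text \<open>The majorant does not involve s or n, so one constant serves uniformly for all tails and
  all partial sums.\<close>

lemma singular_series_truncation:
  obtains K where "K \<ge> 0"
    "\<And>s n Q. s \<ge> 3 \<Longrightarrow> Q \<ge> 1 \<Longrightarrow> cmod (singular_series s n - (\<Sum>q\<in>{1..Q}. singular_term s n q)) \<le> K * real Q powr - (1 / 20)"
    "\<And>s n Q. s \<ge> 3 \<Longrightarrow> Q \<ge> 1 \<Longrightarrow> cmod (\<Sum>q\<in>{1..Q}. singular_term s n q) \<le> K"
proof -
  obtain K where K: "K \<ge> 0" "\<And>Q m. Q \<ge> 1 \<Longrightarrow> (\<Sum>q\<in>{Q<..m}. singular_majorant q) \<le> K * real Q powr - (1 / 20)"
    using sum_singular_majorant_le by blast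
  let ?h = singular_majorant
  have part: "(\<Sum>q\<in>{1..Q}. ?h q) \<le> ?h 1 + K" if "Q \<ge> 1" for Q
  proof -
    have "{1..Q} = insert 1 {1<..Q}" using that by auto
    then show ?thesis using K(2)[of 1 Q] by simp
  qed
  have "(\<Sum>i<m. ?h (Suc i)) \<le> ?h 1 + K" for m
  proof (cases "m \<ge> 1")
    case True
    have "(\<Sum>i<m. ?h (Suc i)) = (\<Sum>q\<in>{1..m}. ?h q)"
      by (rule sum.reindex_bij_witness[of _ "\<lambda>q. q - 1" Suc]) auto
    then show ?thesis using part[OF True] by simp
  next
    case False
    then show ?thesis using K singular_majorant_nonneg[of 1] by (simp add: not_le)
  qed
  then have summ: "summable (\<lambda>i. ?h (Suc i))"
    by (intro summableI_nonneg_bounded[where x = "?h 1 + K"]) (auto simp: singular_majorant_nonneg)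
  show thesis
  proof (rule that[of "?h 1 + K"])
    show "?h 1 + K \<ge> 0" using K singular_majorant_nonneg[of 1] by simp
    fix s n Q :: nat assume s: "s \<ge> 3" and Q: "Q \<ge> 1"
    have "cmod (\<Sum>q\<in>{1..Q}. singular_term s n q) \<le> (\<Sum>q\<in>{1..Q}. ?h q)"
      by (intro sum_norm_le norm_singular_term_le s)
    with part[OF Q] show "cmod (\<Sum>q\<in>{1..Q}. singular_term s n q) \<le> ?h 1 + K" by linarith
    have f: "summable (\<lambda>i. singular_term s n (Suc i))"
      by (rule summable_comparison_test[OF _ summ]) (use norm_singular_term_le[OF s] in auto)
    have "singular_series s n = (\<Sum>i. singular_term s n (Suc (i + Q))) + (\<Sum>i<Q. singular_term s n (Suc i))"
      unfolding singular_series_def by (rule suminf_split_initial_segment[OF f])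
    also have "(\<Sum>i<Q. singular_term s n (Suc i)) = (\<Sum>q\<in>{1..Q}. singular_term s n q)"
      by (rule sum.reindex_bij_witness[of _ "\<lambda>q. q - 1" Suc]) auto
    finally have "cmod (singular_series s n - (\<Sum>q\<in>{1..Q}. singular_term s n q)) = cmod (\<Sum>i. singular_term s n (Suc (i + Q)))"
      by simp
    also have "\<dots> \<le> (\<Sum>i. ?h (Suc (i + Q)))"
      using summable_ignore_initial_segment[OF summ, of Q] norm_singular_term_le[OF s]
      by (intro norm_suminf_le) auto
    also have "\<dots> \<le> K * real Q powr - (1 / 20)"
    proof (rule suminf_le_const)
      show "summable (\<lambda>i. ?h (Suc (i + Q)))" using summable_ignore_initial_segment[OF summ, of Q] by simp
      fix m
      have "(\<Sum>i<m. ?h (Suc (i + Q))) = (\<Sum>q\<in>{Q<..Q + m}. ?h q)"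
        by (rule sum.reindex_bij_witness[of _ "\<lambda>q. q - Suc Q" "\<lambda>i. Suc (i + Q)"]) auto
      then show "(\<Sum>i<m. ?h (Suc (i + Q))) \<le> K * real Q powr - (1 / 20)" using K(2)[OF Q, of "Q + m"] by simp
    qed
    also have "\<dots> \<le> (?h 1 + K) * real Q powr - (1 / 20)"
      using singular_majorant_nonneg[of 1] by (intro mult_right_mono) auto
    finally show "cmod (singular_series s n - (\<Sum>q\<in>{1..Q}. singular_term s n q)) \<le> (?h 1 + K) * real Q powr - (1 / 20)" .
  qed
qed

section \<open>The singular integral\<close>

text \<open>Bernoulli's inequality for exponents below 1. It is concavity of the logarithm, y^a <= a
  y + (1 - a), obtained from \<open>ln_le_minus_one\<close> after dividing by the right-hand side
  w.\<close>

lemma powr_one_plus_le: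
  fixes a x :: real
  assumes "0 < a" "a \<le> 1" "x > -1"
  shows "(1 + x) powr a \<le> 1 + a * x"
proof -
  define y where "y = 1 + x"
  define w where "w = a * y + (1 - a)"
  have y: "y > 0" using assms by (simp add: y_def)
  have w: "w > 0" unfolding w_def using assms y by (intro add_pos_nonneg mult_pos_pos) auto
  have "a * ln (y / w) + (1 - a) * ln (1 / w) \<le> a * (y / w - 1) + (1 - a) * (1 / w - 1)"
    using assms y w by (intro add_mono mult_left_mono ln_le_minus_one) auto
  also have "\<dots> = (a * y + (1 - a)) / w - 1" by (simp add: field_simps add_divide_distrib diff_divide_distrib)
  also have "\<dots> = 0" using w by (simp add: w_def)
  finally have "a * ln y \<le> ln w" using y w by (simp add: ln_div algebra_simps)
  then have "exp (a * ln y) \<le> w" using w by (simp add: ln_ge_iff)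
  then show ?thesis using y by (simp add: powr_def w_def y_def algebra_simps)
qed

text \<open>The coefficients of \<open>(1 - z)\<^bsup>-a\<^esup>\<close>. As weights they replace the usual \<open>m\<^bsup>a-1\<^esup> / \<Gamma>(a)\<close>: their
  convolutions and partial sums are again of this form, so the singular integral is exact.\<close>

definition poch_coeff :: "real \<Rightarrow> nat \<Rightarrow> real"
  where "poch_coeff a m = pochhammer a m / fact m"

lemma poch_coeff_Suc: "poch_coeff a (Suc m) = poch_coeff a m * ((a + real m) / (real m + 1))"
  by (simp add: poch_coeff_def pochhammer_Suc field_simps)

lemma poch_coeff_pos: "a > 0 \<Longrightarrow> poch_coeff a m > 0"
  by (simp add: poch_coeff_def pochhammer_pos)

text \<open>Taking partial sums multiplies the generating function by (1 - z)^(-1).\<close>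

lemma sum_poch_coeff: "(\<Sum>m\<le>t. poch_coeff a m) = poch_coeff (a + 1) t"
proof (induction t)
  case (Suc t)
  have "poch_coeff a (Suc t) = poch_coeff (a + 1) t * (a / (real t + 1))"
    by (simp add: poch_coeff_def pochhammer_rec field_simps)
  moreover have "poch_coeff (a + 1) (Suc t) = poch_coeff (a + 1) t * ((a + 1 + real t) / (real t + 1))"
    by (rule poch_coeff_Suc)
  moreover have "(a + 1 + real t) / (real t + 1) = 1 + a / (real t + 1)" by (simp add: field_simps)
  ultimately show ?case using Suc by (simp only: sum.atMost_Suc) (simp only: distrib_left mult_1_right)
qed (simp add: poch_coeff_def)

text \<open>Up to sign these are binomial coefficients with upper entry -a, so Vandermonde's
  identity applies.\<close>

lemma poch_coeff_convolution: "(\<Sum>i=0..n. poch_coeff a i * poch_coeff b (n - i)) = poch_coeff (a + b) n"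
proof -
  have poch_coeff: "poch_coeff a i = (- 1) ^ i * ((- a) gchoose i)" for a i
    by (simp add: poch_coeff_def gbinomial_pochhammer)
  have "(\<Sum>i=0..n. poch_coeff a i * poch_coeff b (n - i)) = (\<Sum>i=0..n. (- 1) ^ n * (((- a) gchoose i) * ((- b) gchoose (n - i))))"
    by (intro sum.cong refl) (auto simp: poch_coeff power_add[symmetric] mult_ac)
  also have "\<dots> = (- 1) ^ n * ((- a + - b) gchoose n)"
    by (simp add: gbinomial_Vandermonde sum_distrib_left[symmetric])
  finally show ?thesis by (simp add: poch_coeff add.commute)
qed

definition poch_coeff_fps :: "real \<Rightarrow> complex fps"
  where "poch_coeff_fps a = Abs_fps (\<lambda>m. of_real (poch_coeff a m))"

lemma poch_coeff_fps_mult: "poch_coeff_fps a * poch_coeff_fps b = poch_coeff_fps (a + b)"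
proof (rule fps_ext)
  fix n
  have "fps_nth (poch_coeff_fps a * poch_coeff_fps b) n = of_real (\<Sum>i=0..n. poch_coeff a i * poch_coeff b (n - i))"
    by (simp add: fps_mult_nth poch_coeff_fps_def)
  then show "fps_nth (poch_coeff_fps a * poch_coeff_fps b) n = fps_nth (poch_coeff_fps (a + b)) n"
    by (simp add: poch_coeff_convolution poch_coeff_fps_def)
qed

lemma poch_coeff_fps_power: "poch_coeff_fps a ^ k = poch_coeff_fps (real k * a)"
proof (induction k)
  case 0
  show ?case by (rule fps_ext) (auto simp: poch_coeff_fps_def poch_coeff_def pochhammer_0_left)
next
  case (Suc k)
  then show ?case by (simp add: poch_coeff_fps_mult algebra_simps)
qed

lemma tendsto_powr_div_poch_coeff:
  assumes "a > 0"
  shows "(\<lambda>n. real n powr a / poch_coeff (1 + a) n) \<longlonglongrightarrow> Gamma (1 + a)"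
proof (rule Lim_transform_eventually)
  show "Gamma_series' (1 + a) \<longlonglongrightarrow> Gamma (1 + a)"
    by (rule Gamma_series'_LIMSEQ)
  show "\<forall>\<^sub>F n in sequentially. Gamma_series' (1 + a) n = real n powr a / poch_coeff (1 + a) n"
    using eventually_gt_at_top[of 0]
  proof eventually_elim
    case (elim n)
    then have "exp ((1 + a) * ln (real n)) = real n * real n powr a"
      by (simp add: powr_def exp_add distrib_right)
    moreover have "(fact n :: real) = real n * fact (n - 1)" using elim by (simp add: fact_reduce)
    ultimately show ?case by (simp add: Gamma_series'_def poch_coeff_def)
  qed
qed

text \<open>Both n^a and (n + 1)^a, divided by the coefficient, tend to Gamma(1 + a). The first
  quotient increases and the second decreases, so the limit separates them for every n, without an
  error term.\<close>

lemma Gamma_mult_poch_coeff_bounds: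
  assumes a: "0 < a" "a \<le> 1"
  shows "real n powr a \<le> Gamma (1 + a) * poch_coeff (1 + a) n"
    and "Gamma (1 + a) * poch_coeff (1 + a) n \<le> (real n + 1) powr a"
proof -
  have cpos: "poch_coeff (1 + a) n > 0" for n using a by (intro poch_coeff_pos) auto
  have step: "poch_coeff (1 + a) (Suc n) = poch_coeff (1 + a) n * (1 + a / (real n + 1))" for n
    by (simp add: poch_coeff_Suc field_simps)
  have Suc: "real (Suc n) = real n + 1" for n by simp
  have lower: "real n powr a / poch_coeff (1 + a) n \<le> real (Suc n) powr a / poch_coeff (1 + a) (Suc n)" for n
  proof -
    have "(real n / (real n + 1)) powr a * (1 + a / (real n + 1)) \<le> 1"
    proof -
      have x: "real n / (real n + 1) = 1 + - (1 / (real n + 1))" by (simp add: field_simps)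
      have "(real n / (real n + 1)) powr a \<le> 1 + a * (- (1 / (real n + 1)))"
      proof (cases "n = 0")
        case True
        then show ?thesis using a by simp
      next
        case False
        show ?thesis unfolding x using a False by (intro powr_one_plus_le) auto
      qed
      then have "(real n / (real n + 1)) powr a * (1 + a / (real n + 1)) \<le> (1 - a / (real n + 1)) * (1 + a / (real n + 1))"
        using a by (intro mult_right_mono) auto
      also have "\<dots> \<le> 1" by (simp add: algebra_simps)
      finally show ?thesis .
    qed
    then have "real n powr a * (1 + a / (real n + 1)) \<le> (real n + 1) powr a"
    proof -
      have "real n powr a / (real n + 1) powr a * (1 + a / (real n + 1)) \<le> 1"
        using \<open>(real n / (real n + 1)) powr a * (1 + a / (real n + 1)) \<le> 1\<close> by (simp add: powr_divide)
      moreover have "(real n + 1) powr a > 0" by simp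
      ultimately show ?thesis by (simp only: times_divide_eq_left pos_divide_le_eq mult_1)
    qed
    then show ?thesis using cpos[of n] a unfolding step Suc
      by (simp add: divide_simps add_pos_pos mult_ac) 
  qed
  then have "incseq (\<lambda>n. real n powr a / poch_coeff (1 + a) n)" by (rule incseq_SucI)
  from incseq_le[OF this tendsto_powr_div_poch_coeff[OF a(1)], of n]
  show "real n powr a \<le> Gamma (1 + a) * poch_coeff (1 + a) n" using cpos[of n] by (simp add: field_simps)
  have upper: "(real (Suc n) + 1) powr a / poch_coeff (1 + a) (Suc n) \<le> (real n + 1) powr a / poch_coeff (1 + a) n" for n
  proof -
    have x: "(real n + 2) / (real n + 1) = 1 + 1 / (real n + 1)" by (simp add: field_simps)
    have "((real n + 2) / (real n + 1)) powr a \<le> 1 + a * (1 / (real n + 1))"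
    proof -
      have "- 1 < 1 / (real n + 1)" by (rule less_le_trans[of _ 0]) auto
      then show ?thesis unfolding x by (rule powr_one_plus_le[OF a])
    qed
    then have "(real n + 2) powr a \<le> (real n + 1) powr a * (1 + a / (real n + 1))"
      by (simp add: powr_divide field_simps)
    moreover have "real n + 1 + 1 = real n + 2" by simp
    ultimately show ?thesis using cpos[of n] a unfolding step Suc
      by (simp only:) (simp add: divide_simps add_pos_pos mult_ac)
  qed
  then have dec: "decseq (\<lambda>n. (real n + 1) powr a / poch_coeff (1 + a) n)" by (intro decseq_SucI) auto
  have "(\<lambda>n. ((real n + 1) / real n) powr a * (real n powr a / poch_coeff (1 + a) n)) \<longlonglongrightarrow> 1 powr a * Gamma (1 + a)"
  proof (intro tendsto_mult tendsto_powr tendsto_powr_div_poch_coeff a)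
    show "(\<lambda>n. (real n + 1) / real n) \<longlonglongrightarrow> 1" by real_asymp
  qed auto
  then have "(\<lambda>n. (real n + 1) powr a / poch_coeff (1 + a) n) \<longlonglongrightarrow> 1 powr a * Gamma (1 + a)"
  proof (rule Lim_transform_eventually)
    show "\<forall>\<^sub>F n in sequentially. ((real n + 1) / real n) powr a * (real n powr a / poch_coeff (1 + a) n) = (real n + 1) powr a / poch_coeff (1 + a) n"
      using eventually_gt_at_top[of 0] by eventually_elim (simp add: powr_divide)
  qed
  then have "(\<lambda>n. (real n + 1) powr a / poch_coeff (1 + a) n) \<longlonglongrightarrow> Gamma (1 + a)" by simp
  from decseq_ge[OF dec this, of n]
  show "Gamma (1 + a) * poch_coeff (1 + a) n \<le> (real n + 1) powr a" using cpos[of n] by (simp add: field_simps)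
qed

text \<open>Normalised so that the partial sum up to t lies between t^a and (t + 1)^a: for a = 1/k
  the weights are a density for the k-th powers.\<close>

definition weight :: "real \<Rightarrow> nat \<Rightarrow> real"
  where "weight a m = Gamma (1 + a) * poch_coeff a m"

lemma weight_nonneg: "a > 0 \<Longrightarrow> weight a m \<ge> 0"
  unfolding weight_def using poch_coeff_pos[of a m] by (intro mult_nonneg_nonneg) (auto intro!: less_imp_le[OF Gamma_real_pos])

lemma sum_weight: "(\<Sum>m\<le>t. weight a m) = Gamma (1 + a) * poch_coeff (1 + a) t"
  using sum_poch_coeff[of a t] by (simp add: weight_def sum_distrib_left[symmetric] add.commute)

lemma weight_antimono:
  assumes "0 < a" "a \<le> 1" "m \<le> n"
  shows "weight a n \<le> weight a m"
  using assms(3)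
proof (induction n rule: dec_induct)
  case (step n)
  have "weight a (Suc n) = weight a n * ((a + real n) / (real n + 1))" by (simp add: weight_def poch_coeff_Suc)
  also have "\<dots> \<le> weight a n * 1"
    using assms weight_nonneg by (intro mult_left_mono) (auto simp: divide_simps)
  finally show ?case using step by simp
qed simp

text \<open>The weights decrease, so m + 1 copies of the last one are at most the partial sum, which
  is at most (m + 1)^a.\<close>

lemma weight_le:
  assumes a: "0 < a" "a \<le> 1"
  shows "weight a m \<le> (real m + 1) powr (a - 1)"
proof -
  have "(real m + 1) * weight a m = (\<Sum>j\<le>m. weight a m)" by simp
  also have "\<dots> \<le> (\<Sum>j\<le>m. weight a j)" using weight_antimono[OF a] by (intro sum_mono) auto
  also have "\<dots> \<le> (real m + 1) powr a" using Gamma_mult_poch_coeff_bounds(2)[OF a] by (simp add: sum_weight)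
  also have "\<dots> = (real m + 1) * (real m + 1) powr (a - 1)" by (simp add: powr_mult_base)
  finally show ?thesis by (simp add: mult_le_cancel_left)
qed

text \<open>Abel summation: the successive differences of \<open>w\<close> are nonnegative and
  telescope to the first weight.\<close>

lemma norm_sum_antimono_le:
  fixes w :: "nat \<Rightarrow> real" and z :: "nat \<Rightarrow> complex"
  assumes w0: "\<And>m. w m \<ge> 0" and w: "\<And>m. w (Suc m) \<le> w m"
    and G: "\<And>j. cmod (\<Sum>m\<in>{l..<l + j}. z m) \<le> G"
  shows "cmod (\<Sum>m\<in>{l..<l + k}. of_real (w m) * z m) \<le> w l * G"
proof -
  define Z where "Z j = (\<Sum>m\<in>{l..<l + j}. z m)" for j
  have eq: "(\<Sum>m\<in>{l..<l + k}. of_real (w m) * z m)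
      = of_real (w (l + k)) * Z k + (\<Sum>j<k. of_real (w (l + j) - w (Suc (l + j))) * Z (Suc j))" for k
    by (induction k) (auto simp: Z_def algebra_simps)
  have "cmod (\<Sum>m\<in>{l..<l + k}. of_real (w m) * z m) \<le> w (l + k) * G + (\<Sum>j<k. (w (l + j) - w (Suc (l + j))) * G)"
    unfolding eq
  proof (intro norm_triangle_mono sum_norm_le)
    have ZG: "cmod (Z j) \<le> G" for j using G unfolding Z_def .
    show "cmod (of_real (w (l + k)) * Z k) \<le> w (l + k) * G"
      using w0 ZG by (simp add: norm_mult mult_left_mono)
    fix j
    have "cmod (of_real (w (l + j) - w (Suc (l + j))) * Z (Suc j)) = (w (l + j) - w (Suc (l + j))) * cmod (Z (Suc j))"
      using w[of "l + j"] unfolding norm_mult norm_of_real by simp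
    then show "cmod (of_real (w (l + j) - w (Suc (l + j))) * Z (Suc j)) \<le> (w (l + j) - w (Suc (l + j))) * G"
      using w[of "l + j"] ZG by (simp only:) (intro mult_left_mono, auto)
  qed
  also have "w (l + k) * G + (\<Sum>j<k. (w (l + j) - w (Suc (l + j))) * G) = w l * G"
    by (induction k) (auto simp: algebra_simps)
  finally show ?thesis .
qed

definition weight_sum :: "real \<Rightarrow> nat \<Rightarrow> real \<Rightarrow> complex"
  where "weight_sum a N \<beta> = (\<Sum>m\<le>N. of_real (weight a m) * ee (real m * \<beta>))"

lemma weight_sum_cong_Ints:
  assumes "\<beta> - \<gamma> \<in> \<int>"
  shows "weight_sum a N \<beta> = weight_sum a N \<gamma>"
  unfolding weight_sum_def
proof (intro sum.cong refl arg_cong2[where f = "(*)"] ee_cong_Ints)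
  fix m
  show "real m * \<beta> - real m * \<gamma> \<in> \<int>"
    using assms by (metis Ints_mult Ints_of_nat right_diff_distrib)
qed

text \<open>Split at r = 1 / \<open>dist_int \<beta>\<close>. The head is at most its total weight,
  below 2 r^a. By Abel summation the tail is at most the first weight times r, below r^(a-1)
  r.\<close>

lemma norm_weight_sum_le:
  assumes a: "0 < a" "a \<le> 1" and nz: "dist_int \<beta> > 0"
  shows "cmod (weight_sum a N \<beta>) \<le> 3 * dist_int \<beta> powr - a"
proof -
  define r where "r = 1 / dist_int \<beta>"
  have r: "r \<ge> 2" using nz dist_int_le_half[of \<beta>] by (simp add: r_def field_simps)
  define t where "t = nat \<lfloor>r\<rfloor>"
  have t: "real t \<le> r" "r \<le> real t + 1" using r by (auto simp: t_def)
  have head: "cmod (\<Sum>m\<in>S. of_real (weight a m) * ee (real m * \<beta>)) \<le> 2 * r powr a" if "S \<subseteq> {..t}" for S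
  proof -
    have "cmod (\<Sum>m\<in>S. of_real (weight a m) * ee (real m * \<beta>)) \<le> (\<Sum>m\<in>S. weight a m)"
      using weight_nonneg[OF a(1)] by (intro sum_norm_le) (auto simp: norm_mult)
    also have "\<dots> \<le> (\<Sum>m\<le>t. weight a m)"
      using that weight_nonneg[OF a(1)] by (intro sum_mono2) auto
    also have "\<dots> \<le> (real t + 1) powr a"
      using Gamma_mult_poch_coeff_bounds(2)[OF a] by (simp add: sum_weight)
    also have "\<dots> \<le> (2 * r) powr a" using t r a by (intro powr_mono2) auto
    also have "\<dots> = 2 powr a * r powr a" using r by (simp add: powr_mult)
    also have "\<dots> \<le> 2 powr 1 * r powr a" using a by (intro mult_right_mono powr_mono) auto
    finally show ?thesis by simp
  qed
  have "cmod (weight_sum a N \<beta>) \<le> 3 * r powr a"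
  proof (cases "N \<le> t")
    case True
    have "2 * r powr a \<le> 3 * r powr a" by (intro mult_right_mono) auto
    moreover have "cmod (weight_sum a N \<beta>) \<le> 2 * r powr a" using head[of "{..N}"] True unfolding weight_sum_def by auto
    ultimately show ?thesis by (rule order_trans[rotated])
  next
    case False
    have "{..N} = {..t} \<union> {Suc t..<Suc t + (N - t)}" using False by auto
    then have split: "weight_sum a N \<beta> = (\<Sum>m\<in>{..t}. of_real (weight a m) * ee (real m * \<beta>))
        + (\<Sum>m\<in>{Suc t..<Suc t + (N - t)}. of_real (weight a m) * ee (real m * \<beta>))"
      unfolding weight_sum_def by (subst \<open>{..N} = _\<close>, subst sum.union_disjoint) auto
    have "cmod (\<Sum>m\<in>{Suc t..<Suc t + j}. ee (real m * \<beta>)) \<le> r" for j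
    proof -
      have "(\<Sum>m\<in>{Suc t..<Suc t + j}. ee (real m * \<beta>)) = (\<Sum>x<j. ee (real (Suc t) * \<beta>) * ee (real x * \<beta>))"
        by (rule sum.reindex_bij_witness[of _ "\<lambda>x. Suc t + x" "\<lambda>m. m - Suc t"])
           (auto simp: ee_add[symmetric] algebra_simps of_nat_diff)
      also have "cmod \<dots> = cmod (\<Sum>x<j. ee (real x * \<beta>))"
        by (simp add: sum_distrib_left[symmetric] norm_mult)
      also have "\<dots> \<le> r" unfolding r_def by (rule norm_geometric_ee_le[OF nz])
      finally show ?thesis .
    qed
    then have "cmod (\<Sum>m\<in>{Suc t..<Suc t + (N - t)}. of_real (weight a m) * ee (real m * \<beta>)) \<le> weight a (Suc t) * r"
      using weight_nonneg weight_antimono[of a] a by (intro norm_sum_antimono_le) auto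
    also have "\<dots> \<le> r powr (a - 1) * r"
    proof (rule mult_right_mono)
      have "weight a (Suc t) \<le> (real (Suc t) + 1) powr (a - 1)" by (rule weight_le[OF a])
      also have "\<dots> \<le> r powr (a - 1)" using a t r by (intro powr_mono2') auto
      finally show "weight a (Suc t) \<le> r powr (a - 1)" .
    qed (use r in auto)
    also have "\<dots> = r powr a" using r by (simp add: mult.commute powr_mult_base)
    finally show ?thesis using head[of "{..t}"] unfolding split
      by (intro order_trans[OF norm_triangle_ineq]) auto
  qed
  then show ?thesis using nz by (simp add: r_def powr_divide powr_minus_divide)
qed

text \<open>For a = 1/2 the squared weights are dominated by the harmonic series. So the two factors
  from squares cost only a logarithm on average, and all decay can be drawn from the
  biquadrates.\<close>

lemma ravg_norm_weight_sum_half_le: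
  assumes "M > N"
  shows "ravg M (\<lambda>t. (cmod (weight_sum (1 / 2) N (t - \<theta>)))\<^sup>2) \<le> 2 + ln (real N + 1)"
proof -
  have "complex_of_real (ravg M (\<lambda>t. (cmod (\<Sum>i\<in>{..N}. of_real (weight (1 / 2) i) * ee (of_int (int i) * (t - \<theta>))))\<^sup>2))
    = (\<Sum>(i, j)\<in>{(i, j). i \<in> {..N} \<and> j \<in> {..N} \<and> int i = int j}. of_real (weight (1 / 2) i) * cnj (of_real (weight (1 / 2) j)))"
    using assms by (intro ravg_trig_sum) auto
  also have "\<dots> = (\<Sum>i\<in>{..N}. complex_of_real ((weight (1 / 2) i)\<^sup>2))"
    by (rule sum.reindex_bij_witness[of _ "\<lambda>i. (i, i)" fst]) (auto simp: power2_eq_square)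
  finally have "ravg M (\<lambda>t. (cmod (weight_sum (1 / 2) N (t - \<theta>)))\<^sup>2) = (\<Sum>i\<in>{..N}. (weight (1 / 2) i)\<^sup>2)"
    by (simp add: weight_sum_def flip: of_real_power of_real_sum)
  also have "\<dots> \<le> (\<Sum>i\<in>{..N}. 1 / real (Suc i))"
  proof (rule sum_mono)
    fix i
    have "(weight (1 / 2) i)\<^sup>2 \<le> ((real i + 1) powr (1 / 2 - 1))\<^sup>2"
      using weight_le[of "1 / 2" i] weight_nonneg by (intro power_mono) auto
    also have "\<dots> = (real i + 1) powr (real 2 * (1 / 2 - 1))" by (rule powr_power) simp
    also have "\<dots> = 1 / real (Suc i)" by (simp add: powr_minus_divide add.commute)
    finally show "(weight (1 / 2) i)\<^sup>2 \<le> 1 / real (Suc i)" .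
  qed
  also have "\<dots> = (\<Sum>i\<in>{1..Suc N}. 1 / real i)"
    by (rule sum.reindex_bij_witness[of _ "\<lambda>i. i - 1" Suc]) auto
  also have "\<dots> \<le> 1 + ln (real (Suc N))" by (rule sum_inverse_le_ln) simp
  finally show ?thesis by (simp add: add.commute)
qed

text \<open>The polynomial whose value at \<open>ee \<beta>\<close> is the weight sum; products of
  weight sums are then handled through their coefficients.\<close>

definition weight_poly :: "real \<Rightarrow> nat \<Rightarrow> complex poly"
  where "weight_poly a N = (\<Sum>m\<le>N. monom (of_real (weight a m)) m)"

lemma poly_weight_poly: "poly (weight_poly a N) (ee \<beta>) = weight_sum a N \<beta>"
  by (simp add: weight_poly_def poly_sum poly_monom weight_sum_def ee_of_nat_mult)

lemma degree_weight_poly: "degree (weight_poly a N) \<le> N"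
  unfolding weight_poly_def by (rule degree_sum_le) (auto intro: order_trans[OF degree_monom_le])

lemma coeff_weight_poly: "coeff (weight_poly a N) k = (if k \<le> N then of_real (weight a k) else 0)"
  unfolding weight_poly_def coeff_sum coeff_monom by simp

text \<open>Congruence modulo z^(N+1). It is compatible with products, so truncating each factor at
  degree N leaves the coefficients up to N intact.\<close>

definition fps_agree :: "nat \<Rightarrow> complex fps \<Rightarrow> complex fps \<Rightarrow> bool"
  where "fps_agree N f g \<longleftrightarrow> (\<forall>k\<le>N. fps_nth f k = fps_nth g k)"

lemma fps_agree_mult: "fps_agree N f g \<Longrightarrow> fps_agree N f' g' \<Longrightarrow> fps_agree N (f * f') (g * g')"
  by (auto simp: fps_agree_def fps_mult_nth)

lemma fps_agree_power: "fps_agree N f g \<Longrightarrow> fps_agree N (f ^ k) (g ^ k)"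
  by (induction k) (auto intro: fps_agree_mult simp: fps_agree_def[of _ 1 1])

lemma fps_agree_weight_poly: "fps_agree N (fps_of_poly (weight_poly a N)) (fps_const (of_real (Gamma (1 + a))) * poch_coeff_fps a)"
  by (auto simp: fps_agree_def coeff_weight_poly poch_coeff_fps_def weight_def)

lemma coeff_weight_poly_product:
  assumes "n \<le> N"
  shows "coeff (weight_poly (1 / 2) N ^ 2 * weight_poly (1 / 4) N ^ s) n
    = of_real (Gamma (3 / 2) ^ 2 * Gamma (5 / 4) ^ s * poch_coeff (1 + real s / 4) n)"
proof -
  define G where "G = fps_const (of_real (Gamma (3 / 2)) :: complex) * poch_coeff_fps (1 / 2)"
  define G' where "G' = fps_const (of_real (Gamma (5 / 4)) :: complex) * poch_coeff_fps (1 / 4)"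
  have "fps_agree N (fps_of_poly (weight_poly (1 / 2) N) ^ 2 * fps_of_poly (weight_poly (1 / 4) N) ^ s) (G ^ 2 * G' ^ s)"
    using fps_agree_weight_poly[of N "1 / 2"] fps_agree_weight_poly[of N "1 / 4"]
    by (intro fps_agree_mult fps_agree_power) (simp_all add: G_def G'_def)
  then have "coeff (weight_poly (1 / 2) N ^ 2 * weight_poly (1 / 4) N ^ s) n = fps_nth (G ^ 2 * G' ^ s) n"
    using assms by (simp add: fps_agree_def flip: fps_of_poly_mult fps_of_poly_power)
  also have "G ^ 2 * G' ^ s = fps_const (of_real (Gamma (3 / 2) ^ 2 * Gamma (5 / 4) ^ s)) * (poch_coeff_fps (1 / 2) ^ 2 * poch_coeff_fps (1 / 4) ^ s)"
    by (simp add: G_def G'_def power_mult_distrib fps_const_power mult_ac fps_const_mult[symmetric] del: fps_const_mult)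
  also have "poch_coeff_fps (1 / 2) ^ 2 * poch_coeff_fps (1 / 4) ^ s = poch_coeff_fps (1 + real s / 4)"
    by (simp add: poch_coeff_fps_power poch_coeff_fps_mult)
  finally show ?thesis by (simp add: poch_coeff_fps_def)
qed

text \<open>The singular integral over the whole circle around \<theta>. The grid is finer than the
  degree of the product, so the average extracts the coefficient of z^n exactly; the exponents 1/2 +
  1/2 + s/4 add up to 1 + s/4.\<close>

lemma avg_weight_sum_product:
  assumes n: "n \<le> N" and M: "(s + 2) * N < M"
  shows "avg M (\<lambda>t. weight_sum (1 / 2) N (t - \<theta>) ^ 2 * weight_sum (1 / 4) N (t - \<theta>) ^ s * ee (- (real n * (t - \<theta>))))
    = of_real (Gamma (3 / 2) ^ 2 * Gamma (5 / 4) ^ s * poch_coeff (1 + real s / 4) n)"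
proof -
  define P where "P = weight_poly (1 / 2) N ^ 2 * weight_poly (1 / 4) N ^ s"
  have "degree P \<le> N * 2 + N * s"
    unfolding P_def
    by (intro order_trans[OF degree_mult_le] add_mono order_trans[OF degree_power_le] mult_right_mono degree_weight_poly) auto
  then have deg: "degree P \<le> (s + 2) * N" by (simp add: algebra_simps)
  have "weight_sum (1 / 2) N (t - \<theta>) ^ 2 * weight_sum (1 / 4) N (t - \<theta>) ^ s * ee (- (real n * (t - \<theta>)))
      = (\<Sum>i\<le>(s + 2) * N. coeff P i * ee (of_int (int i - int n) * (t - \<theta>)))" for t
  proof -
    have "weight_sum (1 / 2) N (t - \<theta>) ^ 2 * weight_sum (1 / 4) N (t - \<theta>) ^ s = poly P (ee (t - \<theta>))"
      by (simp add: P_def poly_weight_poly)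
    also have "\<dots> = (\<Sum>i\<le>(s + 2) * N. coeff P i * ee (t - \<theta>) ^ i)"
      unfolding poly_altdef by (rule sum.mono_neutral_left) (use deg in \<open>auto simp: coeff_eq_0\<close>)
    finally have e: "weight_sum (1 / 2) N (t - \<theta>) ^ 2 * weight_sum (1 / 4) N (t - \<theta>) ^ s = (\<Sum>i\<le>(s + 2) * N. coeff P i * ee (t - \<theta>) ^ i)" .
    have "ee (t - \<theta>) ^ i * ee (- (real n * (t - \<theta>))) = ee (of_int (int i - int n) * (t - \<theta>))" for i
      unfolding ee_of_nat_mult[symmetric] ee_add[symmetric] by (simp add: left_diff_distrib)
    then show ?thesis unfolding e sum_distrib_right by (simp only: mult.assoc)
  qed
  then have "avg M (\<lambda>t. weight_sum (1 / 2) N (t - \<theta>) ^ 2 * weight_sum (1 / 4) N (t - \<theta>) ^ s * ee (- (real n * (t - \<theta>))))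
      = (\<Sum>i\<le>(s + 2) * N. coeff P i * avg M (\<lambda>t. ee (of_int (int i - int n) * (t - \<theta>))))"
    by (simp only: avg_sum avg_cmult)
  also have "\<dots> = (\<Sum>i\<le>(s + 2) * N. if i = n then coeff P i else 0)"
  proof (intro sum.cong refl)
    fix i assume i: "i \<in> {..(s + 2) * N}"
    have "N \<le> (s + 2) * N" by simp
    with i n M have "\<bar>int i - int n\<bar> < int M" by auto
    then show "coeff P i * avg M (\<lambda>t. ee (of_int (int i - int n) * (t - \<theta>))) = (if i = n then coeff P i else 0)"
      by (subst avg_ee_shift) auto
  qed
  also have "\<dots> = coeff P n" using n by (simp add: sum.delta)
  finally show ?thesis unfolding P_def coeff_weight_poly_product[OF n] .
qed

section \<open>Identification of the constant in the main term\<close>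

lemma Gamma_three_halves: "Gamma (3 / 2 :: real) ^ 2 = pi / 4"
proof -
  have "Gamma (1 / 2 + 1 :: real) = 1 / 2 * Gamma (1 / 2)" by (rule Gamma_plus1) (auto elim!: nonpos_Ints_cases)
  then have g: "Gamma (3 / 2 :: real) = sqrt pi / 2" by (simp add: Gamma_one_half_real)
  show ?thesis unfolding g by (simp add: power_divide)
qed

text \<open>For s = 3 the denominator Gamma(7/4) is traded for Gamma(5/4) by the functional equation
  and the reflection formula Gamma(1/4) Gamma(3/4) = pi sqrt 2.\<close>

lemma main_coeff_altdef:
  assumes "s = 3 \<or> s = 4"
  shows "main_coeff s * Gamma (5 / 4) ^ 4 = Gamma (3 / 2) ^ 2 * Gamma (5 / 4) ^ s / Gamma (1 + real s / 4)"
  using assms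
proof
  assume "s = 4"
  moreover have "Gamma (2 :: real) = 1" using Gamma_fact[of 1, where 'a = real] by simp
  ultimately show ?thesis by (simp add: main_coeff_def Gamma_three_halves)
next
  assume s: "s = 3"
  have 1: "Gamma (1 / 4 + 1 :: real) = 1 / 4 * Gamma (1 / 4)" by (rule Gamma_plus1) (auto elim!: nonpos_Ints_cases)
  have 2: "Gamma (3 / 4 + 1 :: real) = 3 / 4 * Gamma (3 / 4)" by (rule Gamma_plus1) (auto elim!: nonpos_Ints_cases)
  have "Gamma (1 / 4) * Gamma (3 / 4) = pi * sqrt 2"
  proof -
    have "complex_of_real (Gamma (1 / 4) * Gamma (3 / 4)) = Gamma (1 / 4) * Gamma (1 - 1 / 4)"
      by (simp flip: Gamma_complex_of_real)
    also have "\<dots> = of_real pi / sin (of_real pi * (1 / 4))" by (rule Gamma_reflection_complex)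
    also have "\<dots> = complex_of_real (pi / sin (pi / 4))" by (simp flip: sin_of_real)
    finally have "Gamma (1 / 4) * Gamma (3 / 4) = pi / sin (pi / 4)" by (simp only: of_real_eq_iff)
    also have "\<dots> = pi * sqrt 2" unfolding sin_45 by (simp add: divide_simps)
    finally show ?thesis .
  qed
  moreover have "Gamma (3 / 4 :: real) > 0" by (intro Gamma_real_pos) auto
  ultimately have g: "Gamma (1 / 4) = pi * sqrt 2 / Gamma (3 / 4)"
    using nonzero_eq_divide_eq[of "Gamma (3 / 4)" "Gamma (1 / 4)" "pi * sqrt 2"] by linarith
  define G where "G = Gamma (3 / 4 :: real)"
  have G: "G > 0" unfolding G_def by (intro Gamma_real_pos) auto
  have 5: "Gamma (5 / 4) = pi * sqrt 2 / (4 * G)" using 1 g by (simp add: G_def)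
  have 7: "Gamma (7 / 4) = 3 / 4 * G" using 2 by (simp add: G_def)
  have "2 / 3 * sqrt 2 * Gamma (5 / 4) = pi / 4 / Gamma (7 / 4)"
    unfolding 5 7 using G by (simp add: field_simps)
  then have "2 / 3 * sqrt 2 * Gamma (5 / 4) * Gamma (5 / 4) ^ 3 = pi / 4 / Gamma (7 / 4) * Gamma (5 / 4) ^ 3"
    by (rule arg_cong)
  then show ?thesis
    by (simp add: s main_coeff_def Gamma_three_halves) (simp add: eval_nat_numeral mult_ac)
qed

lemma powr_add_one_le:
  assumes b: "0 < b" "b \<le> 1"
  shows "(real n + 1) powr b \<le> real n powr b + 1"
proof (cases "n = 0")
  case False
  then have n: "n \<ge> 1" by simp
  have "(real n + 1) powr b = real n powr b * (1 + 1 / real n) powr b"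
    using n by (simp add: powr_mult[symmetric] distrib_left)
  also have "\<dots> \<le> real n powr b * (1 + b * (1 / real n))"
  proof -
    have "- 1 < 1 / real n" by (rule less_le_trans[of _ 0]) auto
    then show ?thesis by (intro mult_left_mono powr_one_plus_le b) auto
  qed
  also have "\<dots> = real n powr b + b * (real n powr b / real n powr 1)" using n by (simp add: algebra_simps)
  also have "real n powr b / real n powr 1 = real n powr (b - 1)" by (simp only: powr_diff)
  also have "b * real n powr (b - 1) \<le> 1 * real n powr 0"
    using b n by (intro mult_mono powr_mono) auto
  finally show ?thesis using n by simp
qed simp

text \<open>The exponent s/4 is at most 1, so (n + 1)^(s/4) exceeds n^(s/4) by at most 1 and the
  error stays bounded.\<close>

lemma singular_integral_approx:
  assumes s: "s = 3 \<or> s = 4" and n: "n \<ge> 1"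
  shows "\<bar>Gamma (3 / 2) ^ 2 * Gamma (5 / 4) ^ s * poch_coeff (1 + real s / 4) n - main_coeff s * Gamma (5 / 4) ^ 4 * real n powr (real s / 4)\<bar>
    \<le> main_coeff s * Gamma (5 / 4) ^ 4"
proof -
  define b where "b = real s / 4"
  have b: "0 < b" "b \<le> 1" using s by (auto simp: b_def)
  define K where "K = main_coeff s * Gamma (5 / 4) ^ 4"
  have K: "K \<ge> 0" by (auto simp: K_def main_coeff_def)
  have G: "Gamma (1 + b) > 0" using b by (intro Gamma_real_pos) auto
  have eq: "Gamma (3 / 2) ^ 2 * Gamma (5 / 4) ^ s * poch_coeff (1 + b) n = K * (Gamma (1 + b) * poch_coeff (1 + b) n)"
    using G by (simp add: K_def main_coeff_altdef[OF s] flip: b_def)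
  have "(real n + 1) powr b \<le> real n powr b + 1" by (rule powr_add_one_le[OF b])
  then have "\<bar>Gamma (1 + b) * poch_coeff (1 + b) n - real n powr b\<bar> \<le> 1"
    using Gamma_mult_poch_coeff_bounds[OF b, of n] by linarith
  then have "K * \<bar>Gamma (1 + b) * poch_coeff (1 + b) n - real n powr b\<bar> \<le> K * 1" using K by (intro mult_left_mono)
  then have "\<bar>K * (Gamma (1 + b) * poch_coeff (1 + b) n) - K * real n powr b\<bar> \<le> K"
    using K by (simp only: right_diff_distrib[symmetric] abs_mult abs_of_nonneg mult_1_right)
  then show ?thesis unfolding eq[symmetric] unfolding b_def K_def .
qed

section \<open>Major arcs\<close>

definition floor_root :: "nat \<Rightarrow> nat \<Rightarrow> nat"
  where "floor_root k N = nat \<lfloor>real N powr (1 / real k)\<rfloor>"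

lemma le_floor_root_iff:
  assumes "k > 0"
  shows "x \<le> floor_root k N \<longleftrightarrow> x ^ k \<le> N"
proof -
  have "x \<le> floor_root k N \<longleftrightarrow> real x \<le> real N powr (1 / real k)"
    unfolding floor_root_def by (simp add: le_nat_iff le_floor_iff)
  also have "\<dots> \<longleftrightarrow> real x ^ k \<le> (real N powr (1 / real k)) ^ k"
    using assms by (intro power_mono_iff[symmetric]) auto
  also have "(real N powr (1 / real k)) ^ k = real N"
    using assms by (cases "N = 0") (simp_all add: powr_power)
  finally show ?thesis by (simp flip: of_nat_power)
qed

lemma floor_root_le: "real (floor_root k N) \<le> real N powr (1 / real k)"
  unfolding floor_root_def by (metis of_nat_floor powr_ge_zero)

lemma floor_root_ge: "real N powr (1 / real k) \<le> real (floor_root k N) + 1"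
proof -
  have "real (floor_root k N) = of_int \<lfloor>real N powr (1 / real k)\<rfloor>" unfolding floor_root_def by simp
  then show ?thesis by linarith
qed

section \<open>Exponential sums near a rational point\<close>

definition power_exp_sum :: "nat \<Rightarrow> nat \<Rightarrow> real \<Rightarrow> complex"
  where "power_exp_sum k A t = (\<Sum>x\<in>{1..A}. ee (real x ^ k * t))"

lemma power_exp_sum_cong_Ints:
  assumes "s - t \<in> \<int>"
  shows "power_exp_sum k A s = power_exp_sum k A t"
  unfolding power_exp_sum_def
proof (intro sum.cong refl ee_cong_Ints)
  fix x
  show "real x ^ k * s - real x ^ k * t \<in> \<int>"
    using assms by (metis Ints_mult Ints_of_nat of_nat_power right_diff_distrib)
qed

lemma norm_power_exp_sum_le: "cmod (power_exp_sum k A t) \<le> real A"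
  unfolding power_exp_sum_def using sum_norm_bound[of "{1..A}" "\<lambda>x. ee (real x ^ k * t)" 1] by simp

lemma power_add_period: "\<exists>c. ((x::nat) + q) ^ k = x ^ k + q * c"
proof (induction k)
  case (Suc k)
  then obtain c where "(x + q) ^ k = x ^ k + q * c" by blast
  then have "(x + q) ^ Suc k = x ^ Suc k + q * (x ^ k + x * c + q * c)"
    by (simp add: algebra_simps)
  then show ?case by blast
qed auto

text \<open>The summand has period q. Full periods match exactly, and the incomplete last one costs
  at most q on each side.\<close>

lemma power_exp_sum_rational_approx:
  assumes q: "q \<ge> 1"
  shows "cmod (power_exp_sum k y (real a / real q) - of_nat y * mean_exp_sum k q a) \<le> 2 * real q"
proof -
  define F where "F y = power_exp_sum k y (real a / real q)" for y
  have per: "ee (real (x + q) ^ k * (real a / real q)) = ee (real x ^ k * (real a / real q))" for x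
  proof (rule ee_cong_Ints)
    obtain c where "(x + q) ^ k = x ^ k + q * c" using power_add_period by blast
    then have "real (x + q) ^ k = real x ^ k + real q * real c" by (metis of_nat_add of_nat_mult of_nat_power)
    then have "real (x + q) ^ k * (real a / real q) - real x ^ k * (real a / real q) = real (c * a)"
      using q by (simp add: field_simps)
    then show "real (x + q) ^ k * (real a / real q) - real x ^ k * (real a / real q) \<in> \<int>"
      by (metis Ints_of_nat)
  qed
  have "F (y + q) = F q + F y" for y
  proof -
    have "{1..y + q} = {1..q} \<union> (\<lambda>x. x + q) ` {1..y}"
    proof (intro set_eqI iffI)
      fix x assume "x \<in> {1..y + q}"
      then show "x \<in> {1..q} \<union> (\<lambda>x. x + q) ` {1..y}"
        by (cases "x \<le> q") (auto intro!: image_eqI[of _ _ "x - q"])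
    qed auto
    moreover have "{1..q} \<inter> (\<lambda>x. x + q) ` {1..y} = {}" by auto
    ultimately have "F (y + q) = F q + (\<Sum>x\<in>(\<lambda>x. x + q) ` {1..y}. ee (real x ^ k * (real a / real q)))"
      by (simp add: F_def power_exp_sum_def sum.union_disjoint)
    also have "(\<Sum>x\<in>(\<lambda>x. x + q) ` {1..y}. ee (real x ^ k * (real a / real q))) = F y"
      unfolding F_def power_exp_sum_def by (subst sum.reindex) (simp_all only: o_def per inj_on_add')
    finally show ?thesis .
  qed
  then have F: "F (q * d + r) = of_nat d * F q + F r" for d r
    by (induction d) (auto simp: algebra_simps, metis (no_types, opaque_lifting) add.assoc add.commute)
  define d r where "d = y div q" and "r = y mod q"
  have y: "y = q * d + r" and r: "r \<le> q" using q by (auto simp: d_def r_def less_imp_le)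
  have "F q = of_nat q * mean_exp_sum k q a" using q by (simp add: F_def power_exp_sum_def mean_exp_sum_altdef)
  then have "F y - of_nat y * mean_exp_sum k q a = F r - of_nat r * mean_exp_sum k q a"
    unfolding y F by (simp add: algebra_simps)
  also have "cmod \<dots> \<le> real r + real r * 1"
    using norm_power_exp_sum_le[of k r] norm_mean_exp_sum_le_1
    by (intro order_trans[OF norm_triangle_ineq4] add_mono) (auto simp: F_def norm_mult intro!: mult_left_le)
  also have "\<dots> \<le> 2 * real q" using r by simp
  finally show ?thesis by (simp add: F_def)
qed

lemma sum_mult_ee_partial:
  fixes u :: "nat \<Rightarrow> complex"
  shows "(\<Sum>m\<le>N. u m * ee (real m * \<beta>)) = (\<Sum>m\<le>N. u m) * ee (real N * \<beta>)
    + (\<Sum>m<N. (\<Sum>j\<le>m. u j) * (ee (real m * \<beta>) - ee (real (Suc m) * \<beta>)))"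
  by (induction N) (auto simp: algebra_simps)

text \<open>Partial summation: consecutive characters differ by at most 2 pi |\<beta>|, so a bound
  for all partial sums at \<beta> = 0 carries over to nearby \<beta>.\<close>

lemma norm_sum_mult_ee_le:
  fixes u :: "nat \<Rightarrow> complex"
  assumes U: "\<And>m. m \<le> N \<Longrightarrow> cmod (\<Sum>j\<le>m. u j) \<le> K"
  shows "cmod (\<Sum>m\<le>N. u m * ee (real m * \<beta>)) \<le> K * (1 + 2 * pi * real N * \<bar>\<beta>\<bar>)"
proof -
  have K: "K \<ge> 0" using U[of 0] norm_ge_zero order_trans by blast
  have "cmod ((\<Sum>m\<le>N. u m) * ee (real N * \<beta>) + (\<Sum>m<N. (\<Sum>j\<le>m. u j) * (ee (real m * \<beta>) - ee (real (Suc m) * \<beta>))))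
      \<le> K + (\<Sum>m<N. K * (2 * pi * \<bar>\<beta>\<bar>))"
  proof (intro norm_triangle_mono sum_norm_le)
    show "cmod ((\<Sum>m\<le>N. u m) * ee (real N * \<beta>)) \<le> K" using U[of N] by (simp add: norm_mult)
    fix m assume m: "m \<in> {..<N}"
    have "cmod (ee (real m * \<beta>) - ee (real (Suc m) * \<beta>)) \<le> 2 * pi * \<bar>\<beta>\<bar>"
      using norm_ee_diff_le[of "real m * \<beta>" "real (Suc m) * \<beta>"] by (simp add: algebra_simps)
    then show "cmod ((\<Sum>j\<le>m. u j) * (ee (real m * \<beta>) - ee (real (Suc m) * \<beta>))) \<le> K * (2 * pi * \<bar>\<beta>\<bar>)"
      unfolding norm_mult using U[of m] m K by (intro mult_mono) auto
  qed
  also have "\<dots> = K * (1 + 2 * pi * real N * \<bar>\<beta>\<bar>)" by (simp add: algebra_simps)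
  finally show ?thesis unfolding sum_mult_ee_partial .
qed

text \<open>The sequence \<open>u\<close> subtracts the mean density of the twisted k-th powers. Its
  partial sums are at most 2q + 2 <= 4q: 2q from the incomplete period, 2 from the gap between the
  number of k-th powers and the total weight. Partial summation then introduces \<beta>.\<close>

lemma power_exp_sum_approx:
  assumes q: "q \<ge> 1" and k: "k \<ge> 1"
  shows "cmod (power_exp_sum k (floor_root k N) (real a / real q + \<beta>) - mean_exp_sum k q a * weight_sum (1 / real k) N \<beta>)
    \<le> 4 * real q * (1 + 2 * pi * real N * \<bar>\<beta>\<bar>)"
proof -
  define A where "A = floor_root k N"
  define b where "b = 1 / real k"
  have b: "0 < b" "b \<le> 1" using k by (auto simp: b_def)
  define c where "c m = (\<Sum>x\<in>{1..A}. if x ^ k = m then ee (real x ^ k * (real a / real q)) else 0)" for m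
  define u where "u m = c m - mean_exp_sum k q a * of_real (weight b m)" for m
  have xA: "x ^ k \<le> N" if "x \<in> {1..A}" for x
    using that le_floor_root_iff[of k x N] k by (auto simp: A_def)
  have csum: "(\<Sum>m\<le>t. c m) = power_exp_sum k (floor_root k t) (real a / real q)" if t: "t \<le> N" for t
  proof -
    have "(\<Sum>m\<le>t. c m) = (\<Sum>x\<in>{1..A}. \<Sum>m\<le>t. if x ^ k = m then ee (real x ^ k * (real a / real q)) else 0)"
      unfolding c_def by (rule sum.swap)
    also have "\<dots> = (\<Sum>x\<in>{1..A}. if x ^ k \<le> t then ee (real x ^ k * (real a / real q)) else 0)"
      by (intro sum.cong refl) (simp add: sum.delta)
    also have "\<dots> = (\<Sum>x\<in>{1..floor_root k t}. ee (real x ^ k * (real a / real q)))"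
    proof (rule sum.mono_neutral_cong_right)
      have "floor_root k t ^ k \<le> t" using k le_floor_root_iff[of k "floor_root k t" t] by simp
      then have "floor_root k t \<le> A" using k t by (simp add: A_def le_floor_root_iff)
      then show "{1..floor_root k t} \<subseteq> {1..A}" by auto
    qed (use k in \<open>auto simp: le_floor_root_iff\<close>)
    finally show ?thesis by (simp add: power_exp_sum_def)
  qed
  have U: "cmod (\<Sum>j\<le>t. u j) \<le> 4 * real q" if t: "t \<le> N" for t
  proof -
    define y where "y = floor_root k t"
    define W where "W = Gamma (1 + b) * poch_coeff (1 + b) t"
    have "(\<Sum>j\<le>t. u j) = power_exp_sum k y (real a / real q) - mean_exp_sum k q a * of_real W"
      unfolding u_def sum_subtractf csum[OF t] y_def W_def
      by (simp add: sum_distrib_left[symmetric] sum_weight flip: of_real_sum of_real_mult)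
    also have "\<dots> = (power_exp_sum k y (real a / real q) - of_nat y * mean_exp_sum k q a) + mean_exp_sum k q a * of_real (real y - W)"
      by (simp add: algebra_simps)
    also have "cmod \<dots> \<le> 2 * real q + 1 * 2"
    proof (intro norm_triangle_mono power_exp_sum_rational_approx q)
      have "\<bar>real y - W\<bar> \<le> 2"
        using Gamma_mult_poch_coeff_bounds[OF b, of t] floor_root_le[of k t] floor_root_ge[of t k] powr_add_one_le[OF b, of t]
        unfolding W_def y_def b_def by linarith
      then show "cmod (mean_exp_sum k q a * of_real (real y - W)) \<le> 1 * 2"
        unfolding norm_mult norm_of_real by (intro mult_mono norm_mean_exp_sum_le_1) auto
    qed
    also have "\<dots> \<le> 4 * real q" using q by simp
    finally show ?thesis .
  qed
  have "(\<Sum>m\<le>N. c m * ee (real m * \<beta>)) = (\<Sum>x\<in>{1..A}. \<Sum>m\<le>N. if x ^ k = m then ee (real x ^ k * (real a / real q)) * ee (real m * \<beta>) else 0)"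
    unfolding c_def sum_distrib_right by (subst sum.swap) (intro sum.cong refl, auto)
  also have "\<dots> = (\<Sum>x\<in>{1..A}. ee (real x ^ k * (real a / real q)) * ee (real (x ^ k) * \<beta>))"
    by (intro sum.cong refl) (simp add: sum.delta xA)
  also have "\<dots> = power_exp_sum k A (real a / real q + \<beta>)"
    unfolding power_exp_sum_def by (intro sum.cong refl) (simp add: ee_add[symmetric] distrib_left)
  finally have "(\<Sum>m\<le>N. u m * ee (real m * \<beta>)) = power_exp_sum k A (real a / real q + \<beta>) - mean_exp_sum k q a * weight_sum b N \<beta>"
    by (simp add: u_def weight_sum_def left_diff_distrib sum_subtractf sum_distrib_left mult.assoc)
  then show ?thesis
    using norm_sum_mult_ee_le[OF U, of N \<beta>] by (simp add: A_def b_def)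
qed

lemma card_nat_interval_le:
  fixes x y :: real
  assumes "x \<le> y"
  shows "real (card {b::nat. x \<le> real b \<and> real b \<le> y}) \<le> y - x + 1"
proof -
  have "card {b::nat. x \<le> real b \<and> real b \<le> y} = card (int ` {b::nat. x \<le> real b \<and> real b \<le> y})"
    by (simp add: card_image)
  also have "\<dots> \<le> card {\<lceil>x\<rceil>..\<lfloor>y\<rfloor>}"
    by (rule card_mono) (auto simp: ceiling_le_iff le_floor_iff)
  finally have "real (card {b::nat. x \<le> real b \<and> real b \<le> y}) \<le> real (nat (\<lfloor>y\<rfloor> - \<lceil>x\<rceil> + 1))" by simp
  also have "\<dots> \<le> y - x + 1" using assms by linarith
  finally show ?thesis .
qed

text \<open>As t - \<theta> lies in [-1, 1], the nearest integer is -1, 0 or 1, and each of the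
  three real intervals contains at most 2 \<eta> M + 1 grid indices.\<close>

lemma ravg_near_le:
  assumes \<theta>: "0 \<le> \<theta>" "\<theta> \<le> 1" and \<eta>: "\<eta> \<ge> 0" and M: "M > 0"
  shows "ravg M (\<lambda>t. of_bool (dist_int (t - \<theta>) \<le> \<eta>)) \<le> 6 * \<eta> + 3 / real M"
proof -
  define S where "S k = {b::nat. real M * (\<theta> + of_int k - \<eta>) \<le> real b \<and> real b \<le> real M * (\<theta> + of_int k + \<eta>)}" for k :: int
  have finS: "finite (S k)" for k
    by (rule finite_subset[of _ "{..nat \<lfloor>real M * (\<theta> + of_int k + \<eta>)\<rfloor>}"]) (auto simp: S_def le_nat_iff le_floor_iff)
  have cS: "real (card (S k)) \<le> 2 * \<eta> * real M + 1" for k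
    using card_nat_interval_le[of "real M * (\<theta> + of_int k - \<eta>)" "real M * (\<theta> + of_int k + \<eta>)"] \<eta> M
    by (simp add: S_def algebra_simps)
  have "{b \<in> {..<M}. dist_int (real b / real M - \<theta>) \<le> \<eta>} \<subseteq> (\<Union>k\<in>{-1, 0, 1}. S k)"
  proof
    fix b assume b: "b \<in> {b \<in> {..<M}. dist_int (real b / real M - \<theta>) \<le> \<eta>}"
    define k where "k = round (real b / real M - \<theta>)"
    have "0 \<le> real b / real M" "real b / real M \<le> 1" using b by auto
    then have "-1 \<le> real b / real M - \<theta>" "real b / real M - \<theta> \<le> 1" using \<theta> by linarith+
    then have "round (of_int (-1) :: real) \<le> k" "k \<le> round (of_int 1 :: real)" unfolding k_def by (intro round_mono; simp)+
    then have "-1 \<le> k" "k \<le> 1" unfolding round_of_int by auto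
    then have k: "k \<in> {-1, 0, 1}" by auto
    have "\<bar>real b / real M - \<theta> - of_int k\<bar> \<le> \<eta>" using b by (simp add: dist_int_def k_def)
    then have "\<theta> + of_int k - \<eta> \<le> real b / real M" "real b / real M \<le> \<theta> + of_int k + \<eta>" by linarith+
    then have "b \<in> S k" using M by (simp add: S_def field_simps)
    then show "b \<in> (\<Union>k\<in>{-1, 0, 1}. S k)" using k by blast
  qed
  then have "card {b \<in> {..<M}. dist_int (real b / real M - \<theta>) \<le> \<eta>} \<le> card (\<Union>k\<in>{-1, 0, 1}. S k)"
    using finS by (intro card_mono) auto
  also have "\<dots> \<le> (\<Sum>k\<in>{-1, 0, 1}. card (S k))" by (rule card_UN_le) auto
  finally have "real (card {b \<in> {..<M}. dist_int (real b / real M - \<theta>) \<le> \<eta>}) \<le> real (\<Sum>k\<in>{-1, 0, 1}. card (S k))"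
    by (simp only: of_nat_le_iff)
  also have "\<dots> \<le> 3 * (2 * \<eta> * real M + 1)" using cS[of "-1"] cS[of 0] cS[of 1] by simp
  finally have "real (card {b \<in> {..<M}. dist_int (real b / real M - \<theta>) \<le> \<eta>}) / real M \<le> 3 * (2 * \<eta> * real M + 1) / real M"
    by (intro divide_right_mono) auto
  also have "\<dots> = 6 * \<eta> + 3 / real M" using M by (simp add: field_simps)
  also have "real (card {b \<in> {..<M}. dist_int (real b / real M - \<theta>) \<le> \<eta>}) / real M = ravg M (\<lambda>t. of_bool (dist_int (t - \<theta>) \<le> \<eta>))"
    unfolding ravg_def of_bool_def by (subst sum.inter_filter[symmetric]) auto
  finally show ?thesis .
qed

lemma norm_power_diff_le:
  fixes x y :: complex
  assumes "cmod x \<le> Y" "cmod y \<le> Y"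
  shows "cmod (x ^ n - y ^ n) \<le> real n * Y ^ (n - 1) * cmod (x - y)"
proof (induction n)
  case (Suc n)
  have Y: "Y \<ge> 0" using assms norm_ge_zero order_trans by blast
  have "x ^ Suc n - y ^ Suc n = x ^ n * (x - y) + y * (x ^ n - y ^ n)" by (simp add: algebra_simps)
  also have "cmod \<dots> \<le> Y ^ n * cmod (x - y) + Y * (real n * Y ^ (n - 1) * cmod (x - y))"
    using assms Y Suc
    by (intro norm_triangle_mono) (auto simp: norm_mult norm_power intro!: mult_mono power_mono)
  also have "\<dots> = real (Suc n) * Y ^ (Suc n - 1) * cmod (x - y)"
    by (cases n) (auto simp: algebra_simps)
  finally show ?case .
qed simp

lemma norm_weight_sum_le_powr:
  assumes "0 < a" "a \<le> 1"
  shows "cmod (weight_sum a N \<beta>) \<le> real N powr a + 1"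
proof -
  have "cmod (weight_sum a N \<beta>) \<le> (\<Sum>m\<le>N. weight a m)"
    unfolding weight_sum_def using weight_nonneg[OF assms(1)] by (intro sum_norm_le) (auto simp: norm_mult)
  then show ?thesis
    using Gamma_mult_poch_coeff_bounds(2)[OF assms, of N] powr_add_one_le[OF assms, of N] by (simp add: sum_weight)
qed

section \<open>Arcs around Farey fractions and the main term\<close>

definition gen_exp_sum :: "nat \<Rightarrow> nat \<Rightarrow> real \<Rightarrow> complex"
  where "gen_exp_sum s N t = power_exp_sum 2 (floor_root 2 N) t ^ 2 * power_exp_sum 4 (floor_root 4 N) t ^ s"

lemma R_eq_avg:
  assumes n: "n \<le> N" and N: "N \<ge> 1" and s: "s \<le> 4"
  shows "of_nat (R s n) = avg (10 * N) (\<lambda>t. gen_exp_sum s N t * ee (- (real n * t)))"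
proof -
  define A B where "A = floor_root 2 N" and "B = floor_root 4 N"
  define Y where "Y = {1..s} \<rightarrow>\<^sub>E {1..B}"
  define I where "I = {1..A} \<times> {1..A} \<times> Y"
  define \<kappa> where "\<kappa> = (\<lambda>(x1, x2, y). x1\<^sup>2 + x2\<^sup>2 + (\<Sum>i=1..s. y i ^ 4) :: nat)"
  have A: "x \<le> A \<longleftrightarrow> x\<^sup>2 \<le> N" for x by (simp add: A_def le_floor_root_iff)
  have B: "x \<le> B \<longleftrightarrow> x ^ 4 \<le> N" for x by (simp add: B_def le_floor_root_iff)
  have finY: "finite Y" unfolding Y_def by (intro finite_PiE) auto
  then have finI: "finite I" by (simp add: I_def)
  have pow: "power_exp_sum 4 B t ^ s = (\<Sum>y\<in>Y. ee (real (\<Sum>i=1..s. y i ^ 4) * t))" for t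
  proof -
    have "power_exp_sum 4 B t ^ s = (\<Prod>i\<in>{1..s}. \<Sum>x\<in>{1..B}. ee (real x ^ 4 * t))" by (simp add: power_exp_sum_def)
    also have "\<dots> = (\<Sum>y\<in>Y. \<Prod>i\<in>{1..s}. ee (real (y i) ^ 4 * t))"
      unfolding Y_def by (rule prod_sum_PiE) auto
    also have "\<dots> = (\<Sum>y\<in>Y. ee (real (\<Sum>i=1..s. y i ^ 4) * t))"
      by (simp add: sum_distrib_right ee_sum)
    finally show ?thesis .
  qed
  have "gen_exp_sum s N t * ee (- (real n * t)) = (\<Sum>p\<in>I. ee (of_int (int (\<kappa> p) - int n) * t))" for t
  proof -
    have "gen_exp_sum s N t = (\<Sum>x1\<in>{1..A}. \<Sum>x2\<in>{1..A}. \<Sum>y\<in>Y. ee (real x1 ^ 2 * t) * ee (real x2 ^ 2 * t) * ee (real (\<Sum>i=1..s. y i ^ 4) * t))"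
    proof -
      have "gen_exp_sum s N t = (power_exp_sum 2 A t * power_exp_sum 2 A t) * (\<Sum>y\<in>Y. ee (real (\<Sum>i=1..s. y i ^ 4) * t))"
        unfolding gen_exp_sum_def A_def[symmetric] B_def[symmetric] pow by (simp only: power2_eq_square)
      also have "\<dots> = (\<Sum>x1\<in>{1..A}. \<Sum>x2\<in>{1..A}. (ee (real x1 ^ 2 * t) * ee (real x2 ^ 2 * t)) * (\<Sum>y\<in>Y. ee (real (\<Sum>i=1..s. y i ^ 4) * t)))"
      proof -
        have P: "power_exp_sum 2 A t * power_exp_sum 2 A t = (\<Sum>x1\<in>{1..A}. \<Sum>x2\<in>{1..A}. ee (real x1 ^ 2 * t) * ee (real x2 ^ 2 * t))"
          unfolding power_exp_sum_def by (rule sum_product)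
        show ?thesis unfolding P by (simp only: sum_distrib_right)
      qed
      finally show ?thesis by (simp only: sum_distrib_left)
    qed
    also have "\<dots> = (\<Sum>p\<in>I. ee (real (\<kappa> p) * t))"
      unfolding I_def sum.cartesian_product
      by (intro sum.cong refl) (auto simp: \<kappa>_def distrib_right ee_add)
    finally show ?thesis
      by (simp add: sum_distrib_right ee_add[symmetric] left_diff_distrib)
  qed
  then have "avg (10 * N) (\<lambda>t. gen_exp_sum s N t * ee (- (real n * t))) = (\<Sum>p\<in>I. avg (10 * N) (\<lambda>t. ee (of_int (int (\<kappa> p) - int n) * t)))"
    by (simp only: avg_sum)
  also have "\<dots> = (\<Sum>p\<in>I. if \<kappa> p = n then 1 else 0)"
  proof (intro sum.cong refl)
    fix p assume "p \<in> I"
    then obtain x1 x2 y where p: "p = (x1, x2, y)" "x1 \<in> {1..A}" "x2 \<in> {1..A}" "y \<in> Y" by (auto simp: I_def)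
    have "(\<Sum>i=1..s. y i ^ 4) \<le> (\<Sum>i=1..s. N)"
      using p B by (intro sum_mono) (auto simp: Y_def)
    \<comment> \<open>The form takes values at most 6N on the box and n <= N, so a grid of 10N
      points separates all frequencies.\<close>
    also have "\<dots> \<le> 4 * N" using s by simp
    finally have "\<kappa> p \<le> N + N + 4 * N" using p A by (auto simp: \<kappa>_def intro!: add_mono)
    then have "\<bar>int (\<kappa> p) - int n\<bar> < int (10 * N)" using n N by linarith
    then show "avg (10 * N) (\<lambda>t. ee (of_int (int (\<kappa> p) - int n) * t)) = (if \<kappa> p = n then 1 else 0)"
      by (subst avg_ee) auto
  qed
  also have "\<dots> = of_nat (card {p \<in> I. \<kappa> p = n})"
    using finI by (simp flip: sum.inter_filter)
  also have "{p \<in> I. \<kappa> p = n} = {(x1, x2, y). x1 \<in> {1..} \<and> x2 \<in> {1..} \<and> y \<in> {1..s} \<rightarrow>\<^sub>E {1..} \<and>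
                         x1\<^sup>2 + x2\<^sup>2 + (\<Sum>i=1..s. y i ^ 4) = n}" (is "_ = ?S")
  proof (intro set_eqI iffI)
    fix p assume "p \<in> {p \<in> I. \<kappa> p = n}"
    then show "p \<in> ?S" by (auto simp: I_def \<kappa>_def Y_def PiE_iff)
  next
    fix p assume "p \<in> ?S"
    then obtain x1 x2 y where p: "p = (x1, x2, y)" "x1 \<ge> 1" "x2 \<ge> 1" "y \<in> {1..s} \<rightarrow>\<^sub>E {1..}" "x1\<^sup>2 + x2\<^sup>2 + (\<Sum>i=1..s. y i ^ 4) = n"
      by auto
    have "y i \<le> B" if "i \<in> {1..s}" for i
    proof -
      have "y i ^ 4 \<le> (\<Sum>i=1..s. y i ^ 4)" by (rule member_le_sum) (use that in auto)
      then show ?thesis using p(5) n unfolding B by linarith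
    qed
    then have "y \<in> Y" using p(4) by (auto simp: Y_def PiE_iff)
    moreover have "x1 \<le> A" "x2 \<le> A" unfolding A using p(5) n by linarith+
    ultimately show "p \<in> {p \<in> I. \<kappa> p = n}" using p by (simp add: I_def \<kappa>_def)
  qed
  finally show ?thesis by (simp add: R_def)
qed

definition farey_pairs :: "nat \<Rightarrow> (nat \<times> nat) set"
  where "farey_pairs T = {(q, a). q \<in> {1..T} \<and> a \<in> {1..q} \<and> coprime a q}"

text \<open>Beyond the half-width T^4 / N each biquadratic weight sum is at most 3 N^(1/4) / T, so
  three of them outweigh the at most T^2 fractions. Distances are taken modulo 1, so the pair for
  1/1 also covers the arc at 0.\<close>

definition near_fraction :: "nat \<Rightarrow> nat \<Rightarrow> nat \<times> nat \<Rightarrow> real \<Rightarrow> bool"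
  where "near_fraction N T p t \<longleftrightarrow> dist_int (t - real (snd p) / real (fst p)) \<le> real T ^ 4 / real N"

definition on_major_arc :: "nat \<Rightarrow> nat \<Rightarrow> real \<Rightarrow> bool"
  where "on_major_arc N T t \<longleftrightarrow> (\<exists>p\<in>farey_pairs T. near_fraction N T p t)"

definition arc_approx :: "nat \<Rightarrow> nat \<Rightarrow> nat \<times> nat \<Rightarrow> real \<Rightarrow> complex"
  where "arc_approx s N p t = (mean_exp_sum 2 (fst p) (snd p) * weight_sum (1 / 2) N (t - real (snd p) / real (fst p))) ^ 2
    * (mean_exp_sum 4 (fst p) (snd p) * weight_sum (1 / 4) N (t - real (snd p) / real (fst p))) ^ s"

lemma finite_farey_pairs: "finite (farey_pairs T)"
  by (rule finite_subset[of _ "{1..T} \<times> {1..T}"]) (auto simp: farey_pairs_def)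

lemma card_farey_pairs_le: "card (farey_pairs T) \<le> T\<^sup>2"
proof -
  have "card (farey_pairs T) \<le> card ({1..T} \<times> {1..T})" by (rule card_mono) (auto simp: farey_pairs_def)
  then show ?thesis by (simp add: power2_eq_square)
qed

text \<open>The integer \<open>D\<close>, the numerator of a'/q' - a/q - k, has modulus at most 2
  T^6 / N < 1 and so vanishes. Coprimality gives q = q', and the range 1..q of the numerators rules
  out a wrap-around.\<close>

lemma near_fraction_unique:
  assumes T: "2 * T ^ 6 < N" and p: "p \<in> farey_pairs T" "p' \<in> farey_pairs T" and t: "near_fraction N T p t" "near_fraction N T p' t"
  shows "p = p'"
proof -
  obtain q a q' a' where pq: "p = (q, a)" "p' = (q', a')" by (cases p, cases p') auto
  have q: "1 \<le> q" "q \<le> T" "1 \<le> q'" "q' \<le> T" and a: "1 \<le> a" "a \<le> q" "1 \<le> a'" "a' \<le> q'"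
    and cop: "coprime a q" "coprime a' q'" using p by (auto simp: pq farey_pairs_def)
  define k where "k = round (t - real a / real q) - round (t - real a' / real q')"
  define D where "D = int a' * int q - int a * int q' - k * int q * int q'"
  have N: "real N > 0" using T by (cases N) auto
  have "\<bar>real a' / real q' - real a / real q - of_int k\<bar> \<le> 2 * (real T ^ 4 / real N)"
    using t unfolding near_fraction_def dist_int_def pq fst_conv snd_conv k_def of_int_diff by linarith
  then have "\<bar>real a' / real q' - real a / real q - of_int k\<bar> * (real q * real q') \<le> 2 * (real T ^ 4 / real N) * (real T * real T)"
    using q by (intro mult_mono) auto
  also have "\<dots> = real (2 * T ^ 6) / real N" by (simp add: eval_nat_numeral)
  also have "\<dots> < 1" using T N by (simp only: divide_less_eq_1_pos of_nat_less_iff)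
  also have "\<bar>real a' / real q' - real a / real q - of_int k\<bar> * (real q * real q')
      = \<bar>(real a' / real q' - real a / real q - of_int k) * (real q * real q')\<bar>" by (simp add: abs_mult)
  also have "(real a' / real q' - real a / real q - of_int k) * (real q * real q') = of_int D"
    using q by (simp add: D_def field_simps)
  finally have "D = 0" by linarith
  then have eq: "int a' * int q = int q' * (int a + k * int q)" by (simp add: D_def algebra_simps)
  have "int a * int q' = int q * (int a' - k * int q')" using \<open>D = 0\<close> by (simp add: D_def algebra_simps)
  then have "int (q) dvd int (a * q')" by simp
  then have "q dvd a * q'" by (simp only: int_dvd_int_iff)
  then have "q dvd q'" using cop(1) coprime_dvd_mult_right_iff[of q a q'] by (simp add: coprime_commute)
  moreover have "int q' dvd int (a' * q)" using eq by simp
  then have "q' dvd a' * q" by (simp only: int_dvd_int_iff)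
  then have "q' dvd q" using cop(2) coprime_dvd_mult_right_iff[of q' a' q] by (simp add: coprime_commute)
  ultimately have qq: "q = q'" by (rule dvd_antisym)
  have "int q * (int a' - int a - k * int q) = 0" using eq by (simp add: qq algebra_simps)
  then have "int a' - int a = k * int q" using q by simp
  moreover have "\<bar>int a' - int a\<bar> < int q" using a qq by auto
  ultimately have "k = 0" using q zdvd_imp_le[of "int q" "\<bar>int a' - int a\<bar>"]
    by (cases "k = 0") (auto simp: abs_mult)
  then have "a = a'" using \<open>int a' - int a = k * int q\<close> by simp
  then show ?thesis using qq pq by simp
qed

lemma sum_farey_pairs: "(\<Sum>p\<in>farey_pairs T. f (fst p) (snd p)) = (\<Sum>q\<in>{1..T}. \<Sum>a | a \<in> {1..q} \<and> coprime a q. f q a)"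
proof -
  have "farey_pairs T = Sigma {1..T} (\<lambda>q. {a. a \<in> {1..q} \<and> coprime a q})" by (auto simp: farey_pairs_def)
  moreover have "(\<Sum>q\<in>{1..T}. \<Sum>a | a \<in> {1..q} \<and> coprime a q. f q a)
      = (\<Sum>(q, a)\<in>Sigma {1..T} (\<lambda>q. {a. a \<in> {1..q} \<and> coprime a q}). f q a)"
    by (rule sum.Sigma) auto
  ultimately show ?thesis by (simp add: case_prod_unfold)
qed

text \<open>Each approximant is averaged over the whole grid, not only over its arc. The result is
  exactly the truncated singular series times the singular integral.\<close>

lemma sum_avg_approx:
  assumes n: "n \<le> N" and N: "N \<ge> 1" and s: "s \<le> 4"
  shows "(\<Sum>p\<in>farey_pairs T. avg (10 * N) (\<lambda>t. arc_approx s N p t * ee (- (real n * t))))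
    = (\<Sum>q\<in>{1..T}. singular_term s n q) * of_real (Gamma (3 / 2) ^ 2 * Gamma (5 / 4) ^ s * poch_coeff (1 + real s / 4) n)"
proof -
  define J where "J = complex_of_real (Gamma (3 / 2) ^ 2 * Gamma (5 / 4) ^ s * poch_coeff (1 + real s / 4) n)"
  define c where "c q a = mean_exp_sum 2 q a ^ 2 * mean_exp_sum 4 q a ^ s * ee (- (real n * (real a / real q)))" for q a
  have "avg (10 * N) (\<lambda>t. arc_approx s N p t * ee (- (real n * t))) = c (fst p) (snd p) * J" for p
  proof -
    define \<theta> where "\<theta> = real (snd p) / real (fst p)"
    have "arc_approx s N p t * ee (- (real n * t))
        = c (fst p) (snd p) * (weight_sum (1 / 2) N (t - \<theta>) ^ 2 * weight_sum (1 / 4) N (t - \<theta>) ^ s * ee (- (real n * (t - \<theta>))))" for t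
    proof -
      have "ee (- (real n * t)) = ee (- (real n * \<theta>)) * ee (- (real n * (t - \<theta>)))"
        by (simp add: ee_add[symmetric] algebra_simps)
      then show ?thesis by (simp add: arc_approx_def c_def \<theta>_def power_mult_distrib mult_ac)
    qed
    moreover have "(s + 2) * N < 10 * N"
    proof -
      have "(s + 2) * N \<le> 6 * N" using s by (intro mult_right_mono) auto
      then show ?thesis using N by linarith
    qed
    ultimately show ?thesis using avg_weight_sum_product[OF n, of s "10 * N" \<theta>] by (simp add: avg_cmult J_def)
  qed
  then have "(\<Sum>p\<in>farey_pairs T. avg (10 * N) (\<lambda>t. arc_approx s N p t * ee (- (real n * t)))) = (\<Sum>p\<in>farey_pairs T. c (fst p) (snd p)) * J"
    by (simp add: sum_distrib_right)
  also have "(\<Sum>p\<in>farey_pairs T. c (fst p) (snd p)) = (\<Sum>q\<in>{1..T}. singular_term s n q)"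
    unfolding sum_farey_pairs
  proof (intro sum.cong refl)
    fix q
    have "e2pi (- (of_nat n * of_nat a / of_nat q)) = ee (- (real n * (real a / real q)))" for a
      using e2pi_of_real[of "- (real n * (real a / real q))"] by simp
    then show "(\<Sum>a | a \<in> {1..q} \<and> coprime a q. c q a) = singular_term s n q"
      by (simp add: singular_term_def c_def)
  qed
  finally show ?thesis by (simp add: J_def)
qed

text \<open>On an arc every single factor is off by at most E = 32 T^5. The worst exchange loses a
  biquadratic factor N^(1/4) from the total N^(1 + s/4), which leaves the exponent 3/4 +
  s/4.\<close>

lemma norm_gen_minus_approx_le:
  assumes p: "p \<in> farey_pairs T" and t: "near_fraction N T p t" and N: "N \<ge> 1" and s: "s = 3 \<or> s = 4"
  shows "cmod (gen_exp_sum s N t - arc_approx s N p t) \<le> 6144 * real T ^ 5 * real N powr (3 / 4 + real s / 4)"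
proof -
  obtain q a where pq: "p = (q, a)" by (cases p)
  have q: "1 \<le> q" "q \<le> T" using p by (auto simp: pq farey_pairs_def)
  define \<theta> where "\<theta> = real a / real q"
  define \<beta> where "\<beta> = t - \<theta> - of_int (round (t - \<theta>))"
  define n where "n = real N"
  have n: "n \<ge> 1" using N by (simp add: n_def)
  have \<beta>: "\<bar>\<beta>\<bar> \<le> real T ^ 4 / n" using t by (simp add: near_fraction_def dist_int_def pq \<beta>_def \<theta>_def n_def)
  define E where "E = 32 * real T ^ 5"
  have T1: "real T \<ge> 1" using q by simp
  have E: "4 * real q * (1 + 2 * pi * n * \<bar>\<beta>\<bar>) \<le> E"
  proof -
    have "n * \<bar>\<beta>\<bar> \<le> real T ^ 4" using \<beta> n by (simp add: field_simps)
    then have "2 * pi * (n * \<bar>\<beta>\<bar>) \<le> 7 * real T ^ 4" using pi_approx n by (intro mult_mono) auto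
    moreover have "1 \<le> real T ^ 4" using T1 by simp
    ultimately have "1 + 2 * pi * n * \<bar>\<beta>\<bar> \<le> 8 * real T ^ 4" by (simp add: mult.assoc)
    then have "4 * real q * (1 + 2 * pi * n * \<bar>\<beta>\<bar>) \<le> 4 * real T * (8 * real T ^ 4)"
      using q n by (intro mult_mono) auto
    also have "\<dots> = E" by (simp add: E_def eval_nat_numeral)
    finally show ?thesis .
  qed
  define f2 g2 f4 g4 where "f2 = power_exp_sum 2 (floor_root 2 N) t" and "g2 = mean_exp_sum 2 q a * weight_sum (1 / 2) N (t - \<theta>)"
    and "f4 = power_exp_sum 4 (floor_root 4 N) t" and "g4 = mean_exp_sum 4 q a * weight_sum (1 / 4) N (t - \<theta>)"
  have tb: "t - (\<theta> + \<beta>) \<in> \<int>" "t - \<theta> - \<beta> \<in> \<int>" by (simp_all add: \<beta>_def)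
  have d2: "cmod (f2 - g2) \<le> E"
    using power_exp_sum_approx[OF q(1), of 2 N a \<beta>] E power_exp_sum_cong_Ints[OF tb(1), of 2 "floor_root 2 N"] weight_sum_cong_Ints[OF tb(2), of "1 / 2" N]
    by (simp add: f2_def g2_def \<theta>_def n_def)
  have d4: "cmod (f4 - g4) \<le> E"
    using power_exp_sum_approx[OF q(1), of 4 N a \<beta>] E power_exp_sum_cong_Ints[OF tb(1), of 4 "floor_root 4 N"] weight_sum_cong_Ints[OF tb(2), of "1 / 4" N]
    by (simp add: f4_def g4_def \<theta>_def n_def)
  \<comment> \<open>The factor 2 covers the generating sums and the weight sums alike, the latter
    being at most N^(1/k) + 1.\<close>
  define X Y where "X = 2 * n powr (1 / 2)" and "Y = 2 * n powr (1 / 4)"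
  have n1: "1 \<le> n powr x" if "x \<ge> 0" for x using n that by (simp add: ge_one_powr_ge_zero)
  have f2: "cmod f2 \<le> X" using order_trans[OF norm_power_exp_sum_le[of 2 "floor_root 2 N" t] floor_root_le[of 2 N]] n1[of "1 / 2"] by (simp add: f2_def X_def n_def)
  have f4: "cmod f4 \<le> Y" using order_trans[OF norm_power_exp_sum_le[of 4 "floor_root 4 N" t] floor_root_le[of 4 N]] n1[of "1 / 4"] by (simp add: f4_def Y_def n_def)
  have "cmod g2 \<le> 1 * (n powr (1 / 2) + 1)" unfolding g2_def norm_mult n_def
    by (intro mult_mono norm_mean_exp_sum_le_1 norm_weight_sum_le_powr) auto
  then have g2: "cmod g2 \<le> X" using n1[of "1 / 2"] by (simp add: X_def)
  have "cmod g4 \<le> 1 * (n powr (1 / 4) + 1)" unfolding g4_def norm_mult n_def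
    by (intro mult_mono norm_mean_exp_sum_le_1 norm_weight_sum_le_powr) auto
  then have g4: "cmod g4 \<le> Y" using n1[of "1 / 4"] by (simp add: Y_def)
  have X0: "X \<ge> 0" and Y0: "Y \<ge> 0" and E0: "E \<ge> 0" by (auto simp: X_def Y_def E_def)
  have "gen_exp_sum s N t - arc_approx s N p t = (f2 ^ 2 - g2 ^ 2) * f4 ^ s + g2 ^ 2 * (f4 ^ s - g4 ^ s)"
    by (simp add: gen_exp_sum_def arc_approx_def f2_def f4_def g2_def g4_def pq \<theta>_def algebra_simps)
  also have "cmod \<dots> \<le> (real 2 * X ^ (2 - 1) * E) * Y ^ s + X ^ 2 * (real s * Y ^ (s - 1) * E)"
    unfolding norm_mult norm_power
  proof (intro order_trans[OF norm_triangle_ineq] add_mono, unfold norm_mult norm_power)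
    have "cmod (f2 ^ 2 - g2 ^ 2) \<le> real 2 * X ^ (2 - 1) * E"
      using norm_power_diff_le[OF f2 g2, of 2] d2 X0 by (smt (verit) mult_left_mono mult_nonneg_nonneg of_nat_0_le_iff zero_le_power)
    then show "cmod (f2 ^ 2 - g2 ^ 2) * cmod f4 ^ s \<le> (real 2 * X ^ (2 - 1) * E) * Y ^ s"
      using f4 X0 Y0 E0 by (intro mult_mono power_mono) auto
    have "cmod (f4 ^ s - g4 ^ s) \<le> real s * Y ^ (s - 1) * E"
      using norm_power_diff_le[OF f4 g4, of s] d4 Y0 by (smt (verit) mult_left_mono mult_nonneg_nonneg of_nat_0_le_iff zero_le_power)
    then show "cmod g2 ^ 2 * cmod (f4 ^ s - g4 ^ s) \<le> X ^ 2 * (real s * Y ^ (s - 1) * E)"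
      using g2 X0 Y0 E0 by (intro mult_mono power_mono) auto
  qed
  also have "\<dots> = E * (4 * 2 ^ s * (n powr (1 / 2) * n powr (real s / 4)) + 4 * real s * 2 ^ (s - 1) * (n powr 1 * n powr (real (s - 1) / 4)))"
    using n by (simp add: X_def Y_def power_mult_distrib powr_power algebra_simps power2_eq_square flip: powr_add)
  also have "\<dots> \<le> E * (64 * n powr (3 / 4 + real s / 4) + 128 * n powr (3 / 4 + real s / 4))"
  proof (intro mult_left_mono add_mono E0)
    have "4 * 2 ^ s * (n powr (1 / 2) * n powr (real s / 4)) = 4 * 2 ^ s * n powr (1 / 2 + real s / 4)"
      by (simp add: powr_add)
    also have "\<dots> \<le> 64 * n powr (3 / 4 + real s / 4)"
      using s n by (intro mult_mono powr_mono) auto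
    finally show "4 * 2 ^ s * (n powr (1 / 2) * n powr (real s / 4)) \<le> 64 * n powr (3 / 4 + real s / 4)" .
    have "real (s - 1) = real s - 1" using s by auto
    then have "4 * real s * 2 ^ (s - 1) * (n powr 1 * n powr (real (s - 1) / 4)) = 4 * real s * 2 ^ (s - 1) * n powr (3 / 4 + real s / 4)"
      unfolding powr_add[symmetric] by (simp add: diff_divide_distrib algebra_simps)
    also have "\<dots> \<le> 128 * n powr (3 / 4 + real s / 4)" using s by (intro mult_right_mono) auto
    finally show "4 * real s * 2 ^ (s - 1) * (n powr 1 * n powr (real (s - 1) / 4)) \<le> 128 * n powr (3 / 4 + real s / 4)" .
  qed
  also have "\<dots> = 6144 * real T ^ 5 * n powr (3 / 4 + real s / 4)" by (simp add: E_def)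
  finally show ?thesis by (simp add: n_def)
qed

text \<open>Off its arc the biquadratic factors are small pointwise, with T^(-3) from s >= 3, while
  the squares are averaged at the cost of a logarithm.\<close>

lemma ravg_far_approx_le:
  assumes p: "p \<in> farey_pairs T" and N: "N \<ge> 1" and s: "s = 3 \<or> s = 4"
  shows "ravg (10 * N) (\<lambda>t. of_bool (\<not> near_fraction N T p t) * cmod (arc_approx s N p t))
    \<le> 81 * real N powr (real s / 4) / real T ^ 3 * (2 + ln (real N + 1))"
proof -
  obtain q a where pq: "p = (q, a)" by (cases p)
  have q: "1 \<le> q" "q \<le> T" using p by (auto simp: pq farey_pairs_def)
  then have T1: "real T \<ge> 1" by simp
  define \<theta> where "\<theta> = real a / real q"
  define K where "K = 81 * real N powr (real s / 4) / real T ^ 3"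
  have K: "K \<ge> 0" by (simp add: K_def)
  have "of_bool (\<not> near_fraction N T p t) * cmod (arc_approx s N p t) \<le> K * (cmod (weight_sum (1 / 2) N (t - \<theta>)))\<^sup>2" for t
  proof (cases "near_fraction N T p t")
    case True
    then show ?thesis using K by simp
  next
    case False
    then have far: "dist_int (t - \<theta>) > real T ^ 4 / real N" by (simp add: near_fraction_def pq \<theta>_def)
    have pos: "real T ^ 4 / real N > 0" using T1 N by simp
    have "cmod (weight_sum (1 / 4) N (t - \<theta>)) \<le> 3 * dist_int (t - \<theta>) powr - (1 / 4)"
      using far pos by (intro norm_weight_sum_le) auto
    also have "\<dots> \<le> 3 * (real T ^ 4 / real N) powr - (1 / 4)"
      using far pos by (intro mult_left_mono powr_mono2') auto
    also have "\<dots> = 3 * real N powr (1 / 4) / real T"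
      using T1 N powr_powr[of "real T" 4 "- (1 / 4)"] by (simp add: powr_divide powr_minus field_simps)
    finally have v: "cmod (weight_sum (1 / 4) N (t - \<theta>)) \<le> 3 * real N powr (1 / 4) / real T" .
    have "cmod (mean_exp_sum 4 q a * weight_sum (1 / 4) N (t - \<theta>)) ^ s \<le> (1 * (3 * real N powr (1 / 4) / real T)) ^ s"
      unfolding norm_mult by (intro power_mono mult_mono norm_mean_exp_sum_le_1 v) auto
    also have "\<dots> = 3 ^ s * real N powr (real s / 4) / real T ^ s"
      using N by (simp add: power_divide power_mult_distrib powr_power)
    also have "\<dots> \<le> 81 * real N powr (real s / 4) / real T ^ 3"
      using s T1 by (intro frac_le mult_right_mono power_increasing) auto
    finally have 1: "cmod (mean_exp_sum 4 q a * weight_sum (1 / 4) N (t - \<theta>)) ^ s \<le> K" by (simp add: K_def)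
    have "cmod (mean_exp_sum 2 q a * weight_sum (1 / 2) N (t - \<theta>)) \<le> 1 * cmod (weight_sum (1 / 2) N (t - \<theta>))"
      unfolding norm_mult by (intro mult_right_mono norm_mean_exp_sum_le_1) auto
    then have 2: "cmod (mean_exp_sum 2 q a * weight_sum (1 / 2) N (t - \<theta>)) ^ 2 \<le> (cmod (weight_sum (1 / 2) N (t - \<theta>)))\<^sup>2"
      by (intro power_mono) auto
    have "cmod (arc_approx s N p t) = cmod (mean_exp_sum 2 q a * weight_sum (1 / 2) N (t - \<theta>)) ^ 2 * cmod (mean_exp_sum 4 q a * weight_sum (1 / 4) N (t - \<theta>)) ^ s"
      by (simp add: arc_approx_def pq \<theta>_def norm_mult norm_power)
    also have "\<dots> \<le> (cmod (weight_sum (1 / 2) N (t - \<theta>)))\<^sup>2 * K"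
      using 1 2 by (intro mult_mono) auto
    finally show ?thesis using False by (simp add: mult.commute)
  qed
  then have "ravg (10 * N) (\<lambda>t. of_bool (\<not> near_fraction N T p t) * cmod (arc_approx s N p t))
      \<le> ravg (10 * N) (\<lambda>t. K * (cmod (weight_sum (1 / 2) N (t - \<theta>)))\<^sup>2)"
    by (intro ravg_mono)
  also have "\<dots> = K * ravg (10 * N) (\<lambda>t. (cmod (weight_sum (1 / 2) N (t - \<theta>)))\<^sup>2)" by (rule ravg_cmult)
  also have "\<dots> \<le> K * (2 + ln (real N + 1))"
    using K N by (intro mult_left_mono ravg_norm_weight_sum_half_le) auto
  finally show ?thesis by (simp add: K_def)
qed

text \<open>Compare the generating function cut off to the major arcs with the sum of all
  approximants. At most one arc contains t: its approximant is close to the generating function, and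
  all other approximants are in their far range. Hence the error K per arc point and L per
  fraction.\<close>

lemma major_arcs_approx:
  assumes n: "n \<le> N" and T: "T \<ge> 1" "2 * T ^ 6 < N" and s: "s = 3 \<or> s = 4"
  shows "cmod (of_nat (R s n) - avg (10 * N) (\<lambda>t. of_bool (\<not> on_major_arc N T t) * gen_exp_sum s N t * ee (- (real n * t)))
      - (\<Sum>p\<in>farey_pairs T. avg (10 * N) (\<lambda>t. arc_approx s N p t * ee (- (real n * t)))))
    \<le> 43008 * real T ^ 11 * real N powr (real s / 4 - 1 / 4) + 81 * real N powr (real s / 4) / real T * (2 + ln (real N + 1))"
proof -
  have N: "N \<ge> 1" using T by linarith
  define M where "M = 10 * N"
  define D where "D t = gen_exp_sum s N t - of_bool (\<not> on_major_arc N T t) * gen_exp_sum s N t - (\<Sum>p\<in>farey_pairs T. arc_approx s N p t)" for t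
  define K where "K = 6144 * real T ^ 5 * real N powr (3 / 4 + real s / 4)"
  define L where "L = 81 * real N powr (real s / 4) / real T ^ 3 * (2 + ln (real N + 1))"
  have K0: "K \<ge> 0" by (simp add: K_def)
  have "of_nat (R s n) - avg M (\<lambda>t. of_bool (\<not> on_major_arc N T t) * gen_exp_sum s N t * ee (- (real n * t)))
      - (\<Sum>p\<in>farey_pairs T. avg M (\<lambda>t. arc_approx s N p t * ee (- (real n * t)))) = avg M (\<lambda>t. D t * ee (- (real n * t)))"
    using R_eq_avg[OF n N] s unfolding M_def D_def left_diff_distrib avg_diff sum_distrib_right avg_sum by auto
  also have "cmod \<dots> \<le> ravg M (\<lambda>t. cmod (D t * ee (- (real n * t))))" by (rule norm_avg_le)
  also have "\<dots> = ravg M (\<lambda>t. cmod (D t))" by (simp add: norm_mult)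
  also have "\<dots> \<le> ravg M (\<lambda>t. \<Sum>p\<in>farey_pairs T. K * of_bool (near_fraction N T p t) + of_bool (\<not> near_fraction N T p t) * cmod (arc_approx s N p t))"
  proof (rule ravg_mono)
    fix b
    define t where "t = real b / real M"
    let ?f = "\<lambda>p. K * of_bool (near_fraction N T p t) + of_bool (\<not> near_fraction N T p t) * cmod (arc_approx s N p t)"
    have f0: "?f p \<ge> 0" for p using K0 by (intro add_nonneg_nonneg mult_nonneg_nonneg) auto
    have "cmod (D t) \<le> (\<Sum>p\<in>farey_pairs T. ?f p)"
    proof (cases "on_major_arc N T t")
      case False
      then have "D t = - (\<Sum>p\<in>farey_pairs T. arc_approx s N p t)" by (simp add: D_def)
      then have "cmod (D t) \<le> (\<Sum>p\<in>farey_pairs T. cmod (arc_approx s N p t))" by (simp add: norm_sum)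
      also have "\<dots> \<le> (\<Sum>p\<in>farey_pairs T. ?f p)" using False by (intro sum_mono) (auto simp: on_major_arc_def)
      finally show ?thesis .
    next
      case True
      then obtain p where p: "p \<in> farey_pairs T" "near_fraction N T p t" by (auto simp: on_major_arc_def)
      have other: "\<not> near_fraction N T p' t" if "p' \<in> farey_pairs T - {p}" for p'
        using near_fraction_unique[OF T(2) p(1) _ p(2), of p'] that by auto
      have "D t = (gen_exp_sum s N t - arc_approx s N p t) - (\<Sum>p'\<in>farey_pairs T - {p}. arc_approx s N p' t)"
        using True by (simp add: D_def sum.remove[OF finite_farey_pairs p(1)])
      also have "cmod \<dots> \<le> K + (\<Sum>p'\<in>farey_pairs T - {p}. cmod (arc_approx s N p' t))"
        unfolding K_def by (intro order_trans[OF norm_triangle_ineq4] add_mono norm_sum norm_gen_minus_approx_le p N s)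
      also have "\<dots> \<le> ?f p + (\<Sum>p'\<in>farey_pairs T - {p}. ?f p')"
        using p other by (intro add_mono sum_mono) auto
      also have "\<dots> = (\<Sum>p\<in>farey_pairs T. ?f p)" by (simp add: sum.remove[OF finite_farey_pairs p(1)])
      finally show ?thesis .
    qed
    then show "cmod (D (real b / real M)) \<le> (\<Sum>p\<in>farey_pairs T. K * of_bool (near_fraction N T p (real b / real M)) + of_bool (\<not> near_fraction N T p (real b / real M)) * cmod (arc_approx s N p (real b / real M)))"
      by (simp only: t_def)
  qed
  also have "\<dots> = (\<Sum>p\<in>farey_pairs T. K * ravg M (\<lambda>t. of_bool (near_fraction N T p t)) + ravg M (\<lambda>t. of_bool (\<not> near_fraction N T p t) * cmod (arc_approx s N p t)))"
    by (simp only: ravg_sum ravg_add ravg_cmult)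
  also have "\<dots> \<le> (\<Sum>p\<in>farey_pairs T. K * (7 * (real T ^ 4 / real N)) + L)"
  proof (intro sum_mono add_mono mult_left_mono K0)
    fix p assume p: "p \<in> farey_pairs T"
    define \<theta> where "\<theta> = real (snd p) / real (fst p)"
    have th: "0 \<le> \<theta>" "\<theta> \<le> 1" using p by (auto simp: farey_pairs_def \<theta>_def)
    have "ravg M (\<lambda>t. of_bool (near_fraction N T p t)) \<le> 6 * (real T ^ 4 / real N) + 3 / real M"
      unfolding near_fraction_def \<theta>_def[symmetric] by (rule ravg_near_le) (use th N in \<open>auto simp: M_def\<close>)
    also have "3 / real M \<le> real T ^ 4 / real N"
    proof -
      have "3 / real M \<le> 1 / real N" using N by (simp add: M_def divide_simps)
      also have "\<dots> \<le> real T ^ 4 / real N" using T(1) by (intro divide_right_mono) auto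
      finally show ?thesis .
    qed
    finally show "ravg M (\<lambda>t. of_bool (near_fraction N T p t)) \<le> 7 * (real T ^ 4 / real N)" by simp
    show "ravg M (\<lambda>t. of_bool (\<not> near_fraction N T p t) * cmod (arc_approx s N p t)) \<le> L"
      unfolding M_def L_def by (rule ravg_far_approx_le[OF p N s])
  qed
  also have "\<dots> = real (card (farey_pairs T)) * (K * (7 * (real T ^ 4 / real N)) + L)" by simp
  also have "\<dots> \<le> (real T)\<^sup>2 * (K * (7 * (real T ^ 4 / real N)) + L)"
  proof (rule mult_right_mono)
    show "real (card (farey_pairs T)) \<le> (real T)\<^sup>2" using card_farey_pairs_le[of T] by (metis of_nat_le_iff of_nat_power)
    have "L \<ge> 0" unfolding L_def by (intro mult_nonneg_nonneg divide_nonneg_nonneg add_nonneg_nonneg) auto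
    then show "K * (7 * (real T ^ 4 / real N)) + L \<ge> 0" using K0 by simp
  qed
  \<comment> \<open>At most T^2 fractions: T^2 * T^5 * T^4 = T^11 from the arcs, T^2 * T^(-3) = 1/T
    from the far ranges, and 43008 = 7 * 6144.\<close>
  also have "\<dots> = 43008 * real T ^ 11 * (real N powr (3 / 4 + real s / 4) / real N powr 1) + 81 * real N powr (real s / 4) / real T * (2 + ln (real N + 1))"
    using T(1) N by (simp add: K_def L_def eval_nat_numeral field_simps)
  also have "real N powr (3 / 4 + real s / 4) / real N powr 1 = real N powr (real s / 4 - 1 / 4)"
    unfolding powr_diff[symmetric] by (simp add: algebra_simps)
  finally show ?thesis by (simp add: M_def)
qed

section \<open>Minor arcs\<close>

text \<open>Dirichlet's theorem with denominators up to N / T yields q <= N / T, while q <= T would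
  put t on a major arc. For T < q <= N / T every term in Weyl's bound is at most a constant times
  D^2 y L with y = N / T.\<close>

lemma norm_power_exp_sum_minor_le:
  assumes t: "\<not> on_major_arc N T t" and T: "T \<ge> 2" "T ^ 4 \<le> N"
    and D: "\<And>h. 0 < h \<Longrightarrow> h \<le> N \<Longrightarrow> card {d. d dvd h} \<le> D" "D \<ge> 1"
  shows "cmod (power_exp_sum 4 (floor_root 4 N) t) ^ 8 \<le> 120000 * (real N)\<^sup>2 * (real D)\<^sup>2 * (1 + ln (real N)) / real T"
proof -
  define N' where "N' = N div T"
  define n where "n = real N"
  have "T ^ 1 \<le> T ^ 4" using T by (intro power_increasing) auto
  then have TN: "T \<le> N" using T by simp
  have N1: "N \<ge> 1" using T TN by linarith
  have N'1: "N' \<ge> 1" unfolding N'_def using TN T by (simp add: div_greater_zero_iff Suc_leI)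
  have N'le: "real N' \<le> n / real T" unfolding N'_def n_def by (rule of_nat_div_le_of_nat)
  have N'ge: "n \<le> 2 * real T * real N'"
  proof -
    have "N < T * N' + T" unfolding N'_def using dividend_less_times_div[of T N] T by simp
    also have "\<dots> \<le> T * N' + T * N'" using N'1 by simp
    finally have "N \<le> 2 * T * N'" by simp
    then show ?thesis unfolding n_def by (metis of_nat_le_iff of_nat_mult of_nat_numeral)
  qed
  obtain h k where hk: "coprime h k" "0 < k" "k \<le> int N'" "\<bar>of_int k * t - of_int h\<bar> < 1 / real N'"
    using Dirichlet_approx_coprime[of N' t] N'1 by auto
  define q where "q = nat k"
  have q: "q \<ge> 1" "q \<le> N'" "k = int q" using hk by (auto simp: q_def)
  have "\<bar>t - of_int h / real q\<bar> = \<bar>of_int k * t - of_int h\<bar> / real q"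
    using q by (simp add: field_simps abs_divide[symmetric])
  also have "\<dots> \<le> (1 / real N') / real q" using hk q by (intro divide_right_mono) auto
  finally have ap: "\<bar>t - of_int h / real q\<bar> \<le> 1 / (real N' * real q)" by simp
  have "q > T"
  proof (rule ccontr)
    assume "\<not> q > T"
    then have qT: "q \<le> T" by simp
    \<comment> \<open>The representative of h modulo q in 1..q instead of 0..q-1, as required for
      Farey pairs.\<close>
    define a where "a = nat ((h - 1) mod int q + 1)"
    have a: "int a = (h - 1) mod int q + 1" using q by (simp add: a_def)
    have am: "a \<ge> 1" "a \<le> q" using q pos_mod_bound[of "int q" "h - 1"] pos_mod_sign[of "int q" "h - 1"] a by linarith+
    define w where "w = (h - 1) div int q"
    have h: "h = int a + int q * w" using a by (simp add: w_def minus_mod_eq_mult_div[symmetric])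
    have "coprime (int a) (int q)" using hk(1) unfolding q(3) h
      by (metis coprime_iff_gcd_eq_1 gcd_add_mult gcd.commute add.commute mult.commute)
    then have "(q, a) \<in> farey_pairs T" using am q qT by (simp add: farey_pairs_def)
    moreover have "near_fraction N T (q, a) t"
    proof -
      have "t - real a / real q - of_int w = t - of_int h / real q" using q by (simp add: h field_simps)
      then have "dist_int (t - real a / real q) \<le> 1 / (real N' * real q)"
        using dist_int_le[of "t - real a / real q" w] ap by simp
      also have "\<dots> \<le> 1 / real N'" using q N'1 by (intro divide_left_mono) auto
      also have "\<dots> \<le> 2 * real T / n"
        using N'ge N'1 N1 by (simp add: n_def field_simps)
      also have "\<dots> \<le> real T ^ 4 / n"
      proof (rule divide_right_mono)
        have "2 * 1 \<le> real T * (real T * real T)" using T mult_mono[of 1 "real T" 1 "real T"] by (intro mult_mono) auto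
        then have "2 * 1 * real T \<le> real T * (real T * real T) * real T" by (intro mult_right_mono) auto
        then show "2 * real T \<le> real T ^ 4" by (simp add: eval_nat_numeral mult_ac)
      qed (simp add: n_def)
      finally show ?thesis by (simp add: near_fraction_def n_def)
    qed
    ultimately show False using t by (auto simp: on_major_arc_def)
  qed
  define B where "B = floor_root 4 N"
  define b where "b = n powr (1 / 4)"
  have n1: "n \<ge> 1" using N1 by (simp add: n_def)
  have B1: "B \<ge> 1" unfolding B_def by (subst le_floor_root_iff) (use N1 in auto)
  have Bb: "real B \<le> b" using floor_root_le[of 4 N] by (simp add: B_def b_def n_def)
  have b1: "b \<ge> 1" using B1 Bb by linarith
  have b4: "b ^ 4 = n" using n1 by (simp add: b_def powr_power)
  have BN: "B ^ 3 \<le> N"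
  proof -
    have "B ^ 3 \<le> B ^ 4" using B1 by (intro power_increasing) auto
    also have "\<dots> \<le> N" using le_floor_root_iff[of 4 B N] by (simp add: B_def)
    finally show ?thesis .
  qed
  \<comment> \<open>From T^4 <= N; this makes b^3 <= N / T, so that the terms free of q are as small
    as those with it.\<close>
  have Tb: "real T \<le> b"
  proof (rule power_le_imp_le_base[of _ 3])
    show "real T ^ Suc 3 \<le> b ^ Suc 3" using T(2) b4 by (simp add: n_def flip: of_nat_power)
  qed (use b1 in auto)
  define y where "y = n / real T"
  define L where "L = 1 + ln n"
  have L1: "L \<ge> 1" using n1 by (simp add: L_def)
  have b3: "b ^ 3 \<le> y"
  proof -
    have "b ^ 3 * real T \<le> b ^ 3 * b" using Tb b1 by (intro mult_left_mono) auto
    then show ?thesis using T b4 by (simp add: y_def field_simps eval_nat_numeral)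
  qed
  have "b ^ 1 \<le> b ^ 3" using b1 by (intro power_increasing) auto
  then have bley: "b \<le> y" using b3 by simp
  have B3y: "real B ^ 3 \<le> y" using b3 power_mono[OF Bb, of 3] by simp
  have y0: "y \<ge> 0" using bley b1 by simp
  have qy: "real q \<le> y" using q N'le by (simp add: y_def)
  have qn: "real q \<le> n" using qy T n1 divide_left_mono[of 1 "real T" n] by (simp add: y_def)
  have lq: "1 + ln (real q) \<le> L" "1 + ln (real q) \<ge> 0" using qn q by (auto simp: L_def)
  have ap': "\<bar>t - of_int h / real q\<bar> \<le> 1 / (real q)\<^sup>2"
  proof -
    have "1 / (real N' * real q) \<le> 1 / (real q)\<^sup>2"
      using q N'1 by (intro divide_left_mono) (auto simp: power2_eq_square intro!: mult_right_mono)
    then show ?thesis using ap by linarith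
  qed
  have "cmod (power_exp_sum 4 B t) ^ 8 \<le> (3 * real B) ^ 4 * (81 * real B ^ 3 + 8 * (real D)\<^sup>2 *
    ((24 * real B ^ 3 / real q + 1) * (5 * real B + 2 * real q * (1 + ln (real q)))))"
    unfolding power_exp_sum_def
    by (rule weyl_quartic[OF B1 D(1) q(1) _ ap']) (use BN hk q in auto)
  also have "\<dots> \<le> (81 * n) * (81 * ((real D)\<^sup>2 * (y * L)) + 8 * (real D)\<^sup>2 * (175 * (y * L)))"
  proof -
    have "real B ^ 4 \<le> b ^ 4" using Bb by (intro power_mono) auto
    then have i: "(3 * real B) ^ 4 \<le> 81 * n" using b4 by (simp add: power_mult_distrib)
    have "1 * (y * 1) \<le> (real D)\<^sup>2 * (y * L)" using D(2) L1 y0 by (intro mult_mono) auto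
    then have ii: "81 * real B ^ 3 \<le> 81 * ((real D)\<^sup>2 * (y * L))" using B3y by simp
    have "real B ^ 3 / real q * real B \<le> y"
    proof -
      have "real B ^ 3 * real B = real B ^ 4" by (simp add: eval_nat_numeral)
      also have "\<dots> \<le> n" using power_mono[OF Bb, of 4] b4 by simp
      finally have "real B ^ 3 / real q * real B \<le> n / real q" using q by (simp add: divide_right_mono)
      also have "\<dots> \<le> y" unfolding y_def using \<open>q > T\<close> T n1 by (intro divide_left_mono) auto
      finally show ?thesis .
    qed
    then have 1: "120 * (real B ^ 3 / real q * real B) \<le> 120 * (y * L)" using mult_left_mono[OF L1 y0] by simp
    have 2: "48 * (real B ^ 3 * (1 + ln (real q))) \<le> 48 * (y * L)"
      using B3y lq y0 by (intro mult_left_mono mult_mono) auto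
    have 3: "5 * real B \<le> 5 * (y * L)" using Bb \<open>b \<le> y\<close> mult_left_mono[OF L1 y0] by simp
    have 4: "2 * (real q * (1 + ln (real q))) \<le> 2 * (y * L)"
      using qy lq y0 by (intro mult_left_mono mult_mono) auto
    have "(24 * real B ^ 3 / real q + 1) * (5 * real B + 2 * real q * (1 + ln (real q)))
        = 120 * (real B ^ 3 / real q * real B) + 48 * (real B ^ 3 * (1 + ln (real q))) + 5 * real B + 2 * (real q * (1 + ln (real q)))"
      using q by (simp add: algebra_simps)
    also have "\<dots> \<le> 175 * (y * L)" using 1 2 3 4 by linarith
    finally have "8 * (real D)\<^sup>2 * ((24 * real B ^ 3 / real q + 1) * (5 * real B + 2 * real q * (1 + ln (real q)))) \<le> 8 * (real D)\<^sup>2 * (175 * (y * L))"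
      by (rule mult_left_mono) simp
    with ii have "81 * real B ^ 3 + 8 * (real D)\<^sup>2 * ((24 * real B ^ 3 / real q + 1) * (5 * real B + 2 * real q * (1 + ln (real q))))
        \<le> 81 * ((real D)\<^sup>2 * (y * L)) + 8 * (real D)\<^sup>2 * (175 * (y * L))" by (rule add_mono)
    with i show ?thesis by (rule mult_mono) (use n1 lq in auto)
  qed
  also have "\<dots> = 119961 * (n * ((real D)\<^sup>2 * (y * L)))" by (simp add: algebra_simps)
  also have "\<dots> \<le> 120000 * (n * ((real D)\<^sup>2 * (y * L)))" using n1 y0 L1 by (intro mult_right_mono) auto
  also have "\<dots> = 120000 * n\<^sup>2 * (real D)\<^sup>2 * L / real T" by (simp add: y_def power2_eq_square)
  finally show ?thesis by (simp add: B_def L_def n_def)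
qed

section \<open>Mean values over the grid by counting coincidences\<close>

lemma square_sum_mult:
  fixes U :: "nat set" and k :: "'i \<Rightarrow> int"
  shows "(\<Sum>u\<in>U. ee (of_int ((int u)\<^sup>2) * t)) * (\<Sum>i\<in>I. c i * ee (of_int (k i) * t))
    = (\<Sum>p\<in>U \<times> I. c (snd p) * ee (of_int ((case p of (u, i) \<Rightarrow> (int u)\<^sup>2 + k i)) * t))"
  unfolding sum_product sum.cartesian_product
  by (intro sum.cong refl) (auto simp: distrib_right ee_add)

lemma power_exp_sum_2_altdef: "power_exp_sum 2 A t = (\<Sum>u\<in>{1..A}. ee (of_int ((int u)\<^sup>2) * t))"
  by (simp add: power_exp_sum_def)

text \<open>Biquadrates written as squares of squares, so that each biquadratic variable can be
  added by \<open>coincidences_add_square\<close> too.\<close>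

lemma power_exp_sum_4_altdef: "power_exp_sum 4 B t = (\<Sum>u\<in>(\<lambda>y. y\<^sup>2) ` {1..B}. ee (of_int ((int u)\<^sup>2) * t))"
proof -
  have "inj_on (\<lambda>y::nat. y\<^sup>2) {1..B}" by (auto simp: inj_on_def power2_eq_iff_nonneg)
  then show ?thesis by (simp add: sum.reindex power_exp_sum_def flip: power_mult)
qed

lemma coincidences_inj:
  assumes "inj_on k I"
  shows "coincidences I k = card I"
proof -
  have "{(i, j). i \<in> I \<and> j \<in> I \<and> k i = k j} = (\<lambda>i. (i, i)) ` I"
    using assms by (auto simp: inj_on_def)
  then show ?thesis by (simp add: coincidences_def card_image inj_on_def)
qed

lemma floor_root_products_le:
  fixes N :: nat
  defines "A \<equiv> floor_root 2 N" and "B \<equiv> floor_root 4 N"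
  shows "B\<^sup>2 \<le> A" "A * B\<^sup>2 \<le> N" "B ^ 4 \<le> N"
proof -
  show B4: "B ^ 4 \<le> N" using le_floor_root_iff[of 4 B N] by (simp add: B_def)
  then show BA: "B\<^sup>2 \<le> A" unfolding A_def by (subst le_floor_root_iff) (auto simp flip: power_mult)
  have "A * B\<^sup>2 \<le> A * A" using BA by simp
  also have "\<dots> \<le> N" using le_floor_root_iff[of 2 A N] by (simp add: A_def power2_eq_square)
  finally show "A * B\<^sup>2 \<le> N" .
qed

lemma square_le_floor_root:
  shows "u \<in> {1..floor_root 2 N} \<Longrightarrow> 0 \<le> (int u)\<^sup>2 \<and> (int u)\<^sup>2 \<le> int N"
    and "u \<in> (\<lambda>y. y\<^sup>2) ` {1..floor_root 4 N} \<Longrightarrow> 0 \<le> (int u)\<^sup>2 \<and> (int u)\<^sup>2 \<le> int N"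
proof -
  show "0 \<le> (int u)\<^sup>2 \<and> (int u)\<^sup>2 \<le> int N" if u: "u \<in> {1..floor_root 2 N}"
  proof -
    have "u ^ 2 \<le> N" using u le_floor_root_iff[of 2 u N] by simp
    then show ?thesis by (simp flip: of_nat_power)
  qed
  show "0 \<le> (int u)\<^sup>2 \<and> (int u)\<^sup>2 \<le> int N" if u: "u \<in> (\<lambda>y. y\<^sup>2) ` {1..floor_root 4 N}"
  proof -
    obtain y where y: "u = y\<^sup>2" "y \<le> floor_root 4 N" using u by auto
    then have "y ^ 4 \<le> N" using le_floor_root_iff[of 4 y N] by simp
    then have "u\<^sup>2 \<le> N" using y by (simp flip: power_mult)
    then show ?thesis by (simp flip: of_nat_power)
  qed
qed

text \<open>Adding the variables of x^2 + y1^4 + y2^4 one by one gives at most 2D B^2, then A (2D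
  B^2) + D B^4. Since A B^2 <= N and B^4 <= N, the mean square has essentially diagonal
  size.\<close>

lemma ravg_f2_f4_square_le:
  assumes N: "N \<ge> 1" and D: "\<And>h. 0 < h \<Longrightarrow> h \<le> 10 * N \<Longrightarrow> card {d. d dvd h} \<le> D" "D \<ge> 1"
  shows "ravg (10 * N) (\<lambda>t. (cmod (power_exp_sum 2 (floor_root 2 N) t * power_exp_sum 4 (floor_root 4 N) t ^ 2))\<^sup>2) \<le> 4 * real D * real N"
proof -
  define A B where "A = floor_root 2 N" and "B = floor_root 4 N"
  note AB = floor_root_products_le[of N, folded A_def B_def]
  define U2 U4 where "U2 = {1..A}" and "U4 = (\<lambda>y. y\<^sup>2) ` {1..B}"
  have U: "finite U2" "0 \<notin> U2" "finite U4" "0 \<notin> U4" by (auto simp: U2_def U4_def)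
  have inj: "inj_on (\<lambda>y::nat. y\<^sup>2) {1..B}" by (auto simp: inj_on_def power2_eq_iff_nonneg)
  have card: "card U2 = A" "card U4 = B" using inj by (auto simp: U2_def U4_def card_image)
  have b2: "0 \<le> (int u)\<^sup>2 \<and> (int u)\<^sup>2 \<le> int N" if "u \<in> U2" for u
    using that square_le_floor_root(1) unfolding U2_def A_def by blast
  have b4: "0 \<le> (int u)\<^sup>2 \<and> (int u)\<^sup>2 \<le> int N" if "u \<in> U4" for u
    using that square_le_floor_root(2) unfolding U4_def B_def by blast
  define k1 where "k1 = (\<lambda>u::nat. (int u)\<^sup>2)"
  define k2 where "k2 = (\<lambda>(u, i). (int u)\<^sup>2 + k1 i)"
  define k3 where "k3 = (\<lambda>(u, i). (int u)\<^sup>2 + k2 i)"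
  have r1: "0 \<le> k1 i \<and> k1 i \<le> int N" if "i \<in> U4" for i using b4[OF that] by (simp add: k1_def)
  have r2: "0 \<le> k2 i \<and> k2 i \<le> 2 * int N" if "i \<in> U4 \<times> U4" for i
  proof -
    have "fst i \<in> U4" "snd i \<in> U4" using that by auto
    from b4[OF this(1)] r1[OF this(2)] show ?thesis unfolding k2_def case_prod_unfold by linarith
  qed
  have r3: "0 \<le> k3 i \<and> k3 i \<le> 3 * int N" if "i \<in> U2 \<times> U4 \<times> U4" for i
  proof -
    have "fst i \<in> U2" "snd i \<in> U4 \<times> U4" using that by auto
    from b2[OF this(1)] r2[OF this(2)] show ?thesis unfolding k3_def case_prod_unfold by linarith
  qed
  have c1: "coincidences U4 k1 = B" 
    by (subst coincidences_inj) (auto simp: card inj_on_def k1_def power2_eq_iff_nonneg)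
  have "coincidences (U4 \<times> U4) k2 \<le> card U4 * coincidences U4 k1 + D * (card U4)\<^sup>2"
    unfolding k2_def
  proof (rule coincidences_add_square[OF U(3,4,3) D(1)])
    fix i j assume "i \<in> U4" "j \<in> U4"
    then show "\<bar>k1 i - k1 j\<bar> \<le> int (10 * N)" using r1[of i] r1[of j] by linarith
  qed auto
  then have c2: "coincidences (U4 \<times> U4) k2 \<le> 2 * D * B\<^sup>2"
    using mult_right_mono[OF D(2), of "B * B"] unfolding card c1 power2_eq_square by linarith
  have fin: "finite (U4 \<times> U4)" "finite (U2 \<times> U4 \<times> U4)" using U by auto
  have "coincidences (U2 \<times> U4 \<times> U4) k3 \<le> card U2 * coincidences (U4 \<times> U4) k2 + D * (card (U4 \<times> U4))\<^sup>2"
    unfolding k3_def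
  proof (rule coincidences_add_square[OF U(1,2) fin(1) D(1)])
    fix i j assume "i \<in> U4 \<times> U4" "j \<in> U4 \<times> U4"
    then show "\<bar>k2 i - k2 j\<bar> \<le> int (10 * N)" using r2[of i] r2[of j] by linarith
  qed auto
  also have "\<dots> \<le> A * (2 * D * B\<^sup>2) + D * B ^ 4"
    using c2 by (intro add_mono) (auto simp: card card_cartesian_product power2_eq_square eval_nat_numeral)
  also have "\<dots> = 2 * D * (A * B\<^sup>2) + D * B ^ 4" by simp
  also have "\<dots> \<le> 2 * D * N + D * N" using AB by (intro add_mono mult_left_mono) auto
  finally have c3: "coincidences (U2 \<times> U4 \<times> U4) k3 \<le> 4 * D * N" by simp
  have eq: "power_exp_sum 2 A t * power_exp_sum 4 B t ^ 2 = (\<Sum>p\<in>U2 \<times> U4 \<times> U4. 1 * ee (of_int (k3 p) * t))" for t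
  proof -
    have f4: "power_exp_sum 4 B t = (\<Sum>u\<in>U4. 1 * ee (of_int (k1 u) * t))" by (simp add: power_exp_sum_4_altdef U4_def k1_def)
    have "power_exp_sum 4 B t * power_exp_sum 4 B t = (\<Sum>p\<in>U4 \<times> U4. 1 * ee (of_int (k2 p) * t))"
      by (subst (2) f4) (simp only: power_exp_sum_4_altdef U4_def[symmetric] square_sum_mult k2_def)
    then have "power_exp_sum 2 A t * power_exp_sum 4 B t ^ 2 = power_exp_sum 2 A t * (\<Sum>p\<in>U4 \<times> U4. 1 * ee (of_int (k2 p) * t))"
      by (simp only: power2_eq_square)
    then show ?thesis by (simp only: power_exp_sum_2_altdef U2_def[symmetric] square_sum_mult k3_def)
  qed
  have "ravg (10 * N) (\<lambda>t. (cmod (\<Sum>p\<in>U2 \<times> U4 \<times> U4. 1 * ee (of_int (k3 p) * t)))\<^sup>2) \<le> real (coincidences (U2 \<times> U4 \<times> U4) k3)"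
  proof (rule ravg_trig_sum_le[OF fin(2)])
    fix i j assume "i \<in> U2 \<times> U4 \<times> U4" "j \<in> U2 \<times> U4 \<times> U4"
    then show "\<bar>k3 i - k3 j\<bar> < int (10 * N)" using r3[of i] r3[of j] N by linarith
  qed auto
  also have "\<dots> \<le> real (4 * D * N)" using c3 by (simp only: of_nat_le_iff)
  finally show ?thesis unfolding A_def[symmetric] B_def[symmetric] eq by simp
qed

text \<open>Starting from the z distinct elements of Z, adding a square gives A z + D z^2 for s = 3.
  For s = 4, adding a biquadrate and then a square gives A B z + D z^2 (A + B^2), where B^2 <=
  A.\<close>

lemma ravg_f2_exceptional_le:
  assumes N: "N \<ge> 1" and D: "\<And>h. 0 < h \<Longrightarrow> h \<le> 10 * N \<Longrightarrow> card {d. d dvd h} \<le> D" "D \<ge> 1"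
    and s: "s = 3 \<or> s = 4" and Z: "Z \<subseteq> {1..N}" and \<eta>: "\<And>n. n \<in> Z \<Longrightarrow> cmod (\<eta> n) \<le> 1"
  shows "ravg (10 * N) (\<lambda>t. (cmod (power_exp_sum 2 (floor_root 2 N) t * power_exp_sum 4 (floor_root 4 N) t ^ (s - 3) * (\<Sum>n\<in>Z. \<eta> n * ee (- (real n * t)))))\<^sup>2)
    \<le> real N powr ((real s - 1) / 4) * real (card Z) + 2 * real D * real N powr ((real s - 3) / 2) * (real (card Z))\<^sup>2"
proof -
  define A B where "A = floor_root 2 N" and "B = floor_root 4 N"
  define z where "z = card Z"
  note AB = floor_root_products_le[of N, folded A_def B_def]
  have Ar: "real A \<le> real N powr (1 / 2)" and Br: "real B \<le> real N powr (1 / 4)"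
    using floor_root_le[of 2 N] floor_root_le[of 4 N] by (simp_all add: A_def B_def)
  define U2 U4 where "U2 = {1..A}" and "U4 = (\<lambda>y. y\<^sup>2) ` {1..B}"
  have U: "finite U2" "0 \<notin> U2" "finite U4" "0 \<notin> U4" by (auto simp: U2_def U4_def)
  have inj: "inj_on (\<lambda>y::nat. y\<^sup>2) {1..B}" by (auto simp: inj_on_def power2_eq_iff_nonneg)
  have card: "card U2 = A" "card U4 = B" using inj by (auto simp: U2_def U4_def card_image)
  have b2: "0 \<le> (int u)\<^sup>2 \<and> (int u)\<^sup>2 \<le> int N" if "u \<in> U2" for u
    using that square_le_floor_root(1) unfolding U2_def A_def by blast
  have b4: "0 \<le> (int u)\<^sup>2 \<and> (int u)\<^sup>2 \<le> int N" if "u \<in> U4" for u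
    using that square_le_floor_root(2) unfolding U4_def B_def by blast
  have finZ: "finite Z" using Z finite_subset by blast
  define k1 where "k1 = (\<lambda>n::nat. - int n)"
  have r1: "- int N \<le> k1 i \<and> k1 i \<le> 0" if "i \<in> Z" for i using that Z by (auto simp: k1_def)
  have c1: "coincidences Z k1 = z" by (subst coincidences_inj) (auto simp: inj_on_def k1_def z_def)
  have KK: "(\<Sum>n\<in>Z. \<eta> n * ee (- (real n * t))) = (\<Sum>n\<in>Z. \<eta> n * ee (of_int (k1 n) * t))" for t
    by (simp add: k1_def)
  show ?thesis
  proof (cases "s = 3")
    case True
    define k2 where "k2 = (\<lambda>(u, i). (int u)\<^sup>2 + k1 i)"
    have r2: "- int N \<le> k2 i \<and> k2 i \<le> int N" if "i \<in> U2 \<times> Z" for i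
  proof -
    have "fst i \<in> U2" "snd i \<in> Z" using that by auto
    from b2[OF this(1)] r1[OF this(2)] show ?thesis unfolding k2_def case_prod_unfold by linarith
  qed
    have fin: "finite (U2 \<times> Z)" using U finZ by auto
    have c2: "coincidences (U2 \<times> Z) k2 \<le> card U2 * coincidences Z k1 + D * (card Z)\<^sup>2"
      unfolding k2_def
  proof (rule coincidences_add_square[OF U(1,2) finZ D(1)])
    fix i j assume "i \<in> Z" "j \<in> Z"
    then show "\<bar>k1 i - k1 j\<bar> \<le> int (10 * N)" using r1[of i] r1[of j] by linarith
  qed auto
    have "ravg (10 * N) (\<lambda>t. (cmod (\<Sum>p\<in>U2 \<times> Z. \<eta> (snd p) * ee (of_int (k2 p) * t)))\<^sup>2) \<le> real (coincidences (U2 \<times> Z) k2)"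
    proof (rule ravg_trig_sum_le[OF fin])
      fix i j assume "i \<in> U2 \<times> Z" "j \<in> U2 \<times> Z"
      then show "\<bar>k2 i - k2 j\<bar> < int (10 * N)" using r2[of i] r2[of j] N by linarith
    qed (use \<eta> in auto)
    also have "\<dots> \<le> real (A * z + D * z\<^sup>2)" using c2 by (simp only: of_nat_le_iff card c1 z_def)
    also have "\<dots> \<le> real N powr (1 / 2) * real z + 2 * real D * (real z)\<^sup>2"
    proof -
      have "real A * real z \<le> real N powr (1 / 2) * real z" by (intro mult_right_mono Ar) simp
      moreover have "0 \<le> real D * (real z)\<^sup>2" by simp
      ultimately show ?thesis unfolding of_nat_add of_nat_mult of_nat_power mult.assoc by linarith
    qed
    finally have fin_le: "ravg (10 * N) (\<lambda>t. (cmod (\<Sum>p\<in>U2 \<times> Z. \<eta> (snd p) * ee (of_int (k2 p) * t)))\<^sup>2)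
        \<le> real N powr (1 / 2) * real z + 2 * real D * (real z)\<^sup>2" .
    have "power_exp_sum 2 A t * power_exp_sum 4 B t ^ (s - 3) * (\<Sum>n\<in>Z. \<eta> n * ee (- (real n * t)))
        = (\<Sum>p\<in>U2 \<times> Z. \<eta> (snd p) * ee (of_int (k2 p) * t))" for t
    proof -
      have "power_exp_sum 2 A t * power_exp_sum 4 B t ^ (s - 3) * (\<Sum>n\<in>Z. \<eta> n * ee (- (real n * t)))
          = power_exp_sum 2 A t * (\<Sum>n\<in>Z. \<eta> n * ee (of_int (k1 n) * t))" by (simp add: True KK)
      then show ?thesis by (simp only: power_exp_sum_2_altdef U2_def[symmetric] square_sum_mult k2_def)
    qed
    then show ?thesis using fin_le N unfolding A_def[symmetric] B_def[symmetric] by (simp add: True z_def)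
  next
    case False
    then have s4: "s = 4" using s by simp
    define k2 where "k2 = (\<lambda>(u, i). (int u)\<^sup>2 + k1 i)"
    define k3 where "k3 = (\<lambda>(u, i). (int u)\<^sup>2 + k2 i)"
    have r2: "- int N \<le> k2 i \<and> k2 i \<le> int N" if "i \<in> U4 \<times> Z" for i
  proof -
    have "fst i \<in> U4" "snd i \<in> Z" using that by auto
    from b4[OF this(1)] r1[OF this(2)] show ?thesis unfolding k2_def case_prod_unfold by linarith
  qed
    have r3: "- int N \<le> k3 i \<and> k3 i \<le> 2 * int N" if "i \<in> U2 \<times> U4 \<times> Z" for i
  proof -
    have "fst i \<in> U2" "snd i \<in> U4 \<times> Z" using that by auto
    from b2[OF this(1)] r2[OF this(2)] show ?thesis unfolding k3_def case_prod_unfold by linarith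
  qed
    have fin: "finite (U4 \<times> Z)" "finite (U2 \<times> U4 \<times> Z)" using U finZ by auto
    have c2: "coincidences (U4 \<times> Z) k2 \<le> card U4 * coincidences Z k1 + D * (card Z)\<^sup>2"
      unfolding k2_def
  proof (rule coincidences_add_square[OF U(3,4) finZ D(1)])
    fix i j assume "i \<in> Z" "j \<in> Z"
    then show "\<bar>k1 i - k1 j\<bar> \<le> int (10 * N)" using r1[of i] r1[of j] by linarith
  qed auto
    have "coincidences (U2 \<times> U4 \<times> Z) k3 \<le> card U2 * coincidences (U4 \<times> Z) k2 + D * (card (U4 \<times> Z))\<^sup>2"
      unfolding k3_def
    proof (rule coincidences_add_square[OF U(1,2) fin(1) D(1)])
      fix i j assume "i \<in> U4 \<times> Z" "j \<in> U4 \<times> Z"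
      then show "\<bar>k2 i - k2 j\<bar> \<le> int (10 * N)" using r2[of i] r2[of j] by linarith
    qed auto
    also have "\<dots> \<le> A * (B * z + D * z\<^sup>2) + D * (B * z)\<^sup>2"
      using c2 by (intro add_mono) (auto simp: card c1 z_def card_cartesian_product)
    also have "\<dots> = A * B * z + D * z\<^sup>2 * (A + B\<^sup>2)" by (simp add: algebra_simps power2_eq_square)
    also have "\<dots> \<le> A * B * z + D * z\<^sup>2 * (A + A)" using AB by (intro add_mono mult_left_mono) auto
    finally have c3: "coincidences (U2 \<times> U4 \<times> Z) k3 \<le> A * B * z + D * z\<^sup>2 * (A + A)" .
    have "ravg (10 * N) (\<lambda>t. (cmod (\<Sum>p\<in>U2 \<times> U4 \<times> Z. \<eta> (snd (snd p)) * ee (of_int (k3 p) * t)))\<^sup>2) \<le> real (coincidences (U2 \<times> U4 \<times> Z) k3)"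
    proof (rule ravg_trig_sum_le[OF fin(2)])
      fix i j assume "i \<in> U2 \<times> U4 \<times> Z" "j \<in> U2 \<times> U4 \<times> Z"
      then show "\<bar>k3 i - k3 j\<bar> < int (10 * N)" using r3[of i] r3[of j] N by linarith
    qed (use \<eta> in auto)
    also have "\<dots> \<le> real (A * B * z + D * z\<^sup>2 * (A + A))" using c3 by (simp only: of_nat_le_iff)
    also have "\<dots> = real A * real B * real z + 2 * real D * real A * (real z)\<^sup>2" by (simp add: algebra_simps)
    also have "\<dots> \<le> real N powr (1 / 2) * real N powr (1 / 4) * real z + 2 * real D * real N powr (1 / 2) * (real z)\<^sup>2"
      using Ar Br by (intro add_mono mult_right_mono mult_left_mono mult_mono) auto
    also have "real N powr (1 / 2) * real N powr (1 / 4) = real N powr (3 / 4)" by (simp flip: powr_add)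
    finally have fin_le: "ravg (10 * N) (\<lambda>t. (cmod (\<Sum>p\<in>U2 \<times> U4 \<times> Z. \<eta> (snd (snd p)) * ee (of_int (k3 p) * t)))\<^sup>2)
        \<le> real N powr (3 / 4) * real z + 2 * real D * real N powr (1 / 2) * (real z)\<^sup>2" .
    have "power_exp_sum 2 A t * power_exp_sum 4 B t ^ (s - 3) * (\<Sum>n\<in>Z. \<eta> n * ee (- (real n * t)))
        = (\<Sum>p\<in>U2 \<times> U4 \<times> Z. \<eta> (snd (snd p)) * ee (of_int (k3 p) * t))" for t
    proof -
      have "power_exp_sum 4 B t * (\<Sum>n\<in>Z. \<eta> n * ee (- (real n * t))) = (\<Sum>p\<in>U4 \<times> Z. \<eta> (snd p) * ee (of_int (k2 p) * t))"
        unfolding KK by (simp only: power_exp_sum_4_altdef U4_def[symmetric] square_sum_mult k2_def)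
      then have "power_exp_sum 2 A t * power_exp_sum 4 B t ^ (s - 3) * (\<Sum>n\<in>Z. \<eta> n * ee (- (real n * t)))
          = power_exp_sum 2 A t * (\<Sum>p\<in>U4 \<times> Z. \<eta> (snd p) * ee (of_int (k2 p) * t))"
        by (simp add: s4 mult.assoc)
      then show ?thesis by (simp only: power_exp_sum_2_altdef U2_def[symmetric] square_sum_mult k3_def)
    qed
    then show ?thesis using fin_le unfolding A_def[symmetric] B_def[symmetric] by (simp add: s4 z_def)
  qed
qed

lemma minor_arcs_mean_le:
  assumes N: "N \<ge> 1" and D: "\<And>h. 0 < h \<Longrightarrow> h \<le> 10 * N \<Longrightarrow> card {d. d dvd h} \<le> D" "D \<ge> 1"
    and s: "s = 3 \<or> s = 4" and Z: "Z \<subseteq> {1..N}" and V: "V \<ge> 0"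
    and sup: "\<And>t. \<not> on_major_arc N T t \<Longrightarrow> cmod (power_exp_sum 4 (floor_root 4 N) t) \<le> V"
  shows "(\<Sum>n\<in>Z. cmod (avg (10 * N) (\<lambda>t. of_bool (\<not> on_major_arc N T t) * gen_exp_sum s N t * ee (- (real n * t)))))\<^sup>2
    \<le> V\<^sup>2 * (4 * real D * real N) * (real N powr ((real s - 1) / 4) * real (card Z) + 2 * real D * real N powr ((real s - 3) / 2) * (real (card Z))\<^sup>2)"
proof -
  define m where "m n = avg (10 * N) (\<lambda>t. of_bool (\<not> on_major_arc N T t) * gen_exp_sum s N t * ee (- (real n * t)))" for n
  \<comment> \<open>Conjugate signs make \<open>\<eta> n * m n\<close> the modulus of
    \<open>m n\<close>, so the sum of moduli becomes one average against \<open>K\<close>. Where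
    \<open>m n\<close> is 0 the coefficient is 0, which keeps the bound 1.\<close>
  define \<eta> where "\<eta> n = cnj (sgn (m n))" for n
  have \<eta>: "cmod (\<eta> n) \<le> 1" for n by (simp add: \<eta>_def norm_sgn)
  define K where "K t = (\<Sum>n\<in>Z. \<eta> n * ee (- (real n * t)))" for t
  define f2 f4 where "f2 = power_exp_sum 2 (floor_root 2 N)" and "f4 = power_exp_sum 4 (floor_root 4 N)"
  define g h where "g t = cmod (f2 t * f4 t ^ 2)" and "h t = cmod (f2 t * f4 t ^ (s - 3) * K t)" for t
  have "\<eta> n * m n = of_real (cmod (m n))" for n
    by (cases "m n = 0") (use complex_norm_square[of "m n"] in \<open>auto simp: \<eta>_def sgn_div_norm scaleR_conv_of_real field_simps power2_eq_square\<close>)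
  then have "of_real (\<Sum>n\<in>Z. cmod (m n)) = (\<Sum>n\<in>Z. \<eta> n * m n)" by simp
  also have "\<dots> = avg (10 * N) (\<lambda>t. \<Sum>n\<in>Z. \<eta> n * (of_bool (\<not> on_major_arc N T t) * gen_exp_sum s N t * ee (- (real n * t))))"
    by (simp add: m_def avg_sum avg_cmult)
  also have "\<dots> = avg (10 * N) (\<lambda>t. of_bool (\<not> on_major_arc N T t) * gen_exp_sum s N t * K t)"
    by (simp add: K_def sum_distrib_left mult_ac)
  finally have "cmod (of_real (\<Sum>n\<in>Z. cmod (m n))) \<le> ravg (10 * N) (\<lambda>t. cmod (of_bool (\<not> on_major_arc N T t) * gen_exp_sum s N t * K t))"
    using norm_avg_le by simp
  moreover have nn: "(\<Sum>n\<in>Z. cmod (m n)) \<ge> 0" by (intro sum_nonneg) auto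
  ultimately have "(\<Sum>n\<in>Z. cmod (m n)) \<le> ravg (10 * N) (\<lambda>t. cmod (of_bool (\<not> on_major_arc N T t) * gen_exp_sum s N t * K t))"
    by (simp only: norm_of_real abs_of_nonneg)
  also have "\<dots> \<le> ravg (10 * N) (\<lambda>t. V * (g t * h t))"
  proof (rule ravg_mono)
    fix b
    define t where "t = real b / real (10 * N)"
    have "cmod (of_bool (\<not> on_major_arc N T t) * gen_exp_sum s N t * K t) \<le> V * (g t * h t)"
    proof (cases "on_major_arc N T t")
      case True
      then show ?thesis using V by (simp add: g_def h_def)
    next
      case False
      \<comment> \<open>The exponent s = 1 + 2 + (s - 3) distributes f4 over the supremum, the first
        mean value and the second.\<close>
      have "f4 t ^ s = f4 t * f4 t ^ 2 * f4 t ^ (s - 3)" using s by (auto simp: eval_nat_numeral)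
      then have "gen_exp_sum s N t * K t = f4 t * ((f2 t * f4 t ^ 2) * (f2 t * f4 t ^ (s - 3) * K t))"
        by (simp add: gen_exp_sum_def f2_def f4_def power2_eq_square mult_ac)
      then have "cmod (gen_exp_sum s N t * K t) = cmod (f4 t) * (g t * h t)" unfolding g_def h_def norm_mult[symmetric] by (rule arg_cong)
      also have "\<dots> \<le> V * (g t * h t)"
        using sup[OF False] by (intro mult_right_mono) (auto simp: f4_def g_def h_def)
      finally show ?thesis using False by simp
    qed
    then show "cmod (of_bool (\<not> on_major_arc N T (real b / real (10 * N))) * gen_exp_sum s N (real b / real (10 * N)) * K (real b / real (10 * N)))
        \<le> V * (g (real b / real (10 * N)) * h (real b / real (10 * N)))"
      by (simp only: t_def)
  qed
  also have "\<dots> = V * ravg (10 * N) (\<lambda>t. g t * h t)" by (rule ravg_cmult)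
  finally have "(\<Sum>n\<in>Z. cmod (m n))\<^sup>2 \<le> (V * ravg (10 * N) (\<lambda>t. g t * h t))\<^sup>2" using nn by (intro power_mono)
  also have "\<dots> = V\<^sup>2 * (ravg (10 * N) (\<lambda>t. g t * h t))\<^sup>2" by (simp add: power_mult_distrib)
  also have "\<dots> \<le> V\<^sup>2 * (ravg (10 * N) (\<lambda>t. (g t)\<^sup>2) * ravg (10 * N) (\<lambda>t. (h t)\<^sup>2))"
    by (intro mult_left_mono ravg_Cauchy_Schwarz) auto
  also have "\<dots> \<le> V\<^sup>2 * ((4 * real D * real N) * (real N powr ((real s - 1) / 4) * real (card Z) + 2 * real D * real N powr ((real s - 3) / 2) * (real (card Z))\<^sup>2))"
  proof (intro mult_left_mono mult_mono)
    show "ravg (10 * N) (\<lambda>t. (g t)\<^sup>2) \<le> 4 * real D * real N"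
      unfolding g_def f2_def f4_def by (rule ravg_f2_f4_square_le[OF N D])
    show "ravg (10 * N) (\<lambda>t. (h t)\<^sup>2) \<le> real N powr ((real s - 1) / 4) * real (card Z) + 2 * real D * real N powr ((real s - 3) / 2) * (real (card Z))\<^sup>2"
      unfolding h_def f2_def f4_def K_def by (rule ravg_f2_exceptional_le[OF N D s Z \<eta>])
    show "ravg (10 * N) (\<lambda>t. (h t)\<^sup>2) \<ge> 0" by (rule ravg_nonneg) auto
  qed auto
  finally show ?thesis by (simp add: m_def mult.assoc)
qed

section \<open>The exceptional set\<close>

definition deviation :: "nat \<Rightarrow> nat \<Rightarrow> real"
  where "deviation s n = cmod (of_nat (R s n) - of_real (main_coeff s * Gamma (5 / 4) ^ 4) * singular_series s n
            * of_real (real n powr (real s / 4)))"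

definition minor_part :: "nat \<Rightarrow> nat \<Rightarrow> nat \<Rightarrow> nat \<Rightarrow> complex"
  where "minor_part s N T n = avg (10 * N) (\<lambda>t. of_bool (\<not> on_major_arc N T t) * gen_exp_sum s N t * ee (- (real n * t)))"

text \<open>The exponent 1/64 keeps the arcs disjoint and T^11 well below N^(1/4), while still
  giving a power saving in Weyl's inequality and in the tail of the singular series.\<close>

definition arc_level :: "nat \<Rightarrow> nat"
  where "arc_level N = nat \<lfloor>real N powr (1 / 64)\<rfloor>"

lemma arc_level_bounds:
  assumes "real N \<ge> 2 ^ 128"
  shows "arc_level N \<ge> 2" "real (arc_level N) \<le> real N powr (1 / 64)" "real N powr (1 / 64) \<le> 2 * real (arc_level N)"
    "2 * arc_level N ^ 6 < N" "arc_level N ^ 4 \<le> N"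
proof -
  define y where "y = real N powr (1 / 64)"
  \<comment> \<open>The threshold 2^128 makes N^(1/64) at least 4, so rounding down loses at most a
    factor 2.\<close>
  have "(2 ^ 128 :: real) powr (1 / 64) \<le> y" unfolding y_def using assms by (intro powr_mono2) auto
  moreover have "(2 ^ 128 :: real) powr (1 / 64) = 4"
    using powr_powr[of 2 128 "1 / 64"] by simp
  ultimately have y: "y \<ge> 4" by simp
  have N0: "real N > 0" using assms by (rule less_le_trans[rotated]) simp
  have y64: "y ^ 64 = real N" using N0 by (simp add: y_def powr_power)
  have fl: "real (arc_level N) = of_int \<lfloor>y\<rfloor>" using y by (simp add: arc_level_def y_def)
  show T1: "real (arc_level N) \<le> y" unfolding fl by simp
  have "real (arc_level N) \<ge> y - 1" unfolding fl by linarith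
  then show "y \<le> 2 * real (arc_level N)" using y by linarith
  then have "real (arc_level N) \<ge> 2" using y by linarith
  then show T2: "arc_level N \<ge> 2" by simp
  have "2 * real (arc_level N) ^ 6 \<le> 2 * y ^ 6" using T1 by (intro mult_left_mono power_mono) auto
  also have "\<dots> < y * y ^ 6" using y by (intro mult_strict_right_mono) auto
  also have "\<dots> = y ^ 7" by (simp add: eval_nat_numeral)
  also have "\<dots> \<le> y ^ 64" using y by (intro power_increasing) auto
  finally have "real (2 * arc_level N ^ 6) < real N" by (simp add: y64)
  then show "2 * arc_level N ^ 6 < N" by (simp only: of_nat_less_iff)
  have "real (arc_level N) ^ 4 \<le> y ^ 4" using T1 by (intro power_mono) auto
  also have "\<dots> \<le> y ^ 64" using y by (intro power_increasing) auto
  finally have "real (arc_level N ^ 4) \<le> real N" by (simp add: y64)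
  then show "arc_level N ^ 4 \<le> N" by (simp only: of_nat_le_iff)
qed

text \<open>Apart from the minor arcs all errors are smaller than N^(s/4 - 1/2000), hence negligible
  against N^(s/4) / \<open>\<psi>\<close>.\<close>

lemma deviation_le_minor_part:
  assumes s: "s = 3 \<or> s = 4"
  obtains N0 where "\<And>N n. N \<ge> N0 \<Longrightarrow> 1 \<le> n \<Longrightarrow> n \<le> N \<Longrightarrow>
    deviation s n \<le> cmod (minor_part s N (arc_level N) n) + real N powr (real s / 4 - 1 / 2000) / 8"
proof -
  obtain K where K: "K \<ge> 0"
    "\<And>s n Q. s \<ge> 3 \<Longrightarrow> Q \<ge> 1 \<Longrightarrow> cmod (singular_series s n - (\<Sum>q\<in>{1..Q}. singular_term s n q)) \<le> K * real Q powr - (1 / 20)"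
    "\<And>s n Q. s \<ge> 3 \<Longrightarrow> Q \<ge> 1 \<Longrightarrow> cmod (\<Sum>q\<in>{1..Q}. singular_term s n q) \<le> K"
    using singular_series_truncation by blast
  define c where "c = main_coeff s * Gamma (5 / 4) ^ 4"
  have c0: "c \<ge> 0" by (auto simp: c_def main_coeff_def)
  \<comment> \<open>Relative errors, in order: approximation on the arcs (T^11 N^(-1/4)), far ranges
    (1/T with a logarithm), the bounded error of the singular integral compared with N^(s/4) where s
    >= 3, and the tail T^(-1/20) of the singular series.\<close>
  define err where "err x = 43008 * x powr (11 / 64 - 1 / 4) + 162 * x powr - (1 / 64) * (2 + ln (x + 1))
    + K * c * x powr - (3 / 4) + 2 * c * K * x powr - (1 / 1280)" for x :: real
  have "((\<lambda>x. err x * x powr (1 / 2000)) \<longlongrightarrow> 0) at_top"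
  proof -
    have "((\<lambda>x::real. 43008 * x powr (11 / 64 - 1 / 4) * x powr (1 / 2000)) \<longlongrightarrow> 0) at_top" by real_asymp
    moreover have "((\<lambda>x::real. 162 * x powr - (1 / 64) * (2 + ln (x + 1)) * x powr (1 / 2000)) \<longlongrightarrow> 0) at_top" by real_asymp
    moreover have "((\<lambda>x::real. x powr - (3 / 4) * x powr (1 / 2000)) \<longlongrightarrow> 0) at_top" by real_asymp
    then have "((\<lambda>x::real. K * c * (x powr - (3 / 4) * x powr (1 / 2000))) \<longlongrightarrow> 0) at_top" by (rule tendsto_mult_right_zero)
    moreover have "((\<lambda>x::real. x powr - (1 / 1280) * x powr (1 / 2000)) \<longlongrightarrow> 0) at_top" by real_asymp
    then have "((\<lambda>x::real. 2 * c * K * (x powr - (1 / 1280) * x powr (1 / 2000))) \<longlongrightarrow> 0) at_top" by (rule tendsto_mult_right_zero)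
    ultimately have "((\<lambda>x::real. 43008 * x powr (11 / 64 - 1 / 4) * x powr (1 / 2000) + 162 * x powr - (1 / 64) * (2 + ln (x + 1)) * x powr (1 / 2000)
      + K * c * (x powr - (3 / 4) * x powr (1 / 2000)) + 2 * c * K * (x powr - (1 / 1280) * x powr (1 / 2000))) \<longlongrightarrow> 0 + 0 + 0 + 0) at_top"
      by (intro tendsto_add)
    then show ?thesis by (simp only: err_def distrib_right mult.assoc add_0_right)
  qed
  then have "\<forall>\<^sub>F x in at_top. err x * x powr (1 / 2000) < 1 / 8"
    by (rule order_tendstoD) simp
  then obtain x0 where x0: "\<And>x. x \<ge> x0 \<Longrightarrow> err x * x powr (1 / 2000) < 1 / 8"
    by (auto simp: eventually_at_top_linorder)
  show thesis
  proof (rule that[of "nat \<lceil>max x0 (2 ^ 128)\<rceil>"])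
    fix N n :: nat assume N: "N \<ge> nat \<lceil>max x0 (2 ^ 128)\<rceil>" and n: "1 \<le> n" "n \<le> N"
    have Nx: "real N \<ge> x0" "real N \<ge> 2 ^ 128"
      using N by (auto simp: nat_le_iff ceiling_le_iff)
    have N1: "real N \<ge> 1" using Nx(2) by (rule order_trans[rotated]) simp
    define x where "x = real N"
    define T where "T = arc_level N"
    note T = arc_level_bounds[OF Nx(2), folded T_def x_def]
    have T1: "T \<ge> 1" using T(1) by simp
    have x: "x \<ge> 1" using N1 by (simp add: x_def)
    define J where "J = Gamma (3 / 2) ^ 2 * Gamma (5 / 4) ^ s * poch_coeff (1 + real s / 4) n"
    define A where "A = (\<Sum>q\<in>{1..T}. singular_term s n q)"
    define S where "S = singular_series s n"
    define y where "y = real n powr (real s / 4)"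
    have s3: "s \<ge> 3" using s by auto
    have yx: "y \<le> x powr (real s / 4)" unfolding y_def x_def using n by (intro powr_mono2) auto
    have y0: "y \<ge> 0" by (simp add: y_def)
    have eq: "of_nat (R s n) - of_real c * S * of_real y = minor_part s N T n
      + ((of_nat (R s n) - minor_part s N T n - A * of_real J) + (A * of_real (J - c * y) - of_real c * of_real y * (S - A)))"
      by (simp add: algebra_simps)
    have "deviation s n = cmod (of_nat (R s n) - of_real c * S * of_real y)" by (simp add: deviation_def c_def S_def y_def)
    also have "\<dots> \<le> cmod (minor_part s N T n) + (cmod (of_nat (R s n) - minor_part s N T n - A * of_real J)
        + (cmod (A * of_real (J - c * y)) + cmod (of_real c * of_real y * (S - A))))"
      unfolding eq by (intro norm_triangle_le add_left_mono norm_triangle_le_diff) auto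
    also have "cmod (of_nat (R s n) - minor_part s N T n - A * of_real J)
        \<le> 43008 * real T ^ 11 * x powr (real s / 4 - 1 / 4) + 81 * x powr (real s / 4) / real T * (2 + ln (x + 1))"
      using major_arcs_approx[OF n(2) T1 T(4) s] sum_avg_approx[OF n(2), of s T] s N1
      unfolding minor_part_def A_def J_def x_def by auto
    also have "43008 * real T ^ 11 * x powr (real s / 4 - 1 / 4) \<le> x powr (real s / 4) * (43008 * x powr (11 / 64 - 1 / 4))"
    proof -
      have "real T ^ 11 \<le> (x powr (1 / 64)) ^ 11" using T(2) by (intro power_mono) auto
      also have "\<dots> = x powr (11 / 64)" using x by (simp add: powr_power)
      finally have "43008 * real T ^ 11 * x powr (real s / 4 - 1 / 4) \<le> 43008 * x powr (11 / 64) * x powr (real s / 4 - 1 / 4)"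
        by (intro mult_right_mono) auto
      also have "\<dots> = x powr (real s / 4) * (43008 * x powr (11 / 64 - 1 / 4))"
        by (simp flip: powr_add add: algebra_simps)
      finally show ?thesis .
    qed
    also have "81 * x powr (real s / 4) / real T * (2 + ln (x + 1)) \<le> x powr (real s / 4) * (162 * x powr - (1 / 64) * (2 + ln (x + 1)))"
    proof -
      have "1 / real T \<le> 2 * x powr - (1 / 64)"
        using T(3) T1 x by (simp add: powr_minus field_simps)
      then have "81 * x powr (real s / 4) * (1 / real T) * (2 + ln (x + 1)) \<le> 81 * x powr (real s / 4) * (2 * x powr - (1 / 64)) * (2 + ln (x + 1))"
        using x by (intro mult_right_mono mult_left_mono) auto
      then show ?thesis by simp
    qed
    also have "cmod (A * of_real (J - c * y)) \<le> x powr (real s / 4) * (K * c * x powr - (3 / 4))"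
    proof -
      have "cmod (A * of_real (J - c * y)) \<le> K * c"
        unfolding norm_mult norm_of_real
      proof (rule mult_mono)
        show "cmod A \<le> K" unfolding A_def by (rule K(3)[OF s3 T1])
        show "\<bar>J - c * y\<bar> \<le> c" using singular_integral_approx[OF s n(1)] by (simp add: J_def c_def y_def)
      qed (use K in auto)
      also have "\<dots> = K * c * x powr 0" using x by simp
      also have "\<dots> \<le> K * c * x powr (real s / 4 + - (3 / 4))"
        using x s K c0 by (intro mult_left_mono powr_mono) auto
      finally show ?thesis unfolding powr_add by (simp only: mult_ac)
    qed
    also have "cmod (of_real c * of_real y * (S - A)) \<le> x powr (real s / 4) * (2 * c * K * x powr - (1 / 1280))"
    proof -
      have "cmod (S - A) \<le> K * real T powr - (1 / 20)" unfolding S_def A_def by (rule K(2)[OF s3 T1])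
      also have "real T powr - (1 / 20) \<le> (x powr (1 / 64) / 2) powr - (1 / 20)"
        using T(3) x by (intro powr_mono2') auto
      also have "\<dots> = 2 powr (1 / 20) * x powr - (1 / 1280)"
        using x by (simp add: powr_divide powr_powr powr_minus field_simps)
      also have "(2::real) powr (1 / 20) \<le> 2 powr 1" by (intro powr_mono) auto
      finally have SA: "cmod (S - A) \<le> K * (2 * x powr - (1 / 1280))" using K(1) by (simp add: mult_left_mono mult_right_mono)
      have "cmod (of_real c * of_real y * (S - A)) = c * y * cmod (S - A)" using c0 y0 by (simp add: norm_mult)
      also have "\<dots> \<le> c * x powr (real s / 4) * (K * (2 * x powr - (1 / 1280)))"
        using SA yx c0 y0 by (intro mult_mono) auto
      finally show ?thesis by (simp add: mult_ac)
    qed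
    also have "x powr (real s / 4) * (43008 * x powr (11 / 64 - 1 / 4)) + x powr (real s / 4) * (162 * x powr - (1 / 64) * (2 + ln (x + 1)))
        + (x powr (real s / 4) * (K * c * x powr - (3 / 4)) + x powr (real s / 4) * (2 * c * K * x powr - (1 / 1280)))
        = x powr (real s / 4) * err x" by (simp add: err_def algebra_simps)
    also have "x powr (real s / 4) * err x \<le> x powr (real s / 4) * (x powr - (1 / 2000) / 8)"
    proof (rule mult_left_mono)
      have "err x * x powr (1 / 2000) < 1 / 8" using x0 Nx(1) by (simp add: x_def)
      moreover have "x powr (1 / 2000) > 0" using x by simp
      ultimately show "err x \<le> x powr - (1 / 2000) / 8" by (simp add: powr_minus field_simps)
    qed simp
    also have "x powr (real s / 4) * (x powr - (1 / 2000) / 8) = x powr (real s / 4 - 1 / 2000) / 8"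
      using powr_add[of x "real s / 4" "- (1 / 2000)"] by simp
    finally show "deviation s n \<le> cmod (minor_part s N (arc_level N) n) + real N powr (real s / 4 - 1 / 2000) / 8"
      by (simp add: x_def T_def)
  qed
qed

text \<open>Written as a square root so that the square of the bound, which is what enters the mean
  value estimate, has the clean form K N^(1/2 - 7/2000).\<close>

lemma norm_power_exp_sum_minor_le_powr:
  obtains K where "K \<ge> 0"
    "\<And>N t. real N \<ge> 2 ^ 128 \<Longrightarrow> \<not> on_major_arc N (arc_level N) t \<Longrightarrow> cmod (power_exp_sum 4 (floor_root 4 N) t) \<le> (K * real N powr (1 / 2 - 7 / 2000)) powr (1 / 2)"
proof -
  obtain C where C: "C \<ge> 1" "\<And>n. n \<ge> 1 \<Longrightarrow> real (max_divisor_count n) \<le> C * real n powr (1 / 2000)"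
    using max_divisor_count_le_powr[of "1 / 2000"] by auto
  define K where "K = 120000 * C\<^sup>2 * 2001 * 2"
  have K: "K \<ge> 0" by (simp add: K_def)
  show thesis
  proof (rule that[of "K powr (1 / 4)"])
    fix N t assume N: "real N \<ge> 2 ^ 128" and t: "\<not> on_major_arc N (arc_level N) t"
    define x where "x = real N"
    have x: "x \<ge> 1" unfolding x_def using N by (rule order_trans[rotated]) simp
    then have N1: "N \<ge> 1" by (simp add: x_def)
    define T where "T = arc_level N"
    note T = arc_level_bounds[OF N, folded T_def x_def]
    define f where "f = cmod (power_exp_sum 4 (floor_root 4 N) t)"
    have "f ^ 8 \<le> 120000 * x\<^sup>2 * (real (max_divisor_count N))\<^sup>2 * (1 + ln x) / real T"
      unfolding f_def x_def using t
      by (intro norm_power_exp_sum_minor_le[OF _ T(1,5)] card_divisors_le_max_divisor_count max_divisor_count_ge_1 N1) (auto simp: T_def)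
    also have "\<dots> = 120000 * x\<^sup>2 * (real (max_divisor_count N))\<^sup>2 * (1 + ln x) * (1 / real T)" by simp
    also have "\<dots> \<le> 120000 * x\<^sup>2 * (C * x powr (1 / 2000))\<^sup>2 * (2001 * x powr (1 / 2000)) * (2 * x powr - (1 / 64))"
    proof (intro mult_mono)
      show "(real (max_divisor_count N))\<^sup>2 \<le> (C * x powr (1 / 2000))\<^sup>2"
        using C(2)[OF N1] by (intro power_mono) (auto simp: x_def)
      show "1 + ln x \<le> 2001 * x powr (1 / 2000)" using one_plus_ln_le_powr[of "1 / 2000" x] x by simp
      show "1 / real T \<le> 2 * x powr - (1 / 64)"
        using T(1,3) x by (simp add: powr_minus field_simps)
    qed (use x in auto)
    also have "\<dots> = K * (x powr 2 * (x powr (1 / 2000) * x powr (1 / 2000)) * x powr (1 / 2000) * x powr - (1 / 64))"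
      using x by (simp add: K_def power_mult_distrib power2_eq_square del: powr_mult_base)
    also have "\<dots> = K * x powr (2 + (1 / 2000 + 1 / 2000) + 1 / 2000 + - (1 / 64))" by (simp only: powr_add)
    \<comment> \<open>Losses 3/2000 against the saving 1/64 = 31.25/2000 leave 28.25/2000 in the
      eighth power, hence 7/2000 in the square.\<close>
    also have "\<dots> \<le> K * x powr (4 * (1 / 2 - 7 / 2000))" using K x by (intro mult_left_mono powr_mono) auto
    finally have "(f ^ 8) powr (1 / 8) \<le> (K * x powr (4 * (1 / 2 - 7 / 2000))) powr (1 / 8)"
      by (intro powr_mono2) (auto simp: f_def)
    moreover have "(f ^ 8) powr (1 / 8) = f"
      using powr_powr[of f 8 "1 / 8"] by (cases "f = 0") (auto simp: f_def)
    moreover have "(K * x powr (4 * (1 / 2 - 7 / 2000))) powr (1 / 8) = (K powr (1 / 4) * x powr (1 / 2 - 7 / 2000)) powr (1 / 2)"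
      using K by (simp add: powr_mult powr_powr)
    ultimately show "cmod (power_exp_sum 4 (floor_root 4 N) t) \<le> (K powr (1 / 4) * real N powr (1 / 2 - 7 / 2000)) powr (1 / 2)"
      by (simp add: f_def x_def)
  qed simp
qed

text \<open>The mean value bound is an inequality between z^2 and a combination of z and z^2. The
  saving 7/2000 exceeds the losses in the z^2 term, so that term moves to the left; dividing by z
  finishes. A fixed value \<Psi> replaces the function here.\<close>

lemma card_dyadic_exceptional_le:
  assumes s: "s = 3 \<or> s = 4"
  obtains C N0 where "C \<ge> 0" "\<And>N \<Psi>. N \<ge> N0 \<Longrightarrow> 1 \<le> \<Psi> \<Longrightarrow> \<Psi> \<le> real N powr (1 / 2000) \<Longrightarrow>
    real (card {n. N < 2 * n \<and> n \<le> N \<and> deviation s n > real n powr (real s / 4) * inverse \<Psi>})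
      \<le> C * \<Psi>\<^sup>2 * real N powr ((5 - real s) / 4)"
proof -
  obtain N1 where N1: "\<And>N n. N \<ge> N1 \<Longrightarrow> 1 \<le> n \<Longrightarrow> n \<le> N \<Longrightarrow>
    deviation s n \<le> cmod (minor_part s N (arc_level N) n) + real N powr (real s / 4 - 1 / 2000) / 8"
    using deviation_le_minor_part[OF s] by blast
  obtain K where K: "K \<ge> 0"
    "\<And>N t. real N \<ge> 2 ^ 128 \<Longrightarrow> \<not> on_major_arc N (arc_level N) t \<Longrightarrow> cmod (power_exp_sum 4 (floor_root 4 N) t) \<le> (K * real N powr (1 / 2 - 7 / 2000)) powr (1 / 2)"
    using norm_power_exp_sum_minor_le_powr by blast
  obtain C' where C': "C' \<ge> 1" "\<And>n. n \<ge> 1 \<Longrightarrow> real (max_divisor_count n) \<le> C' * real n powr (1 / 2000)"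
    using max_divisor_count_le_powr[of "1 / 2000"] by auto
  \<comment> \<open>The factor 2 absorbs 10^(1/2000), since divisors are counted up to 10N.\<close>
  define C where "C = 2 * C'"
  have C: "C \<ge> 1" using C' by (simp add: C_def)
  \<comment> \<open>64 = 4 * 16, the 16 coming from the square of 4 \<Psi>.\<close>
  define K3 where "K3 = 64 * C * K"
  have K3: "K3 \<ge> 0" using C K by (simp add: K3_def)
  have "((\<lambda>x::real. x powr - (3 / 2000)) \<longlongrightarrow> 0) at_top" by real_asymp
  then have "((\<lambda>x::real. 2 * K3 * C * x powr - (3 / 2000)) \<longlongrightarrow> 0) at_top" by (rule tendsto_mult_right_zero)
  then have "\<forall>\<^sub>F x in at_top. 2 * K3 * C * x powr - (3 / 2000) < 1 / 2" by (rule order_tendstoD) simp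
  then obtain x0 where x0: "\<And>x. x \<ge> x0 \<Longrightarrow> 2 * K3 * C * x powr - (3 / 2000) < 1 / 2"
    by (auto simp: eventually_at_top_linorder)
  show thesis
  proof (rule that[of "2 * K3" "max N1 (nat \<lceil>max x0 (2 ^ 128)\<rceil>)"])
    show "2 * K3 \<ge> 0" using K3 by simp
    fix N \<Psi> assume N: "N \<ge> max N1 (nat \<lceil>max x0 (2 ^ 128)\<rceil>)" and \<Psi>: "1 \<le> \<Psi>" "\<Psi> \<le> real N powr (1 / 2000)"
    define x where "x = real N"
    have Nx: "x \<ge> x0" "real N \<ge> 2 ^ 128" "N \<ge> N1"
      using N by (auto simp: nat_le_iff ceiling_le_iff x_def)
    have x: "x \<ge> 1" unfolding x_def using Nx(2) by (rule order_trans[rotated]) simp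
    then have N_ge: "N \<ge> 1" by (simp add: x_def)
    define Z where "Z = {n. N < 2 * n \<and> n \<le> N \<and> deviation s n > real n powr (real s / 4) * inverse \<Psi>}"
    define z where "z = real (card Z)"
    have ZN: "Z \<subseteq> {1..N}" using N_ge by (auto simp: Z_def)
    define D where "D = max_divisor_count (10 * N)"
    have D1: "D \<ge> 1" using max_divisor_count_ge_1[of "10 * N"] N_ge by (simp add: D_def)
    have DC: "real D \<le> C * x powr (1 / 2000)"
    proof -
      have "real D \<le> C' * real (10 * N) powr (1 / 2000)" unfolding D_def using N_ge by (intro C'(2)) simp
      also have "real (10 * N) powr (1 / 2000) = 10 powr (1 / 2000) * x powr (1 / 2000)"
        by (simp add: x_def powr_mult)
      also have "(10::real) powr (1 / 2000) \<le> 2"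
      proof -
        have "(10::real) powr (1 / 2000) \<le> 16 powr (1 / 2000)" by (intro powr_mono2) auto
        also have "\<dots> \<le> 16 powr (1 / 4)" by (intro powr_mono) auto
        also have "(16::real) powr (1 / 4) = 2" using powr_powr[of 2 4 "1 / 4"] by simp
        finally show ?thesis .
      qed
      finally show ?thesis using C' by (simp add: C_def mult_left_mono mult_right_mono mult_ac)
    qed
    define V where "V = (K * x powr (1 / 2 - 7 / 2000)) powr (1 / 2)"
    have V2: "V\<^sup>2 = K * x powr (1 / 2 - 7 / 2000)" unfolding V_def using K(1) by (simp add: powr_half_sqrt)
    define m where "m n = cmod (minor_part s N (arc_level N) n)" for n
    \<comment> \<open>As n > N/2, passing from n^(s/4) to N^(s/4) costs at most 2, and the error
      N^(-1/2000) / 8 is at most 1 / (8 \<Psi>). A quarter of N^(s/4) / \<Psi> therefore remains for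
      the minor arcs.\<close>
    have big: "x powr (real s / 4) / (4 * \<Psi>) \<le> m n" if n: "n \<in> Z" for n
    proof -
      have nN: "N < 2 * n" "1 \<le> n" "n \<le> N" using n ZN by (auto simp: Z_def)
      have "x powr (real s / 4) \<le> (2 * real n) powr (real s / 4)"
        unfolding x_def using nN by (intro powr_mono2) auto
      also have "\<dots> = 2 powr (real s / 4) * real n powr (real s / 4)" by (simp add: powr_mult)
      also have "\<dots> \<le> 2 powr 1 * real n powr (real s / 4)" using s by (intro mult_right_mono powr_mono) auto
      finally have "x powr (real s / 4) * inverse \<Psi> \<le> 2 * real n powr (real s / 4) * inverse \<Psi>"
        using \<Psi> by (intro mult_right_mono) auto
      also have "2 * real n powr (real s / 4) * inverse \<Psi> \<le> 2 * deviation s n" using n by (simp add: Z_def)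
      also have "\<dots> \<le> 2 * (m n + x powr (real s / 4 - 1 / 2000) / 8)"
        unfolding m_def x_def by (intro mult_left_mono N1 Nx nN) auto
      finally have 1: "x powr (real s / 4) * inverse \<Psi> \<le> 2 * m n + x powr (real s / 4 - 1 / 2000) / 4" by simp
      have "x powr - (1 / 2000) \<le> inverse \<Psi>"
        unfolding powr_minus using \<Psi> by (intro le_imp_inverse_le) (auto simp: x_def)
      then have "x powr (real s / 4) * x powr - (1 / 2000) \<le> x powr (real s / 4) * inverse \<Psi>"
        by (intro mult_left_mono) auto
      then have 2: "x powr (real s / 4 - 1 / 2000) \<le> x powr (real s / 4) * inverse \<Psi>"
        by (simp flip: powr_add)
      have "0 \<le> x powr (real s / 4) * inverse \<Psi>" using \<Psi> by simp
      with 1 2 have "x powr (real s / 4) * inverse \<Psi> \<le> 4 * m n" by linarith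
      then show ?thesis using \<Psi> by (simp add: field_simps)
    qed
    have "z * (x powr (real s / 4) / (4 * \<Psi>)) \<le> (\<Sum>n\<in>Z. m n)"
      unfolding z_def by (rule sum_bounded_below[OF big])
    then have "(z * (x powr (real s / 4) / (4 * \<Psi>)))\<^sup>2 \<le> (\<Sum>n\<in>Z. m n)\<^sup>2"
      using \<Psi> by (intro power_mono) (auto simp: z_def)
    also have "\<dots> \<le> V\<^sup>2 * (4 * real D * x) * (x powr ((real s - 1) / 4) * z + 2 * real D * x powr ((real s - 3) / 2) * z\<^sup>2)"
      unfolding m_def minor_part_def x_def z_def
      by (rule minor_arcs_mean_le[OF N_ge _ D1 s ZN])
         (use K(2)[OF Nx(2)] card_divisors_le_max_divisor_count in \<open>auto simp: V_def x_def D_def\<close>)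
    also have "\<dots> \<le> (K * x powr (1 / 2 - 7 / 2000)) * (4 * (C * x powr (1 / 2000)) * x powr 1)
        * (x powr ((real s - 1) / 4) * z + 2 * (C * x powr (1 / 2000)) * x powr ((real s - 3) / 2) * z\<^sup>2)"
      unfolding V2 using DC K C x
      by (intro mult_mono add_mono mult_nonneg_nonneg add_nonneg_nonneg) (auto simp: z_def)
    also have "\<dots> = 4 * C * K * ((x powr (1 / 2 - 7 / 2000) * x powr (1 / 2000) * x powr 1 * x powr ((real s - 1) / 4)) * z)
        + 8 * C * C * K * ((x powr (1 / 2 - 7 / 2000) * x powr (1 / 2000) * x powr 1 * x powr (1 / 2000) * x powr ((real s - 3) / 2)) * z\<^sup>2)"
      by (simp add: algebra_simps)
    also have "x powr (1 / 2 - 7 / 2000) * x powr (1 / 2000) * x powr 1 * x powr ((real s - 1) / 4) = x powr (real s / 2) * x powr ((5 - real s) / 4 - 6 / 2000)"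
      unfolding powr_add[symmetric] by (rule arg_cong[where f = "\<lambda>e. x powr e"]) (simp add: field_simps)
    also have "x powr (1 / 2 - 7 / 2000) * x powr (1 / 2000) * x powr 1 * x powr (1 / 2000) * x powr ((real s - 3) / 2) = x powr (real s / 2) * x powr - (5 / 2000)"
      unfolding powr_add[symmetric] by (rule arg_cong[where f = "\<lambda>e. x powr e"]) (simp add: field_simps)
    finally have main: "(z * (x powr (real s / 4) / (4 * \<Psi>)))\<^sup>2 \<le>
        4 * C * K * (x powr (real s / 2) * x powr ((5 - real s) / 4 - 6 / 2000) * z) + 8 * C * C * K * (x powr (real s / 2) * x powr - (5 / 2000) * z\<^sup>2)" .
    define w where "w = x powr (real s / 2)"
    have w: "w > 0" using x by (simp add: w_def)
    have "(x powr (real s / 4))\<^sup>2 = w" using x by (simp add: w_def powr_power)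
    then have e1: "(z * (x powr (real s / 4) / (4 * \<Psi>)))\<^sup>2 = w * (z\<^sup>2 / (16 * \<Psi>\<^sup>2))"
      by (simp add: power_mult_distrib power_divide)
    have e2: "4 * C * K * (x powr (real s / 2) * x powr ((5 - real s) / 4 - 6 / 2000) * z) + 8 * C * C * K * (x powr (real s / 2) * x powr - (5 / 2000) * z\<^sup>2)
        = w * (K3 / 16 * x powr ((5 - real s) / 4 - 6 / 2000) * z + 2 * K3 * C / 16 * x powr - (5 / 2000) * z\<^sup>2)"
      by (simp add: w_def K3_def algebra_simps)
    have "z\<^sup>2 / (16 * \<Psi>\<^sup>2) \<le> K3 / 16 * x powr ((5 - real s) / 4 - 6 / 2000) * z + 2 * K3 * C / 16 * x powr - (5 / 2000) * z\<^sup>2"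
      using main w unfolding e1 e2 by (simp only: mult_le_cancel_left_pos)
    then have "16 * \<Psi>\<^sup>2 * (z\<^sup>2 / (16 * \<Psi>\<^sup>2)) \<le> 16 * \<Psi>\<^sup>2 * (K3 / 16 * x powr ((5 - real s) / 4 - 6 / 2000) * z + 2 * K3 * C / 16 * x powr - (5 / 2000) * z\<^sup>2)"
      by (intro mult_left_mono) auto
    then have "z\<^sup>2 \<le> K3 * \<Psi>\<^sup>2 * x powr ((5 - real s) / 4 - 6 / 2000) * z + 2 * K3 * C * x powr - (5 / 2000) * \<Psi>\<^sup>2 * z\<^sup>2"
      using \<Psi> by (simp add: algebra_simps)
    also have "K3 * \<Psi>\<^sup>2 * x powr ((5 - real s) / 4 - 6 / 2000) * z \<le> K3 * \<Psi>\<^sup>2 * x powr ((5 - real s) / 4) * z"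
    proof -
      have "(5 - real s) / 4 - 6 / 2000 \<le> (5 - real s) / 4" by linarith
      then show ?thesis using K3 x by (intro mult_right_mono mult_left_mono powr_mono) (simp_all add: z_def)
    qed
    \<comment> \<open>The absorption: the quadratic term carries x^(-5/2000), and \<Psi>^2 gives
      back at most x^(2/2000).\<close>
    also have "2 * K3 * C * x powr - (5 / 2000) * \<Psi>\<^sup>2 * z\<^sup>2 \<le> 1 / 2 * z\<^sup>2"
    proof (rule mult_right_mono)
      have "\<Psi>\<^sup>2 \<le> (x powr (1 / 2000))\<^sup>2" using \<Psi> by (intro power_mono) (auto simp: x_def)
      also have "\<dots> = x powr (2 / 2000)" using x by (simp add: powr_power)
      finally have "2 * K3 * C * x powr - (5 / 2000) * \<Psi>\<^sup>2 \<le> 2 * K3 * C * x powr - (5 / 2000) * x powr (2 / 2000)"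
        using K3 C by (intro mult_left_mono) auto
      also have "\<dots> = 2 * K3 * C * x powr - (3 / 2000)" by (simp flip: powr_add add: mult.assoc)
      also have "\<dots> \<le> 1 / 2" using x0[OF Nx(1)] by simp
      finally show "2 * K3 * C * x powr - (5 / 2000) * \<Psi>\<^sup>2 \<le> 1 / 2" .
    qed simp
    finally have "z * z \<le> 2 * K3 * \<Psi>\<^sup>2 * x powr ((5 - real s) / 4) * z" by (simp add: power2_eq_square)
    then have "z \<le> 2 * K3 * \<Psi>\<^sup>2 * x powr ((5 - real s) / 4)"
      using K3 by (cases "z = 0") (auto simp: z_def)
    then show "real (card {n. N < 2 * n \<and> n \<le> N \<and> deviation s n > real n powr (real s / 4) * inverse \<Psi>})
      \<le> 2 * K3 * \<Psi>\<^sup>2 * real N powr ((5 - real s) / 4)" by (simp add: z_def Z_def x_def)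
  qed
qed

text \<open>Induction by halving N. The constant G = C / (1 - 2^(-\<alpha>)) satisfies G
  2^(-\<alpha>) + C = G, so the step closes exactly; below N1 everything is counted.\<close>

lemma card_exceptional_le:
  fixes C \<alpha> :: real and P :: "nat \<Rightarrow> bool"
  assumes C: "C \<ge> 0" and \<alpha>: "\<alpha> > 0"
    and dy: "\<And>N. N > N1 \<Longrightarrow> real (card {n. N < 2 * n \<and> n \<le> N \<and> P n}) \<le> C * real N powr \<alpha>"
  shows "real (card {n. 1 \<le> n \<and> n \<le> N \<and> P n}) \<le> real N1 + C / (1 - 2 powr - \<alpha>) * real N powr \<alpha>"
proof (induction N rule: less_induct)
  case (less N)
  define r where "r = (2::real) powr - \<alpha>"
  have r: "0 \<le> r" "r < 1" using \<alpha> by (auto simp: r_def powr_less_one)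
  define G where "G = C / (1 - r)"
  have G: "G \<ge> 0" using C r by (simp add: G_def)
  have fin: "finite {n. 1 \<le> n \<and> n \<le> N \<and> P n}" for N by (rule finite_subset[of _ "{..N}"]) auto
  show ?case
  proof (cases "N \<le> N1")
    case True
    have "card {n. 1 \<le> n \<and> n \<le> N \<and> P n} \<le> card {1..N}" by (intro card_mono) auto
    then have "real (card {n. 1 \<le> n \<and> n \<le> N \<and> P n}) \<le> real N1" using True by simp
    also have "\<dots> \<le> real N1 + G * real N powr \<alpha>" using G by simp
    finally show ?thesis by (simp add: G_def r_def)
  next
    case False
    have "{n. 1 \<le> n \<and> n \<le> N \<and> P n} \<subseteq> {n. 1 \<le> n \<and> n \<le> N div 2 \<and> P n} \<union> {n. N < 2 * n \<and> n \<le> N \<and> P n}" by auto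
    then have "card {n. 1 \<le> n \<and> n \<le> N \<and> P n} \<le> card ({n. 1 \<le> n \<and> n \<le> N div 2 \<and> P n} \<union> {n. N < 2 * n \<and> n \<le> N \<and> P n})"
      by (rule card_mono[rotated]) (use fin[of "N div 2"] in auto)
    also have "\<dots> \<le> card {n. 1 \<le> n \<and> n \<le> N div 2 \<and> P n} + card {n. N < 2 * n \<and> n \<le> N \<and> P n}" by (rule card_Un_le)
    finally have "real (card {n. 1 \<le> n \<and> n \<le> N \<and> P n}) \<le> real (card {n. 1 \<le> n \<and> n \<le> N div 2 \<and> P n}) + real (card {n. N < 2 * n \<and> n \<le> N \<and> P n})"
      by simp
    also have "\<dots> \<le> (real N1 + G * real (N div 2) powr \<alpha>) + C * real N powr \<alpha>"
      unfolding G_def r_def using less[of "N div 2"] False dy[of N] by (intro add_mono) auto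
    also have "\<dots> \<le> (real N1 + G * (real N / 2) powr \<alpha>) + C * real N powr \<alpha>"
      using \<alpha> G C by (intro add_mono mult_left_mono powr_mono2) auto
    also have "(real N / 2) powr \<alpha> = r * real N powr \<alpha>" by (simp add: r_def powr_divide powr_minus field_simps)
    also have "real N1 + G * (r * real N powr \<alpha>) + C * real N powr \<alpha> = real N1 + G * real N powr \<alpha>"
    proof -
      have "C = G * (1 - r)" using r by (simp add: G_def)
      then show ?thesis by (simp only:) (simp add: algebra_simps)
    qed
    finally show ?thesis unfolding G_def r_def .
  qed
qed

text \<open>Monotonicity lets the single value \<Psi> = \<open>\<psi> X\<close> replace
  \<open>\<psi>\<close> at every large n <= X, since this only lowers the threshold and enlarges the
  exceptional set. The dyadic estimate then applies with the same \<Psi> to all blocks above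
  X^(1/4).\<close>

lemma exceptional_bound:
  fixes \<psi> :: "real \<Rightarrow> real"
  assumes s: "s = 3 \<or> s = 4"
    and mono: "mono_on {0<..} \<psi>" and top: "filterlim \<psi> at_top at_top"
    and O: "\<psi> \<in> O[at_top](\<lambda>t. t powr (1 / 16000))"
  obtains K where "\<forall>\<^sub>F X in at_top. real (E s \<psi> X) \<le> K * (X powr ((5 - real s) / 4) * \<psi> X ^ 2)"
proof -
  obtain C N0 where C: "C \<ge> 0" "\<And>N \<Psi>. N \<ge> N0 \<Longrightarrow> 1 \<le> \<Psi> \<Longrightarrow> \<Psi> \<le> real N powr (1 / 2000) \<Longrightarrow>
    real (card {n. N < 2 * n \<and> n \<le> N \<and> deviation s n > real n powr (real s / 4) * inverse \<Psi>})
      \<le> C * \<Psi>\<^sup>2 * real N powr ((5 - real s) / 4)"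
    using card_dyadic_exceptional_le[OF s] by blast
  define \<alpha> where "\<alpha> = (5 - real s) / 4"
  have \<alpha>: "\<alpha> \<ge> 1 / 4" using s by (auto simp: \<alpha>_def)
  obtain c where c: "\<forall>\<^sub>F X in at_top. norm (\<psi> X) \<le> c * norm (X powr (1 / 16000))"
    using O by (elim landau_o.bigE) auto
  have "\<forall>\<^sub>F X in at_top. \<psi> X \<ge> 1" using top by (simp add: filterlim_at_top)
  then obtain X1 where X1: "\<And>X. X \<ge> X1 \<Longrightarrow> \<psi> X \<ge> 1" by (auto simp: eventually_at_top_linorder)
  \<comment> \<open>Beyond \<open>n1\<close> the function is at least 1, so taking inverses reverses
    the order; smaller n are counted trivially.\<close>
  define n1 where "n1 = nat \<lceil>max X1 1\<rceil>"
  define G where "G = C / (1 - 2 powr - \<alpha>)"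
  have G: "G \<ge> 0" unfolding G_def using C \<alpha> powr_less_one[of 2 "- \<alpha>"] by (intro divide_nonneg_nonneg) auto
  have "\<forall>\<^sub>F X in at_top. X \<ge> max 1 X1 \<and> norm (\<psi> X) \<le> c * norm (X powr (1 / 16000)) \<and> c * X powr (1 / 16000) \<le> X powr (1 / 8000) \<and> real n1 + real N0 \<le> X powr (1 / 4)"
  proof (intro eventually_conj c eventually_ge_at_top)
    have "filterlim (\<lambda>X::real. X powr (1 / 16000)) at_top at_top" by real_asymp
    then have "\<forall>\<^sub>F X::real in at_top. X powr (1 / 16000) \<ge> c" by (simp add: filterlim_at_top)
    \<comment> \<open>Doubling the exponent from 1/16000 to 1/8000 absorbs the implied
      constant.\<close>
    then show "\<forall>\<^sub>F X::real in at_top. c * X powr (1 / 16000) \<le> X powr (1 / 8000)"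
    proof eventually_elim
      case (elim X)
      then have "c * X powr (1 / 16000) \<le> X powr (1 / 16000) * X powr (1 / 16000)" by (intro mult_right_mono) auto
      then show ?case by (simp flip: powr_add)
    qed
    have "filterlim (\<lambda>X::real. X powr (1 / 4)) at_top at_top" by real_asymp
    then show "\<forall>\<^sub>F X::real in at_top. real n1 + real N0 \<le> X powr (1 / 4)" by (simp add: filterlim_at_top)
  qed
  then have "\<forall>\<^sub>F X in at_top. real (E s \<psi> X) \<le> (2 + G) * (X powr \<alpha> * \<psi> X ^ 2)"
  proof eventually_elim
    case (elim X)
    define \<Psi> where "\<Psi> = \<psi> X"
    have X: "X \<ge> 1" "X \<ge> X1" and big: "real n1 + real N0 \<le> X powr (1 / 4)" using elim by auto
    have \<Psi>1: "\<Psi> \<ge> 1" using X1[OF X(2)] by (simp add: \<Psi>_def)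
    have \<Psi>X: "\<Psi> \<le> X powr (1 / 8000)" using elim abs_ge_self[of "\<psi> X"] by (simp add: \<Psi>_def)
    define N where "N = nat \<lfloor>X\<rfloor>"
    have NX: "real N \<le> X" "real n \<le> X \<longleftrightarrow> n \<le> N" for n using X by (auto simp: N_def le_nat_iff le_floor_iff)
    define P where "P n \<longleftrightarrow> deviation s n > real n powr (real s / 4) * inverse \<Psi>" for n
    \<comment> \<open>A block with M > X^(1/4) has M^(1/2000) >= X^(1/8000) >= \<Psi>, as the dyadic
      bound demands. The integers below contribute at most X^(1/4), which is harmless because (5 -
      s)/4 >= 1/4.\<close>
    define N1 where "N1 = max N0 (nat \<lfloor>X powr (1 / 4)\<rfloor>)"
    have N1: "real N1 \<le> X powr (1 / 4)"
    proof -
      have "real (nat \<lfloor>X powr (1 / 4)\<rfloor>) \<le> X powr (1 / 4)" by simp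
      moreover have "real N0 \<le> X powr (1 / 4)" using big by simp
      ultimately show ?thesis unfolding N1_def by (simp add: max_def)
    qed
    have dy: "real (card {n. M < 2 * n \<and> n \<le> M \<and> P n}) \<le> (C * \<Psi>\<^sup>2) * real M powr \<alpha>" if M: "M > N1" for M
      unfolding P_def \<alpha>_def
    proof (rule C(2)[OF _ \<Psi>1])
      show "M \<ge> N0" using M by (simp add: N1_def)
      have "nat \<lfloor>X powr (1 / 4)\<rfloor> < M" using M by (simp add: N1_def)
      then have "X powr (1 / 4) \<le> real M" by linarith
      then have "(X powr (1 / 4)) powr (1 / 2000) \<le> real M powr (1 / 2000)" by (intro powr_mono2) auto
      then show "\<Psi> \<le> real M powr (1 / 2000)" using \<Psi>X by (simp add: powr_powr)
    qed
    have "real (card {n. 1 \<le> n \<and> n \<le> N \<and> P n}) \<le> real N1 + (C * \<Psi>\<^sup>2) / (1 - 2 powr - \<alpha>) * real N powr \<alpha>"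
      by (rule card_exceptional_le[OF _ _ dy]) (use C \<alpha> in auto)
    also have "(C * \<Psi>\<^sup>2) / (1 - 2 powr - \<alpha>) * real N powr \<alpha> = G * \<Psi>\<^sup>2 * real N powr \<alpha>" by (simp add: G_def)
    also have "\<dots> \<le> G * \<Psi>\<^sup>2 * X powr \<alpha>" using G NX \<alpha> by (intro mult_left_mono powr_mono2) auto
    finally have cP: "real (card {n. 1 \<le> n \<and> n \<le> N \<and> P n}) \<le> real N1 + G * \<Psi>\<^sup>2 * X powr \<alpha>" by simp
    have "{n :: nat. 1 \<le> n \<and> real n \<le> X \<and> deviation s n > real n powr (real s / 4) * inverse (\<psi> (real n))}
      \<subseteq> {1..n1} \<union> {n. 1 \<le> n \<and> n \<le> N \<and> P n}"
    proof
      fix n assume n: "n \<in> {n :: nat. 1 \<le> n \<and> real n \<le> X \<and> deviation s n > real n powr (real s / 4) * inverse (\<psi> (real n))}"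
      show "n \<in> {1..n1} \<union> {n. 1 \<le> n \<and> n \<le> N \<and> P n}"
      proof (cases "n \<le> n1")
        case True
        then show ?thesis using n by auto
      next
        case False
        then have "real n \<ge> X1" unfolding n1_def by linarith
        then have p1: "\<psi> (real n) \<ge> 1" by (rule X1)
        have "\<psi> (real n) \<le> \<Psi>"
          unfolding \<Psi>_def using n X by (intro mono_onD[OF mono]) auto
        then have "inverse \<Psi> \<le> inverse (\<psi> (real n))" using p1 by (intro le_imp_inverse_le) auto
        then have "real n powr (real s / 4) * inverse \<Psi> \<le> real n powr (real s / 4) * inverse (\<psi> (real n))"
          by (intro mult_left_mono) auto
        moreover have "real n powr (real s / 4) * inverse (\<psi> (real n)) < deviation s n" using n by blast
        ultimately have "P n" unfolding P_def by (rule le_less_trans)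
        then show ?thesis using n NX(2) by auto
      qed
    qed
    then have "card {n :: nat. 1 \<le> n \<and> real n \<le> X \<and> deviation s n > real n powr (real s / 4) * inverse (\<psi> (real n))}
        \<le> card ({1..n1} \<union> {n. 1 \<le> n \<and> n \<le> N \<and> P n})"
      by (rule card_mono[rotated]) (auto intro: finite_subset[of _ "{..N}"])
    also have "\<dots> \<le> card {1..n1} + card {n. 1 \<le> n \<and> n \<le> N \<and> P n}" by (rule card_Un_le)
    finally have "E s \<psi> X \<le> n1 + card {n. 1 \<le> n \<and> n \<le> N \<and> P n}"
      unfolding E_def deviation_def by simp
    then have "real (E s \<psi> X) \<le> real n1 + (real N1 + G * \<Psi>\<^sup>2 * X powr \<alpha>)" using cP by linarith
    also have "\<dots> \<le> 2 * X powr (1 / 4) + G * \<Psi>\<^sup>2 * X powr \<alpha>" using N1 big by linarith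
    also have "X powr (1 / 4) \<le> X powr \<alpha> * \<Psi>\<^sup>2"
    proof -
      have "X powr (1 / 4) \<le> X powr \<alpha>" using X \<alpha> by (intro powr_mono) auto
      also have "X powr \<alpha> \<le> X powr \<alpha> * \<Psi>\<^sup>2"
        using mult_left_mono[of 1 "\<Psi>\<^sup>2" "X powr \<alpha>"] \<Psi>1 by simp
      finally show ?thesis .
    qed
    finally show ?case by (simp add: \<Psi>_def algebra_simps)
  qed
  then show thesis using that by (simp add: \<alpha>_def)
qed

theorem theorem1p2:
  "\<exists>\<delta>>0. \<forall>\<psi> :: real \<Rightarrow> real.
     mono_on {0<..} \<psi> \<longrightarrow> filterlim \<psi> at_top at_top \<longrightarrow> \<psi> \<in> O[at_top](\<lambda>t. t powr \<delta>) \<longrightarrow>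
     (\<forall>\<epsilon>>0. (\<lambda>X. real (E 3 \<psi> X)) \<in> O[at_top](\<lambda>X. X powr (1 / 2 + \<epsilon>) * \<psi> X ^ 2) \<and>
            (\<lambda>X. real (E 4 \<psi> X)) \<in> O[at_top](\<lambda>X. X powr (1 / 4 + \<epsilon>) * \<psi> X ^ 4))"
proof (rule exI[of _ "1 / 16000"], intro conjI allI impI)
  fix \<psi> :: "real \<Rightarrow> real" and \<epsilon> :: real
  assume \<psi>: "mono_on {0<..} \<psi>" "filterlim \<psi> at_top at_top" "\<psi> \<in> O[at_top](\<lambda>t. t powr (1 / 16000))" and \<epsilon>: "\<epsilon> > 0"
  have ge1: "\<forall>\<^sub>F X in at_top. \<psi> X \<ge> 1 \<and> X \<ge> 1"
    using \<psi>(2) by (intro eventually_conj eventually_ge_at_top) (simp add: filterlim_at_top)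
  obtain K where "\<forall>\<^sub>F X in at_top. real (E 3 \<psi> X) \<le> K * (X powr ((5 - real 3) / 4) * \<psi> X ^ 2)"
    using exceptional_bound[of 3, OF _ \<psi>] by auto
  then show "(\<lambda>X. real (E 3 \<psi> X)) \<in> O[at_top](\<lambda>X. X powr (1 / 2 + \<epsilon>) * \<psi> X ^ 2)"
    using ge1
  proof (intro bigoI[where c = "\<bar>K\<bar>"], eventually_elim)
    case (elim X)
    have "real (E 3 \<psi> X) \<le> K * (X powr (1 / 2) * \<psi> X ^ 2)" using elim by simp
    also have "\<dots> \<le> \<bar>K\<bar> * (X powr (1 / 2 + \<epsilon>) * \<psi> X ^ 2)"
      using elim \<epsilon> by (intro mult_mono powr_mono) auto
    finally show ?case by simp
  qed
  obtain K where "\<forall>\<^sub>F X in at_top. real (E 4 \<psi> X) \<le> K * (X powr ((5 - real 4) / 4) * \<psi> X ^ 2)"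
    using exceptional_bound[of 4, OF _ \<psi>] by auto
  then show "(\<lambda>X. real (E 4 \<psi> X)) \<in> O[at_top](\<lambda>X. X powr (1 / 4 + \<epsilon>) * \<psi> X ^ 4)"
    using ge1
  proof (intro bigoI[where c = "\<bar>K\<bar>"], eventually_elim)
    case (elim X)
    have "real (E 4 \<psi> X) \<le> K * (X powr (1 / 4) * \<psi> X ^ 2)" using elim by simp
    \<comment> \<open>Here \<open>\<psi> X ^ 2\<close> is at most \<open>\<psi> X ^ 4\<close>, since
      \<open>\<psi> X\<close> is eventually at least 1.\<close>
    also have "\<dots> \<le> \<bar>K\<bar> * (X powr (1 / 4 + \<epsilon>) * \<psi> X ^ 4)"
      using elim \<epsilon> by (intro mult_mono powr_mono power_increasing) auto
    finally show ?case by simp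
  qed
qed simp

end
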